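(* Let $L$ be a nonsolvable Lie algebra of dimension $6$ over a finite field $k$ of characteristic $p\ge 3$. Assume that $\dim\operatorname{rad}(L)=3$ and that the extension $$0\to \operatorname{rad}(L)\to L\to L/\operatorname{rad}(L)\to 0$$ does not split. Then $p=3$, and $L$ is one of the following algebras. (I) $L$ has a basis $(e,h,f,v_0,v_1,z)$ with $z$ central and multiplication $$\begin{array}{llll} [h,e]=-e+v_1, & [h,v_0]=v_0, & [e,v_0]=\alpha z, & [f,v_0]=v_1,\\ {}[h,f]=f, & [h,v_1]=-v_1, & [e,v_1]=v_0, & [f,v_1]=0,\\ {}[e,f]=h, & [v_0,v_1]=\beta z, & & \end{array}$$ where one of the following occurs: $\alpha=\beta=0$; or $\alpha=0,\ \beta=1$; or $\alpha=1,\ \beta=0$. (II) $L$ has a 5-dimensional ideal $L_1$ (spanned by $e,h,f,v_0,v_1$) and a basis $(d,e,h,f,v_0,v_1)$ with multiplication $$\begin{array}{llll} [h,e]=-e+v_1, & [h,v_0]=v_0, & [e,v_0]=0, & [f,v_0]=v_1,\\ {}[h,f]=f, & [h,v_1]=-v_1, & [e,v_1]=v_0, & [f,v_1]=0,\\ {}[e,f]=h, & [v_0,v_1]=0, & & \end{array}$$ and $$[d,e]=v_1,\quad [d,h]=[d,f]=[d,v_0]=[d,v_1]=0,$$ or $$[d,f]=v_0,\quad [d,h]=[d,e]=[d,v_0]=[d,v_1]=0.$$ These algebras are mutually nonisomorphic.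
   Context: $\operatorname{rad}(L)$ is the solvable radical of $L$. The extension $0\to \operatorname{rad}(L)\to L\to L/\operatorname{rad}(L)\to 0$ splits if $L$ contains a subalgebra mapped isomorphically onto $L/\operatorname{rad}(L)$. *)

theory Defs
  imports Complex_Main
begin

text \<open>
  Bilinear products with \<open>[x, x] = 0\<close>. The Jacobi identity is kept separate, so that one can speak
  of the algebra given by a multiplication table without knowing that the table defines a Lie algebra.
\<close>

locale alternating_algebra = vector_space scale
  for scale :: "'k::field \<Rightarrow> 'l::ab_group_add \<Rightarrow> 'l" +
  fixes bracket :: "'l \<Rightarrow> 'l \<Rightarrow> 'l"
  assumes bracket_add_left: "bracket (x + y) w = bracket x w + bracket y w"
    and bracket_add_right: "bracket w (x + y) = bracket w x + bracket w y"
    and bracket_scale_left: "bracket (scale c x) y = scale c (bracket x y)"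
    and bracket_scale_right: "bracket x (scale c y) = scale c (bracket x y)"
    and bracket_self: "bracket x x = 0"
begin

definition subalgebra :: "'l set \<Rightarrow> bool" where
  "subalgebra S \<longleftrightarrow> subspace S \<and> (\<forall>x\<in>S. \<forall>y\<in>S. bracket x y \<in> S)"

definition ideal :: "'l set \<Rightarrow> bool" where
  "ideal I \<longleftrightarrow> subspace I \<and> (\<forall>x. \<forall>y\<in>I. bracket x y \<in> I)"

primrec derived_series :: "'l set \<Rightarrow> nat \<Rightarrow> 'l set" where
  "derived_series S 0 = S"
| "derived_series S (Suc n) =
     span {bracket x y | x y. x \<in> derived_series S n \<and> y \<in> derived_series S n}"

definition solvable :: "'l set \<Rightarrow> bool" where
  "solvable S \<longleftrightarrow> (\<exists>n. derived_series S n = {0})"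

text \<open>The sum of all solvable ideals; in finite dimension, the largest solvable ideal.\<close>

definition radical :: "'l set" where
  "radical = span (\<Union>{I. ideal I \<and> solvable I})"

text \<open>The canonical projection onto the quotient by \<open>I\<close>, with cosets as elements of the quotient.\<close>

definition coset :: "'l set \<Rightarrow> 'l \<Rightarrow> 'l set" where
  "coset I x = (\<lambda>y. x + y) ` I"

text \<open>
  The operations of the quotient by the radical are those induced by the projection, which is
  therefore a homomorphism. So its restriction to a subalgebra is an isomorphism onto the quotient
  as soon as it is bijective.
\<close>

definition radical_extension_splits :: bool where
  "radical_extension_splits \<longleftrightarrow>
     (\<exists>S. subalgebra S \<and> bij_betw (coset radical) S (range (coset radical)))"

definition is_basis :: "'l list \<Rightarrow> bool" where
  "is_basis bs \<longleftrightarrow> distinct bs \<and> independent (set bs) \<and> span (set bs) = UNIV"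

end

locale lie_algebra = alternating_algebra +
  assumes jacobi:
    "bracket x (bracket y w) + bracket y (bracket w x) + bracket w (bracket x y) = 0"

definition algebra_isomorphic ::
    "('k::field \<Rightarrow> 'a::ab_group_add \<Rightarrow> 'a) \<Rightarrow> ('a \<Rightarrow> 'a \<Rightarrow> 'a) \<Rightarrow>
     ('k \<Rightarrow> 'b::ab_group_add \<Rightarrow> 'b) \<Rightarrow> ('b \<Rightarrow> 'b \<Rightarrow> 'b) \<Rightarrow> bool" where
  "algebra_isomorphic scale1 bracket1 scale2 bracket2 \<longleftrightarrow>
     (\<exists>\<phi>. Vector_Spaces.linear scale1 scale2 \<phi> \<and> bij \<phi> \<and>
          (\<forall>x y. \<phi> (bracket1 x y) = bracket2 (\<phi> x) (\<phi> y)))"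

datatype 'k mult_table =
    Table_I 'k 'k  \<comment> \<open>the parameters \<open>\<alpha>\<close> and \<open>\<beta>\<close>\<close>
  | Table_II_e     \<comment> \<open>\<open>[d, e] = v\<^sub>1\<close>\<close>
  | Table_II_f     \<comment> \<open>\<open>[d, f] = v\<^sub>0\<close>\<close>

context alternating_algebra
begin

text \<open>The products of \<open>e, h, f, v\<^sub>0, v\<^sub>1\<close>, where \<open>a = [e, v\<^sub>0]\<close> and \<open>b = [v\<^sub>0, v\<^sub>1]\<close>.\<close>

definition core_products :: "'l \<Rightarrow> 'l \<Rightarrow> 'l \<Rightarrow> 'l \<Rightarrow> 'l \<Rightarrow> 'l \<Rightarrow> 'l \<Rightarrow> bool" where
  "core_products e h f v0 v1 a b \<longleftrightarrow>
     bracket h e = - e + v1 \<and> bracket h v0 = v0 \<and> bracket e v0 = a \<and> bracket f v0 = v1 \<and>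
     bracket h f = f \<and> bracket h v1 = - v1 \<and> bracket e v1 = v0 \<and> bracket f v1 = 0 \<and>
     bracket e f = h \<and> bracket v0 v1 = b"

fun has_table :: "'k mult_table \<Rightarrow> bool" where
  "has_table (Table_I \<alpha> \<beta>) \<longleftrightarrow>
     (\<exists>e h f v0 v1 z. is_basis [e, h, f, v0, v1, z] \<and> (\<forall>x. bracket z x = 0) \<and>
        core_products e h f v0 v1 (scale \<alpha> z) (scale \<beta> z))"
| "has_table Table_II_e \<longleftrightarrow>
     (\<exists>d e h f v0 v1. is_basis [d, e, h, f, v0, v1] \<and>
        ideal (span {e, h, f, v0, v1}) \<and> dim (span {e, h, f, v0, v1}) = 5 \<and>
        core_products e h f v0 v1 0 0 \<and>
        bracket d e = v1 \<and> bracket d h = 0 \<and> bracket d f = 0 \<and> bracket d v0 = 0 \<and> bracket d v1 = 0)"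
| "has_table Table_II_f \<longleftrightarrow>
     (\<exists>d e h f v0 v1. is_basis [d, e, h, f, v0, v1] \<and>
        ideal (span {e, h, f, v0, v1}) \<and> dim (span {e, h, f, v0, v1}) = 5 \<and>
        core_products e h f v0 v1 0 0 \<and>
        bracket d f = v0 \<and> bracket d h = 0 \<and> bracket d e = 0 \<and> bracket d v0 = 0 \<and> bracket d v1 = 0)"

end

definition classification_tables :: "'k::field mult_table set" where
  "classification_tables = {Table_I 0 0, Table_I 0 1, Table_I 1 0, Table_II_e, Table_II_f}"

end

theory Submission
  imports Defs
begin

text \<open>
  Let \<open>R\<close> be the radical. The quotient \<open>L/R\<close> is perfect of dimension three, and because a ternary
  quadratic form over a finite field is isotropic, it contains a nonzero ad-nilpotent element; hence
  it is \<open>sl\<^sub>2\<close> (\<open>exists_sl2_modulo\<close>). Everything else is done inside \<open>L\<close> by means of a \<^emph>\<open>minimal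
  supplement\<close> \<open>P\<close>: a subalgebra with \<open>P + R = L\<close> that contains no smaller one. Put \<open>A = P \<inter> R\<close>; the
  extension splits if and only if some supplement has \<open>A = 0\<close>.

  Minimality replaces cohomology. Lifts of the generators \<open>e, f\<close> of \<open>sl\<^sub>2\<close> act nilpotently on \<open>P\<close>,
  since the generalized null space of \<open>ad e\<close> is a supplement (\<open>ad_nilpotent\<close>); every one-dimensional
  section of \<open>A\<close> is acted on trivially, since \<open>P\<close> is its own derived algebra; and \<open>A\<close> has no \<open>P\<close>-ideal
  of codimension one, since central extensions of \<open>sl\<^sub>2\<close> split (\<open>no_ideal_of_codimension_one\<close>). So if
  \<open>Z\<close> is a maximal \<open>P\<close>-ideal below \<open>A\<close>, then \<open>A/Z\<close> is an irreducible \<open>sl\<^sub>2\<close>-module of dimension two or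
  three, and \<open>Z\<close> is central of dimension at most one. In dimension three the Casimir element is
  invertible on \<open>A\<close> and produces a complement (\<open>casimir_splitting\<close>). In dimension two \<open>A/Z\<close> is the
  natural module with weights \<open>1\<close> and \<open>-1\<close>. The defects \<open>[h, e] - 2e\<close> and \<open>[h, f] + 2f\<close> have weights
  \<open>2\<close> and \<open>-2\<close>, so that they can be removed unless \<open>2 = -1\<close>: the characteristic is three
  (\<open>characteristic_three\<close>).

  In characteristic three two scalars \<open>a, b\<close> remain, the coordinates of the extension class in
  \<open>H\<^sup>2(sl\<^sub>2, V)\<close>, a Frobenius twist of the natural module \<open>V\<close>. As cubing is bijective on a finite field
  of characteristic three, the automorphisms of \<open>sl\<^sub>2\<close> and the scalars on \<open>V\<close> move the class to
  \<open>(1, 0)\<close> (\<open>normal_form\<close>). If \<open>Z \<noteq> 0\<close>, then \<open>P = L\<close> and the first table results with \<open>\<beta> = 0\<close>. If \<open>Z = 0\<close>, then \<open>L\<close> is spanned by \<open>P\<close>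
  and one further element, which acts on \<open>P\<close> through a class in \<open>H\<^sup>1(sl\<^sub>2, V)\<close>; up to automorphisms
  this class is zero, parallel or transversal to the extension class, and these cases give the direct
  product with a line and the tables with \<open>[d, e] = v\<^sub>1\<close> and \<open>[d, f] = v\<^sub>0\<close>.

  The five tables are separated by being perfect, having a centre, satisfying the Jacobi identity,
  and containing, outside the derived algebra, an element that commutes with a suitable pair \<open>h, f\<close>.
\<close>

section \<open>Quadratic equations over a finite field\<close>

text \<open>
  A square has at most two square roots, and zero has only one.
\<close>

lemma card_squares:
  assumes "(2::'k::{field,finite}) \<noteq> 0"
  shows "card (UNIV::'k set) < 2 * card (range (\<lambda>x::'k. x * x))"
proof -
  let ?S = "range (\<lambda>x::'k. x * x)"
  let ?F = "\<lambda>y. {x::'k. x * x = y}"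
  have fib: "card (?F y) \<le> 2" for y
  proof (cases "?F y = {}")
    case False
    then obtain r where r: "r * r = y" by blast
    have "?F y \<subseteq> {r, -r}"
    proof
      fix x assume "x \<in> ?F y"
      then have "(x - r) * (x + r) = 0" using r by (simp add: algebra_simps)
      then show "x \<in> {r, -r}" by (auto simp: add_eq_0_iff2)
    qed
    then have "card (?F y) \<le> card {r, -r}" by (intro card_mono) auto
    also have "\<dots> \<le> 2" by (simp add: card_insert_if)
    finally show ?thesis .
  qed (simp add: card_eq_0_iff)
  have zero: "?F 0 = {0}" by auto
  have mem0: "(0::'k) \<in> ?S" by force
  have un: "(UNIV::'k set) = (\<Union>y\<in>?S. ?F y)" by auto
  have "card (UNIV::'k set) = (\<Sum>y\<in>?S. card (?F y))"
    by (subst un, subst card_UN_disjoint) auto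
  also have "\<dots> = card (?F 0) + (\<Sum>y\<in>?S - {0}. card (?F y))"
    by (rule sum.remove) (use mem0 in auto)
  also have "\<dots> \<le> 1 + (\<Sum>y\<in>?S - {0}. 2)"
    using fib by (intro add_mono sum_mono) (simp_all add: zero)
  also have "\<dots> < 2 * card ?S"
  proof -
    have "card ?S > 0" using mem0 by (auto simp: card_gt_0_iff)
    then show ?thesis using mem0 by (simp add: card_Diff_singleton)
  qed
  finally show ?thesis .
qed

text \<open>
  The values of \<open>p x\<^sup>2\<close> and those of \<open>c - y\<^sup>2\<close> each make up more than half of the field, so some value
  is common to both.
\<close>

lemma binary_quadratic_form_represents:
  assumes two: "(2::'k::{field,finite}) \<noteq> 0" and "p \<noteq> (0::'k)"
  shows "\<exists>x y. p * x * x + y * y = c"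
proof -
  let ?S = "range (\<lambda>x::'k. x * x)"
  let ?X = "(\<lambda>s. p * s) ` ?S" and ?Y = "(\<lambda>s. c - s) ` ?S"
  have cX: "card ?X = card ?S" by (rule card_image) (use assms in \<open>auto simp: inj_on_def\<close>)
  have cY: "card ?Y = card ?S" by (rule card_image) (auto simp: inj_on_def)
  have "?X \<inter> ?Y \<noteq> {}"
  proof
    assume "?X \<inter> ?Y = {}"
    then have "card (?X \<union> ?Y) = 2 * card ?S" using cX cY by (subst card_Un_disjoint) auto
    moreover have "card (?X \<union> ?Y) \<le> card (UNIV::'k set)" by (intro card_mono) auto
    ultimately show False using card_squares[OF two] by simp
  qed
  then obtain x y where "p * (x * x) = c - y * y" by auto
  then show ?thesis by (intro exI[of _ x] exI[of _ y]) (simp add: algebra_simps)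
qed

lemma ternary_quadratic_form_isotropic:
  fixes A B C D E F :: "'k::{field,finite}"
  assumes two: "(2::'k) \<noteq> 0"
  shows "\<exists>x y z. (x, y, z) \<noteq> (0, 0, 0) \<and>
    A * x * x + B * y * y + C * z * z + 2 * D * x * y + 2 * E * x * z + 2 * F * y * z = 0"
proof (cases "A = 0")
  case True
  then show ?thesis by (intro exI[of _ 1] exI[of _ 0]) simp
next
  case A: False
  define P G H where "P = A * B - D * D" and "G = A * C - E * E" and "H = A * F - D * E"
  let ?Q = "\<lambda>x y z. A * x * x + B * y * y + C * z * z + 2 * D * x * y + 2 * E * x * z + 2 * F * y * z"
  \<comment> \<open>Completing the square twice diagonalizes the form; \<open>P\<close> is the second leading minor of its matrix,
    and \<open>P * G - H * H\<close> is \<open>A\<close> times the determinant.\<close>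
  have sq: "P * A * ?Q x y z = P * (A * x + D * y + E * z) * (A * x + D * y + E * z)
      + (P * y + H * z) * (P * y + H * z) + (P * G - H * H) * z * z" for x y z
    unfolding P_def G_def H_def by algebra
  show ?thesis
  proof (cases "P = 0")
    case True
    have "A * ?Q (- D) A 0 = 0"
      using True unfolding P_def by algebra
    then show ?thesis using A by (intro exI[of _ "- D"] exI[of _ A] exI[of _ 0]) simp
  next
    case False
    obtain X Y where XY: "P * X * X + Y * Y = - (P * G - H * H)"
      using binary_quadratic_form_represents[OF two False] by blast
    define y where "y = (Y - H) / P"
    define x where "x = (X - D * y - E) / A"
    have 1: "P * y + H * 1 = Y" using False by (simp add: y_def)
    have 2: "A * x + D * y + E * 1 = X" using A by (simp add: x_def)
    have "P * A * ?Q x y 1 = 0" unfolding sq 1 2 using XY by simp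
    then show ?thesis using A False by (intro exI[of _ x] exI[of _ y] exI[of _ 1]) simp
  qed
qed

section \<open>Brackets, ideals and the radical\<close>

context alternating_algebra
begin

lemma bracket_zero_left [simp]: "bracket 0 x = 0"
  using bracket_add_left[of 0 0 x] by simp

lemma bracket_zero_right [simp]: "bracket x 0 = 0"
  using bracket_add_right[of x 0 0] by simp

lemma bracket_minus_left: "bracket (- x) y = - bracket x y"
  using bracket_add_left[of x "- x" y] by (simp add: eq_neg_iff_add_eq_0 add.commute)

lemma bracket_minus_right: "bracket x (- y) = - bracket x y"
  using bracket_add_right[of x y "- y"] by (simp add: eq_neg_iff_add_eq_0 add.commute)

lemma bracket_diff_left: "bracket (x - y) w = bracket x w - bracket y w"
  using bracket_add_left[of x "- y" w] by (simp add: bracket_minus_left)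

lemma bracket_diff_right: "bracket w (x - y) = bracket w x - bracket w y"
  using bracket_add_right[of w x "- y"] by (simp add: bracket_minus_right)

lemmas bracket_linear = bracket_add_left bracket_add_right bracket_diff_left bracket_diff_right
  bracket_minus_left bracket_minus_right bracket_scale_left bracket_scale_right bracket_self

lemma bracket_anticommute: "bracket y x = - bracket x y"
proof -
  have "bracket y x + bracket x y = bracket (x + y) (x + y)"
    unfolding bracket_add_left bracket_add_right by (simp add: bracket_self)
  then show ?thesis by (simp add: bracket_self eq_neg_iff_add_eq_0)
qed

lemmas scale_linear = scale_right_distrib scale_left_distrib scale_right_diff_distrib
  scale_left_diff_distrib scale_minus_left scale_minus_right

lemma subspace_add_cancel: "subspace S \<Longrightarrow> x - y \<in> S \<Longrightarrow> y \<in> S \<Longrightarrow> x \<in> S"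
  using subspace_add[of S "x - y" y] by simp

lemma derived_series_mono: "S \<subseteq> T \<Longrightarrow> derived_series S n \<subseteq> derived_series T n"
  by (induction n) (auto intro!: span_mono)

lemma derived_series_add: "derived_series S (m + n) = derived_series (derived_series S m) n"
  by (induction n) auto

lemma zero_in_derived_series: "0 \<in> S \<Longrightarrow> 0 \<in> derived_series S n"
  by (cases n) (auto simp: span_zero)

lemma solvable_iff: "0 \<in> S \<Longrightarrow> solvable S \<longleftrightarrow> (\<exists>n. derived_series S n \<subseteq> {0})"
  unfolding solvable_def using zero_in_derived_series by blast

lemma solvable_by_derived: "0 \<in> S \<Longrightarrow> derived_series S n \<subseteq> T \<Longrightarrow> solvable T \<Longrightarrow> solvable S"
proof -
  assume S: "0 \<in> S" "derived_series S n \<subseteq> T" and "solvable T"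
  then obtain m where "derived_series T m = {0}" unfolding solvable_def by blast
  then have "derived_series S (n + m) \<subseteq> {0}"
    using derived_series_mono[OF S(2), of m] by (simp add: derived_series_add)
  then show ?thesis using solvable_iff[OF S(1)] by blast
qed

lemma ideal_left: "ideal I \<Longrightarrow> y \<in> I \<Longrightarrow> bracket y x \<in> I"
  unfolding ideal_def by (metis bracket_anticommute subspace_neg)

lemma ideal_right: "ideal I \<Longrightarrow> y \<in> I \<Longrightarrow> bracket x y \<in> I"
  unfolding ideal_def by blast

lemma ideal_subspace: "ideal I \<Longrightarrow> subspace I"
  unfolding ideal_def by blast

lemma ideal_sum:
  assumes "ideal I" "ideal J" shows "ideal {x + y | x y. x \<in> I \<and> y \<in> J}"
  unfolding ideal_def
proof (intro conjI allI ballI)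
  show "subspace {x + y | x y. x \<in> I \<and> y \<in> J}"
    using assms by (intro subspace_sums) (auto simp: ideal_def)
  fix w z assume "z \<in> {x + y | x y. x \<in> I \<and> y \<in> J}"
  then obtain x y where "z = x + y" "x \<in> I" "y \<in> J" by blast
  then show "bracket w z \<in> {x + y | x y. x \<in> I \<and> y \<in> J}"
    using ideal_right[OF assms(1), of x w] ideal_right[OF assms(2), of y w]
    by (metis (mono_tags, lifting) bracket_add_right mem_Collect_eq)
qed

text \<open>
  Modulo the ideal \<open>J\<close>, brackets of elements of \<open>I + J\<close> are brackets of elements of \<open>I\<close>; hence the sum
  of two solvable ideals is solvable.
\<close>

lemma derived_series_sum:
  assumes "ideal I" "ideal J"
  shows "derived_series {x + y | x y. x \<in> I \<and> y \<in> J} n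
    \<subseteq> {x + y | x y. x \<in> derived_series I n \<and> y \<in> J}"
proof (induction n)
  case (Suc n)
  let ?D = "{x + y | x y. x \<in> derived_series I (Suc n) \<and> y \<in> J}"
  have sub: "subspace ?D" using assms by (intro subspace_sums) (auto simp: ideal_def)
  have "bracket u w \<in> ?D" if uw: "u \<in> derived_series {x + y | x y. x \<in> I \<and> y \<in> J} n"
    "w \<in> derived_series {x + y | x y. x \<in> I \<and> y \<in> J} n" for u w
  proof -
    obtain x y where u: "u = x + y" "x \<in> derived_series I n" "y \<in> J" using Suc.IH uw(1) by blast
    obtain x' y' where w: "w = x' + y'" "x' \<in> derived_series I n" "y' \<in> J"
      using Suc.IH uw(2) by blast
    have "bracket u w = bracket x x' + (bracket x y' + bracket y w)"
      by (simp add: u w bracket_linear)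
    moreover have "bracket x x' \<in> derived_series I (Suc n)"
      using u(2) w(2) by (auto intro!: span_base)
    moreover have "bracket x y' + bracket y w \<in> J"
      using subspace_add[OF ideal_subspace] ideal_left ideal_right assms(2) u(3) w(3) by simp
    ultimately show ?thesis by blast
  qed
  then have "{bracket u w | u w. u \<in> derived_series {x + y | x y. x \<in> I \<and> y \<in> J} n \<and>
      w \<in> derived_series {x + y | x y. x \<in> I \<and> y \<in> J} n} \<subseteq> ?D" by blast
  from span_minimal[OF this sub] show ?case by simp
qed simp

lemma solvable_sum:
  assumes "ideal I" "ideal J" "solvable I" "solvable J"
  shows "solvable {x + y | x y. x \<in> I \<and> y \<in> J}"
proof -
  obtain n where "derived_series I n = {0}" using assms(3) unfolding solvable_def by blast
  then have "derived_series {x + y | x y. x \<in> I \<and> y \<in> J} n \<subseteq> J"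
    using derived_series_sum[OF assms(1,2), of n] by auto
  moreover have "0 \<in> {x + y | x y. x \<in> I \<and> y \<in> J}"
    using ideal_subspace[OF ideal_sum[OF assms(1,2)]] by (rule subspace_0)
  ultimately show ?thesis using solvable_by_derived[OF _ _ assms(4)] by simp
qed

lemma solvable_ideal_subset_radical: "ideal I \<Longrightarrow> solvable I \<Longrightarrow> I \<subseteq> radical"
  unfolding radical_def using span_superset[of "\<Union>{I. ideal I \<and> solvable I}"] by auto

text \<open>
  A solvable ideal of largest cardinality absorbs every other one, because the sum of the two is again
  a solvable ideal. So the radical is that ideal.
\<close>

lemma radical_is_solvable_ideal:
  assumes fin: "finite (UNIV :: 'l set)"
  shows "ideal radical" "solvable radical"
proof -
  let ?P = "\<lambda>I. ideal I \<and> solvable I"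
  have "ideal {0}" by (simp add: ideal_def)
  moreover have "solvable {0}" unfolding solvable_def by (rule exI[of _ 0]) simp
  ultimately have ex: "?P {0}" by blast
  have "\<forall>I. ?P I \<longrightarrow> card I < Suc (card (UNIV :: 'l set))" by (simp add: card_mono fin less_Suc_eq_le)
  then obtain M where M: "?P M" and max: "\<forall>I. ?P I \<longrightarrow> card I \<le> card M"
    using ex_has_greatest_nat[where P = ?P and f = card, OF ex] by blast
  have "I \<subseteq> M" if I: "?P I" for I
  proof -
    let ?S = "{x + y | x y. x \<in> I \<and> y \<in> M}"
    have S: "x + y \<in> ?S" if "x \<in> I" "y \<in> M" for x y using that by auto
    have 0: "0 \<in> I" "0 \<in> M" using subspace_0[OF ideal_subspace] I M by auto
    have "M \<subseteq> ?S" using S[OF 0(1)] by auto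
    moreover have "card ?S \<le> card M" using I M max ideal_sum solvable_sum by simp
    moreover have "finite ?S" using fin by (rule finite_subset[OF subset_UNIV])
    ultimately have eq: "M = ?S" by (intro card_seteq)
    show ?thesis using S[OF _ 0(2)] unfolding eq[symmetric] by auto
  qed
  then have "\<Union>{I. ?P I} = M" using M by (intro antisym Union_least Union_upper) auto
  then have "radical = M" unfolding radical_def using M ideal_subspace by simp
  then show "ideal radical" "solvable radical" using M by auto
qed

end

context lie_algebra
begin

lemma leibniz: "bracket x (bracket y w) = bracket (bracket x y) w + bracket y (bracket x w)"
proof -
  have "bracket y (bracket w x) = - bracket y (bracket x w)"
    by (metis bracket_anticommute bracket_minus_right)
  moreover have "bracket w (bracket x y) = - bracket (bracket x y) w"
    by (rule bracket_anticommute)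
  ultimately show ?thesis using jacobi[of x y w] by (simp add: algebra_simps)
qed

end

section \<open>Three-dimensional quotients\<close>

text \<open>The vector space is finite, as the field is finite and \<open>Basis\<close> is a finite basis.\<close>

locale odd_lie_algebra =
  lie_algebra scale bracket + finite_dimensional_vector_space scale Basis
  for scale :: "'k::{field,finite} \<Rightarrow> 'l::ab_group_add \<Rightarrow> 'l" (infixr "*s" 75)
    and bracket :: "'l \<Rightarrow> 'l \<Rightarrow> 'l" (infixl "\<bullet>" 70)
    and Basis :: "'l set" +
  assumes two_neq_zero: "(2::'k) \<noteq> 0"
begin

lemma finite_UNIV: "finite (UNIV :: 'l set)"
proof -
  have "finite (span S)" if "finite S" for S
    using that
  proof induction
    case (insert a S)
    have "x \<in> (\<Union>k. (\<lambda>y. y + k *s a) ` span S)" if "x - k *s a \<in> span S" for x k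
      using that by (intro UN_I[of k] image_eqI[of _ _ "x - k *s a"]) auto
    then have "span (insert a S) \<subseteq> (\<Union>k. (\<lambda>y. y + k *s a) ` span S)"
      unfolding span_insert by blast
    then show ?case using insert.IH by (auto intro: finite_subset)
  qed simp
  from this[OF finite_Basis] show ?thesis by (simp add: span_Basis)
qed

lemma four_neq_zero: "(4::'k) \<noteq> 0"
  using two_neq_zero mult_eq_0_iff[of "2::'k" 2] by simp

lemma scale_two: "2 *s x = x + x"
  using scale_left_distrib[of 1 1 x] by simp

text \<open>
  Linear forms \<open>c1\<close>, \<open>c2\<close>, \<open>c3\<close> that identify the quotient by \<open>R\<close> with \<open>k\<^sup>3\<close>, and representatives of
  the dual basis.
\<close>

definition coordinates_modulo ::
    "'l set \<Rightarrow> ('l \<Rightarrow> 'k) \<Rightarrow> ('l \<Rightarrow> 'k) \<Rightarrow> ('l \<Rightarrow> 'k) \<Rightarrow> 'l \<Rightarrow> 'l \<Rightarrow> 'l \<Rightarrow> bool" where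
  "coordinates_modulo R c1 c2 c3 x1 x2 x3 \<longleftrightarrow>
    (\<forall>x y. c1 (x + y) = c1 x + c1 y) \<and> (\<forall>a x. c1 (a *s x) = a * c1 x) \<and>
    (\<forall>x y. c2 (x + y) = c2 x + c2 y) \<and> (\<forall>a x. c2 (a *s x) = a * c2 x) \<and>
    (\<forall>x y. c3 (x + y) = c3 x + c3 y) \<and> (\<forall>a x. c3 (a *s x) = a * c3 x) \<and>
    (\<forall>x. x \<in> R \<longleftrightarrow> c1 x = 0 \<and> c2 x = 0 \<and> c3 x = 0) \<and>
    c1 x1 = 1 \<and> c2 x1 = 0 \<and> c3 x1 = 0 \<and> c1 x2 = 0 \<and> c2 x2 = 1 \<and> c3 x2 = 0 \<and>
    c1 x3 = 0 \<and> c2 x3 = 0 \<and> c3 x3 = 1"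

lemma exists_coordinates_modulo:
  assumes R: "subspace R" and dimR: "dim UNIV = dim R + 3"
  shows "\<exists>c1 c2 c3 x1 x2 x3. coordinates_modulo R c1 c2 c3 x1 x2 x3"
proof -
  obtain C where C: "C \<subseteq> R" "independent C" "R \<subseteq> span C" "card C = dim R"
    using basis_exists by blast
  have RC: "R = span C" using C(1,3) span_minimal[OF C(1) R] by blast
  define B where "B = extend_basis C"
  have B: "C \<subseteq> B" "independent B" "span B = UNIV"
    unfolding B_def using extend_basis_superset independent_extend_basis span_extend_basis C(2) by auto
  have cB: "card B = dim R + 3" using dim_eq_card[of B UNIV] B dimR by simp
  have "card (B - C) = 3"
    using card_Diff_subset[OF _ B(1)] C(2,4) cB finiteI_independent by simp
  then obtain x1 x2 x3 where x: "B - C = {x1, x2, x3}" "x1 \<noteq> x2" "x1 \<noteq> x3" "x2 \<noteq> x3"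
    using card_3_iff by metis
  let ?r = "representation B"
  have xB: "x1 \<in> B" "x2 \<in> B" "x3 \<in> B" using x by auto
  have ker: "x \<in> R \<longleftrightarrow> ?r x x1 = 0 \<and> ?r x x2 = 0 \<and> ?r x x3 = 0" for x
  proof
    assume "x \<in> R"
    then have "?r x = representation C x" by (intro representation_extend B) (simp add: RC)
    moreover have "x1 \<notin> C" "x2 \<notin> C" "x3 \<notin> C" using x by auto
    ultimately show "?r x x1 = 0 \<and> ?r x x2 = 0 \<and> ?r x x3 = 0"
      using representation_ne_zero by metis
  next
    assume 0: "?r x x1 = 0 \<and> ?r x x2 = 0 \<and> ?r x x3 = 0"
    have "b \<in> C" if "?r x b \<noteq> 0" for b
    proof -
      have "b \<in> B" using that by (rule representation_ne_zero)
      then show ?thesis using that 0 x(1) by auto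
    qed
    then have "(\<Sum>b | ?r x b \<noteq> 0. ?r x b *s b) \<in> span C"
      by (intro span_sum span_scale span_base) simp
    then show "x \<in> R" using sum_nonzero_representation_eq[OF B(2), of x] B(3) RC by simp
  qed
  have "coordinates_modulo R (\<lambda>x. ?r x x1) (\<lambda>x. ?r x x2) (\<lambda>x. ?r x x3) x1 x2 x3"
    unfolding coordinates_modulo_def using B x xB ker
    by (simp add: representation_add representation_scale representation_basis)
  then show ?thesis by blast
qed

text \<open>
  The images of \<open>e\<close>, \<open>[e, f]\<close> and \<open>f\<close> in the quotient by \<open>R\<close> satisfy the relations of the standard basis of
  \<open>sl\<^sub>2\<close>. Stating this by congruences keeps all computations in one type.
\<close>

definition sl2_modulo :: "'l set \<Rightarrow> 'l \<Rightarrow> 'l \<Rightarrow> bool" where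
  "sl2_modulo R e f \<longleftrightarrow> e \<notin> R \<and> (e \<bullet> f) \<bullet> e - 2 *s e \<in> R \<and> (e \<bullet> f) \<bullet> f + 2 *s f \<in> R"

text \<open>
  In coordinates the bracket of \<open>L/R\<close> is a matrix \<open>m\<close> applied to the vector product. Perfectness makes \<open>m\<close>
  invertible and the Jacobi identity then makes it symmetric, so that
  \<open>[u, [u, w]] = N(u, w) u - N(u, u) w\<close> for the symmetric form \<open>N\<close> whose matrix is the adjugate of \<open>m\<close>.
  An isotropic vector \<open>e\<close> of \<open>N\<close> is therefore ad-nilpotent; the third element is any vector that is not
  orthogonal to \<open>e\<close>, after a correction by a multiple of \<open>e\<close>.
\<close>

lemma exists_sl2_modulo:
  assumes R: "ideal R" and dimR: "dim UNIV = dim R + 3"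
    and perfect: "\<And>x. \<exists>y\<in>span (range (\<lambda>(x, y). x \<bullet> y)). x - y \<in> R"
  obtains e f where "sl2_modulo R e f"
proof -
  obtain c1 c2 c3 x1 x2 x3 where c: "coordinates_modulo R c1 c2 c3 x1 x2 x3"
    using exists_coordinates_modulo[OF ideal_subspace[OF R] dimR] by blast
  have
    add: "c1 (x + y) = c1 x + c1 y" "c2 (x + y) = c2 x + c2 y" "c3 (x + y) = c3 x + c3 y"
    and scale: "c1 (a *s x) = a * c1 x" "c2 (a *s x) = a * c2 x" "c3 (a *s x) = a * c3 x"
    and ker: "x \<in> R \<longleftrightarrow> c1 x = 0 \<and> c2 x = 0 \<and> c3 x = 0"
    and dual: "c1 x1 = 1" "c2 x1 = 0" "c3 x1 = 0"
    "c1 x2 = 0" "c2 x2 = 1" "c3 x2 = 0"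
    "c1 x3 = 0" "c2 x3 = 0" "c3 x3 = 1" for a x y
    using c unfolding coordinates_modulo_def by simp_all
  have diff: "c1 (x - y) = c1 x - c1 y" "c2 (x - y) = c2 x - c2 y" "c3 (x - y) = c3 x - c3 y" for x y
    using add(1)[of "x - y" y] add(2)[of "x - y" y] add(3)[of "x - y" y] by simp_all
  have minus: "c1 (- y) = - c1 y" "c2 (- y) = - c2 y" "c3 (- y) = - c3 y" for y
    using diff[of 0 y] diff[of 0 0] by simp_all
  note coord = add scale diff minus
  define m11 m12 m13 where "m11 = c1 (x2 \<bullet> x3)" and "m12 = c2 (x2 \<bullet> x3)" and "m13 = c3 (x2 \<bullet> x3)"
  define m21 m22 m23 where "m21 = c1 (x3 \<bullet> x1)" and "m22 = c2 (x3 \<bullet> x1)" and "m23 = c3 (x3 \<bullet> x1)"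
  define m31 m32 m33 where "m31 = c1 (x1 \<bullet> x2)" and "m32 = c2 (x1 \<bullet> x2)" and "m33 = c3 (x1 \<bullet> x2)"
  note m = m11_def[symmetric] m12_def[symmetric] m13_def[symmetric]
    m21_def[symmetric] m22_def[symmetric] m23_def[symmetric]
    m31_def[symmetric] m32_def[symmetric] m33_def[symmetric]
  define p1 p2 p3 where "p1 = (\<lambda>u w. c2 u * c3 w - c3 u * c2 w)"
    and "p2 = (\<lambda>u w. c3 u * c1 w - c1 u * c3 w)" and "p3 = (\<lambda>u w. c1 u * c2 w - c2 u * c1 w)"
  \<comment> \<open>The values of \<open>p1\<close>, \<open>p2\<close>, \<open>p3\<close> are the components of the vector product.\<close>
  have prod: "c1 (u \<bullet> w) = m11 * p1 u w + m21 * p2 u w + m31 * p3 u w"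
    "c2 (u \<bullet> w) = m12 * p1 u w + m22 * p2 u w + m32 * p3 u w"
    "c3 (u \<bullet> w) = m13 * p1 u w + m23 * p2 u w + m33 * p3 u w" for u w
  proof -
    let ?c = "\<lambda>u. c1 u *s x1 + c2 u *s x2 + c3 u *s x3"
    have "u - ?c u \<in> R" for u unfolding ker by (simp add: coord dual)
    then have "(u - ?c u) \<bullet> w \<in> R" "?c u \<bullet> (w - ?c w) \<in> R"
      using ideal_left[OF R] ideal_right[OF R] by auto
    then have "(u - ?c u) \<bullet> w + ?c u \<bullet> (w - ?c w) \<in> R"
      using subspace_add[OF ideal_subspace[OF R]] by blast
    then have "u \<bullet> w - ?c u \<bullet> ?c w \<in> R" by (simp add: bracket_diff_left bracket_diff_right)
    then have e: "c1 (u \<bullet> w) = c1 (?c u \<bullet> ?c w)" "c2 (u \<bullet> w) = c2 (?c u \<bullet> ?c w)"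
      "c3 (u \<bullet> w) = c3 (?c u \<bullet> ?c w)" by (simp_all add: ker diff)
    have a: "x3 \<bullet> x2 = - (x2 \<bullet> x3)" "x1 \<bullet> x3 = - (x3 \<bullet> x1)" "x2 \<bullet> x1 = - (x1 \<bullet> x2)"
      by (rule bracket_anticommute)+
    show "c1 (u \<bullet> w) = m11 * p1 u w + m21 * p2 u w + m31 * p3 u w"
      "c2 (u \<bullet> w) = m12 * p1 u w + m22 * p2 u w + m32 * p3 u w"
      "c3 (u \<bullet> w) = m13 * p1 u w + m23 * p2 u w + m33 * p3 u w"
      unfolding e by (simp_all add: bracket_linear a coord m p1_def p2_def p3_def algebra_simps)
  qed
  have span_coord: "\<exists>s1 s2 s3. c1 y = m11 * s1 + m21 * s2 + m31 * s3 \<and>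
      c2 y = m12 * s1 + m22 * s2 + m32 * s3 \<and> c3 y = m13 * s1 + m23 * s2 + m33 * s3"
    if "y \<in> span (range (\<lambda>(x, y). x \<bullet> y))" for y
    using that
  proof (induction rule: span_induct_alt)
    case base
    show ?case by (intro exI[of _ 0]) (use diff[of 0 0] in simp)
  next
    case (step a x y)
    obtain u w where x: "x = u \<bullet> w" using step by auto
    obtain s1 s2 s3 where "c1 y = m11 * s1 + m21 * s2 + m31 * s3 \<and>
      c2 y = m12 * s1 + m22 * s2 + m32 * s3 \<and> c3 y = m13 * s1 + m23 * s2 + m33 * s3"
      using step by blast
    then show ?case
      by (intro exI[of _ "a * p1 u w + s1"] exI[of _ "a * p2 u w + s2"] exI[of _ "a * p3 u w + s3"])
        (simp add: x coord prod algebra_simps)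
  qed
  have onto: "\<exists>s1 s2 s3. c1 y = m11 * s1 + m21 * s2 + m31 * s3 \<and>
      c2 y = m12 * s1 + m22 * s2 + m32 * s3 \<and> c3 y = m13 * s1 + m23 * s2 + m33 * s3" for y
  proof -
    obtain z where z: "z \<in> span (range (\<lambda>(x, y). x \<bullet> y))" "y - z \<in> R" using perfect by blast
    then have "c1 y = c1 z" "c2 y = c2 z" "c3 y = c3 z" using ker diff by auto
    then show ?thesis using span_coord[OF z(1)] by simp
  qed
  obtain a1 a2 a3 where a: "1 = m11 * a1 + m21 * a2 + m31 * a3"
    "0 = m12 * a1 + m22 * a2 + m32 * a3" "0 = m13 * a1 + m23 * a2 + m33 * a3"
    using onto[of x1] dual by auto
  obtain b1 b2 b3 where b: "0 = m11 * b1 + m21 * b2 + m31 * b3"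
    "1 = m12 * b1 + m22 * b2 + m32 * b3" "0 = m13 * b1 + m23 * b2 + m33 * b3"
    using onto[of x2] dual by auto
  obtain d1 d2 d3 where d: "0 = m11 * d1 + m21 * d2 + m31 * d3"
    "0 = m12 * d1 + m22 * d2 + m32 * d3" "1 = m13 * d1 + m23 * d2 + m33 * d3"
    using onto[of x3] dual by auto
  have J: "c1 (x1 \<bullet> (x2 \<bullet> x3) + x2 \<bullet> (x3 \<bullet> x1) + x3 \<bullet> (x1 \<bullet> x2)) = 0"
    "c2 (x1 \<bullet> (x2 \<bullet> x3) + x2 \<bullet> (x3 \<bullet> x1) + x3 \<bullet> (x1 \<bullet> x2)) = 0"
    "c3 (x1 \<bullet> (x2 \<bullet> x3) + x2 \<bullet> (x3 \<bullet> x1) + x3 \<bullet> (x1 \<bullet> x2)) = 0"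
    unfolding jacobi using diff[of 0 0] by simp_all
  note J' = J[unfolded add prod[of x1] prod[of x2 "x3 \<bullet> x1"] prod[of x3] p1_def p2_def p3_def m dual]
  define t1 t2 t3 where "t1 = m23 - m32" and "t2 = m31 - m13" and "t3 = m12 - m21"
  have t: "m11 * t1 + m21 * t2 + m31 * t3 = 0" "m12 * t1 + m22 * t2 + m32 * t3 = 0"
    "m13 * t1 + m23 * t2 + m33 * t3 = 0"
    using J' unfolding t1_def t2_def t3_def by (simp_all add: algebra_simps)
  \<comment> \<open>The vector \<open>t\<close> measures the asymmetry of \<open>m\<close>; the Jacobi identity puts it into the kernel of the
    transpose of \<open>m\<close>, which is invertible because \<open>m\<close> has a one-sided inverse.\<close>
  define det where "det = m11 * (m22 * m33 - m23 * m32) - m12 * (m21 * m33 - m23 * m31)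
    + m13 * (m21 * m32 - m22 * m31)"
  define det' where "det' = a1 * (b2 * d3 - b3 * d2) - a2 * (b1 * d3 - b3 * d1) + a3 * (b1 * d2 - b2 * d1)"
  have "(m11 * a1 + m21 * a2 + m31 * a3) * ((m12 * b1 + m22 * b2 + m32 * b3) * (m13 * d1 + m23 * d2 + m33 * d3)
       - (m13 * b1 + m23 * b2 + m33 * b3) * (m12 * d1 + m22 * d2 + m32 * d3))
     - (m12 * a1 + m22 * a2 + m32 * a3) * ((m11 * b1 + m21 * b2 + m31 * b3) * (m13 * d1 + m23 * d2 + m33 * d3)
       - (m13 * b1 + m23 * b2 + m33 * b3) * (m11 * d1 + m21 * d2 + m31 * d3))
     + (m13 * a1 + m23 * a2 + m33 * a3) * ((m11 * b1 + m21 * b2 + m31 * b3) * (m12 * d1 + m22 * d2 + m32 * d3)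
       - (m12 * b1 + m22 * b2 + m32 * b3) * (m11 * d1 + m21 * d2 + m31 * d3)) = det * det'"
    unfolding det_def det'_def by algebra
  then have "det * det' = 1" unfolding a[symmetric] b[symmetric] d[symmetric] by simp
  then have det: "det \<noteq> 0" by auto
  have "det * t1 = 0" "det * t2 = 0" "det * t3 = 0"
    unfolding det_def using t by algebra+
  then have sym: "m32 = m23" "m31 = m13" "m21 = m12"
    using det unfolding t1_def t2_def t3_def by auto
  define n11 n22 n33 n12 n13 n23 where "n11 = m22 * m33 - m23 * m23" and "n22 = m11 * m33 - m13 * m13"
    and "n33 = m11 * m22 - m12 * m12" and "n12 = m13 * m23 - m12 * m33"
    and "n13 = m12 * m23 - m13 * m22" and "n23 = m12 * m13 - m11 * m23"
  define N where "N = (\<lambda>u w. n11 * c1 u * c1 w + n22 * c2 u * c2 w + n33 * c3 u * c3 w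
    + n12 * (c1 u * c2 w + c2 u * c1 w) + n13 * (c1 u * c3 w + c3 u * c1 w) + n23 * (c2 u * c3 w + c3 u * c2 w))"
  have square: "u \<bullet> (u \<bullet> w) - (N u w *s u - N u u *s w) \<in> R" for u w
    unfolding ker coord prod p1_def p2_def p3_def sym N_def n11_def n22_def n33_def n12_def n13_def n23_def
    by (intro conjI; algebra)
  obtain x y z where xyz: "(x, y, z) \<noteq> (0, 0, 0)"
    "n11 * x * x + n22 * y * y + n33 * z * z + 2 * n12 * x * y + 2 * n13 * x * z + 2 * n23 * y * z = 0"
    using ternary_quadratic_form_isotropic[OF two_neq_zero] by blast
  define e where "e = x *s x1 + y *s x2 + z *s x3"
  have ce: "c1 e = x" "c2 e = y" "c3 e = z" unfolding e_def by (simp_all add: coord dual)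
  have Ne: "N e e = 0" using xyz(2) unfolding N_def ce by (simp add: algebra_simps)
  have eR: "e \<notin> R" using xyz(1) unfolding ker ce by simp
  have "\<exists>u. N e u \<noteq> 0"
  proof (rule ccontr)
    assume "\<not> ?thesis"
    then have "N e x1 = 0" "N e x2 = 0" "N e x3 = 0" by auto
    then have 0: "n11 * x + n12 * y + n13 * z = 0" "n12 * x + n22 * y + n23 * z = 0"
      "n13 * x + n23 * y + n33 * z = 0"
      unfolding N_def ce dual by (simp_all add: algebra_simps)
    have "det * x = m11 * (n11 * x + n12 * y + n13 * z) + m12 * (n12 * x + n22 * y + n23 * z) + m13 * (n13 * x + n23 * y + n33 * z)"
      "det * y = m12 * (n11 * x + n12 * y + n13 * z) + m22 * (n12 * x + n22 * y + n23 * z) + m23 * (n13 * x + n23 * y + n33 * z)"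
      "det * z = m13 * (n11 * x + n12 * y + n13 * z) + m23 * (n12 * x + n22 * y + n23 * z) + m33 * (n13 * x + n23 * y + n33 * z)"
      unfolding n11_def n22_def n33_def n12_def n13_def n23_def det_def sym by algebra+
    then have "x = 0" "y = 0" "z = 0" unfolding 0 using det by auto
    then show False using xyz(1) by simp
  qed
  then obtain u where u: "N e u \<noteq> 0" by blast
  \<comment> \<open>Scaled so that \<open>N e f' = - 2\<close>, which gives \<open>[[e, f'], e] = 2e\<close>.\<close>
  define f' where "f' = (- 2 / N e u) *s u"
  have Nf: "N e f' = - 2" "N f' e = - 2"
  proof -
    have "N e (t *s u) = t * N e u" for t
      unfolding N_def by (simp add: coord algebra_simps)
    then have "N e f' = (- 2 / N e u) * N e u" unfolding f'_def by blast
    then show "N e f' = - 2" using u by simp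
    then show "N f' e = - 2" unfolding N_def by (simp add: algebra_simps)
  qed
  \<comment> \<open>The square of \<open>ad f'\<close> contributes the multiple \<open>N f' f'\<close> of \<open>e\<close> to \<open>[[e, f'], f']\<close>; this correction cancels it.\<close>
  define f where "f = f' + (N f' f' / 4) *s e"
  have h: "e \<bullet> f = e \<bullet> f'" unfolding f_def by (simp add: bracket_linear)
  have 1: "(e \<bullet> f) \<bullet> e - 2 *s e \<in> R"
  proof -
    have "(e \<bullet> f) \<bullet> e - 2 *s e = - (e \<bullet> (e \<bullet> f') - (N e f' *s e - N e e *s f'))"
      unfolding h Nf Ne by (simp add: bracket_anticommute[of "e \<bullet> f'" e])
    then show ?thesis using subspace_neg[OF ideal_subspace[OF R] square[of e f']] by simp
  qed
  have 2: "(e \<bullet> f) \<bullet> f + 2 *s f \<in> R"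
  proof -
    have k: "(N f' f' / 4) *s 2 *s e + 2 *s (N f' f' / 4) *s e = N f' f' *s e"
    proof -
      have "(N f' f' / 4) *s 2 *s e + 2 *s (N f' f' / 4) *s e = (4 * (N f' f' / 4)) *s e"
        by (simp only: scale_scale scale_left_distrib[symmetric]) (simp add: algebra_simps)
      then show ?thesis using four_neq_zero by simp
    qed
    have "(e \<bullet> f') \<bullet> f' = f' \<bullet> (f' \<bullet> e)"
      by (metis bracket_anticommute bracket_minus_right)
    then have "(e \<bullet> f) \<bullet> f + 2 *s f = (f' \<bullet> (f' \<bullet> e) - (N f' e *s f' - N f' f' *s e))
        + (N f' f' / 4) *s ((e \<bullet> f) \<bullet> e - 2 *s e)
        + ((N f' f' / 4) *s 2 *s e + 2 *s (N f' f' / 4) *s e - N f' f' *s e)"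
      unfolding h Nf unfolding f_def
      by (simp only: bracket_linear scale_linear) (simp add: algebra_simps)
    then show ?thesis unfolding k
      using square 1 subspace_add[OF ideal_subspace[OF R]] subspace_scale[OF ideal_subspace[OF R]] by simp
  qed
  show thesis by (rule that) (use eR 1 2 in \<open>simp add: sl2_modulo_def\<close>)
qed

end

section \<open>Minimal supplements of the radical\<close>

context odd_lie_algebra
begin

lemma derived_series_Suc_subset:
  "subspace T \<Longrightarrow> (\<And>x y. x \<in> derived_series S n \<Longrightarrow> y \<in> derived_series S n \<Longrightarrow> x \<bullet> y \<in> T) \<Longrightarrow>
    derived_series S (Suc n) \<subseteq> T"
  unfolding derived_series.simps by (rule span_minimal) auto

text \<open>
  Applying \<open>ad e\<close> once and twice to a relation isolates the coefficient of \<open>[e, f]\<close> and that of \<open>f\<close>.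
\<close>

lemma sl2_modulo_independent:
  assumes R: "ideal R" and ef: "sl2_modulo R e f"
    and 0: "a *s e + b *s (e \<bullet> f) + c *s f \<in> R"
  shows "a = 0 \<and> b = 0 \<and> c = 0"
proof -
  note sub = ideal_subspace[OF R]
  let ?h = "e \<bullet> f"
  have e: "e \<notin> R" and he: "?h \<bullet> e - 2 *s e \<in> R" using ef by (auto simp: sl2_modulo_def)
  have scaled: "t = 0" if "t *s e \<in> R" for t
  proof (rule ccontr)
    assume "t \<noteq> 0"
    then have "e = (1 / t) *s (t *s e)" by simp
    then show False using e subspace_scale[OF sub that, of "1 / t"] by simp
  qed
  have eh: "e \<bullet> ?h + 2 *s e \<in> R"
    using subspace_neg[OF sub he] by (simp add: bracket_anticommute[of ?h e] add.commute)
  have 1: "(- 2 * b) *s e + c *s ?h \<in> R"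
  proof -
    have "(- 2 * b) *s e + c *s ?h = e \<bullet> (a *s e + b *s ?h + c *s f) - b *s (e \<bullet> ?h + 2 *s e)"
      by (simp add: bracket_linear algebra_simps)
    then show ?thesis using subspace_diff[OF sub ideal_right[OF R 0] subspace_scale[OF sub eh]] by simp
  qed
  have "(- 2 * c) *s e \<in> R"
  proof -
    have "(- 2 * c) *s e = e \<bullet> ((- 2 * b) *s e + c *s ?h) - c *s (e \<bullet> ?h + 2 *s e)"
      by (simp add: bracket_linear algebra_simps)
    then show ?thesis using subspace_diff[OF sub ideal_right[OF R 1] subspace_scale[OF sub eh]] by simp
  qed
  then have c: "c = 0" using scaled[of "- 2 * c"] two_neq_zero by simp
  then have "(- 2 * b) *s e \<in> R" using 1 by simp
  then have b: "b = 0" using scaled[of "- 2 * b"] two_neq_zero by simp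
  have "a *s e \<in> R" using 0 b c by simp
  then show ?thesis using scaled b c by simp
qed

lemma sl2_modulo_spans:
  assumes R: "ideal R" and dimR: "dim UNIV = dim R + 3" and ef: "sl2_modulo R e f"
  shows "\<exists>a b c. x - (a *s e + b *s (e \<bullet> f) + c *s f) \<in> R"
proof -
  note indep = sl2_modulo_independent[OF R ef]
  have [simp]: "span R = R" using ideal_subspace[OF R] by simp
  have 1: "f \<notin> span R" using indep[of 0 0 1] by auto
  have 2: "e \<bullet> f \<notin> span (insert f R)"
  proof
    assume "e \<bullet> f \<in> span (insert f R)"
    then obtain k where "e \<bullet> f - k *s f \<in> R" by (auto simp: span_insert)
    then show False using indep[of 0 1 "- k"] by auto
  qed
  have 3: "e \<notin> span (insert (e \<bullet> f) (insert f R))"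
  proof
    assume "e \<in> span (insert (e \<bullet> f) (insert f R))"
    then obtain k l where "e - k *s (e \<bullet> f) - l *s f \<in> R" by (auto simp: span_breakdown_eq)
    then show False using indep[of 1 "- k" "- l"] by (auto simp: algebra_simps)
  qed
  have "dim (insert e (insert (e \<bullet> f) (insert f R))) = dim UNIV"
    using 1 2 3 dimR by (simp add: dim_insert del: dim_UNIV)
  then have "span (insert e (insert (e \<bullet> f) (insert f R))) = UNIV"
    using dim_eq_full dimension_def by simp
  then have "x \<in> span (insert e (insert (e \<bullet> f) (insert f R)))" by simp
  then obtain a b c where "x - a *s e - b *s (e \<bullet> f) - c *s f \<in> R"
    by (auto simp: span_breakdown_eq)
  then show ?thesis by (intro exI[of _ a] exI[of _ b] exI[of _ c]) (simp add: algebra_simps)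
qed

lemma sl2_modulo_cong:
  assumes R: "ideal R" and ef: "sl2_modulo R e f" and e': "e' - e \<in> R" and f': "f' - f \<in> R"
  shows "sl2_modulo R e' f'"
proof -
  note sub = ideal_subspace[OF R]
  have cong: "x' \<bullet> y' - x \<bullet> y \<in> R" if "x' - x \<in> R" "y' - y \<in> R" for x x' y y'
  proof -
    have "x' \<bullet> y' - x \<bullet> y = (x' - x) \<bullet> y' + x \<bullet> (y' - y)"
      by (simp add: bracket_linear)
    then show ?thesis
      using subspace_add[OF sub ideal_left[OF R that(1)] ideal_right[OF R that(2)]] by simp
  qed
  have c: "(e' \<bullet> f') \<bullet> e' - (e \<bullet> f) \<bullet> e \<in> R" "(e' \<bullet> f') \<bullet> f' - (e \<bullet> f) \<bullet> f \<in> R"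
    using cong e' f' by blast+
  have d: "2 *s (e' - e) \<in> R" "2 *s (f' - f) \<in> R"
    using e' f' subspace_scale[OF sub] by blast+
  have r: "(e \<bullet> f) \<bullet> e - 2 *s e \<in> R" "(e \<bullet> f) \<bullet> f + 2 *s f \<in> R"
    using ef by (auto simp: sl2_modulo_def)
  note subspace_add[OF sub subspace_diff[OF sub c(1) d(1)] r(1)]
    subspace_add[OF sub subspace_add[OF sub c(2) d(2)] r(2)]
  moreover have "e' \<notin> R"
  proof
    assume "e' \<in> R"
    from subspace_diff[OF sub this e'] show False using ef by (simp add: sl2_modulo_def)
  qed
  ultimately show ?thesis unfolding sl2_modulo_def by (simp add: algebra_simps)
qed

text \<open>
  A Lie algebra of dimension at most two is solvable, so the derived algebra of a nonsolvable
  algebra cannot be proper modulo a solvable ideal of codimension three.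
\<close>

lemma perfect_modulo_radical:
  assumes nonsolvable: "\<not> solvable UNIV" and dimR: "dim UNIV = dim radical + 3"
  shows "\<exists>y\<in>span (range (\<lambda>(x, y). x \<bullet> y)). x - y \<in> radical"
proof -
  note R = radical_is_solvable_ideal[OF finite_UNIV]
  note sub = ideal_subspace[OF R(1)]
  have [simp]: "span radical = radical" using sub by simp
  let ?D = "range (\<lambda>(x, y). x \<bullet> y)"
  define T where "T = span (?D \<union> radical)"
  have subT: "subspace T" unfolding T_def by simp
  have RT: "radical \<subseteq> T" unfolding T_def using span_superset by blast
  have DT: "x \<bullet> y \<in> T" for x y unfolding T_def by (intro span_base) auto
  have "ideal T" unfolding ideal_def using subT DT by simp
  have "T = UNIV"
  proof (rule ccontr)
    assume T: "T \<noteq> UNIV"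
    obtain a b where ab: "T \<subseteq> span (insert a (insert b radical))"
    proof (cases "T \<subseteq> span radical")
      case True
      moreover have "span radical \<subseteq> span (insert 0 (insert 0 radical))" by simp
      ultimately show thesis using that[of 0 0] by blast
    next
      case False
      then obtain b where b: "b \<in> T" "b \<notin> span radical" by blast
      show thesis
      proof (cases "T \<subseteq> span (insert b radical)")
        case True
        then show thesis using that[of 0 b] by simp
      next
        case False
        then obtain a where a: "a \<in> T" "a \<notin> span (insert b radical)" by blast
        show thesis
        proof (cases "T \<subseteq> span (insert a (insert b radical))")
          case True
          then show thesis using that by blast
        next
          case False
          then obtain c where c: "c \<in> T" "c \<notin> span (insert a (insert b radical))" by blast
          have "dim (insert c (insert a (insert b radical))) = dim UNIV"
            using a b c dimR by (simp add: dim_insert del: dim_UNIV)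
          then have "span (insert c (insert a (insert b radical))) = UNIV"
            using dim_eq_full dimension_def by simp
          moreover have "span (insert c (insert a (insert b radical))) \<subseteq> T"
            using a b c RT by (intro span_minimal subT) auto
          ultimately show thesis using T by blast
        qed
      qed
    qed
    have prod: "u \<bullet> w \<in> span (insert (a \<bullet> b) radical)" if uw: "u \<in> T" "w \<in> T" for u w
    proof -
      have "\<exists>k l r. u = k *s a + l *s b + r \<and> r \<in> radical" if "u \<in> T" for u
      proof -
        have "u \<in> span (insert a (insert b radical))" using that ab by blast
        then obtain k l where "u - k *s a - l *s b \<in> radical"
          by (auto simp: span_breakdown_eq)
        then show ?thesis
          by (intro exI[of _ k] exI[of _ l] exI[of _ "u - k *s a - l *s b"]) simp
      qed
      note decompose = this
      obtain k l r where u: "u = k *s a + l *s b + r" "r \<in> radical"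
        using decompose[OF uw(1)] by blast
      obtain k' l' r' where w: "w = k' *s a + l' *s b + r'" "r' \<in> radical"
        using decompose[OF uw(2)] by blast
      have "u \<bullet> w - (k * l' - l * k') *s (a \<bullet> b) = (k *s a + l *s b) \<bullet> r' + r \<bullet> w"
        unfolding u w by (simp add: bracket_linear bracket_anticommute[of b a] algebra_simps)
      moreover have "(k *s a + l *s b) \<bullet> r' + r \<bullet> w \<in> radical"
        using subspace_add[OF sub ideal_right[OF R(1) w(2)] ideal_left[OF R(1) u(2)]] .
      ultimately have "u \<bullet> w - (k * l' - l * k') *s (a \<bullet> b) \<in> radical" by simp
      then show ?thesis unfolding span_breakdown_eq by auto
    qed
    have 1: "derived_series T (Suc 0) \<subseteq> span (insert (a \<bullet> b) radical)"
      using prod by (intro derived_series_Suc_subset) auto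
    have "u \<bullet> w \<in> radical" if uw: "u \<in> derived_series T (Suc 0)" "w \<in> derived_series T (Suc 0)" for u w
    proof -
      obtain k l where "u - k *s (a \<bullet> b) \<in> radical" "w - l *s (a \<bullet> b) \<in> radical"
        using subsetD[OF 1 uw(1)] subsetD[OF 1 uw(2)] unfolding span_breakdown_eq by auto
      then have "(u - k *s (a \<bullet> b)) \<bullet> w + (k *s (a \<bullet> b)) \<bullet> (w - l *s (a \<bullet> b)) \<in> radical"
        by (intro subspace_add[OF sub] ideal_left[OF R(1)] ideal_right[OF R(1)])
      then show ?thesis by (simp add: bracket_linear)
    qed
    then have "derived_series T (Suc (Suc 0)) \<subseteq> radical"
      using sub by (intro derived_series_Suc_subset)
    then have "solvable T" using solvable_by_derived[OF subspace_0[OF subT]] R(2) by blast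
    then have "T \<subseteq> radical" using \<open>ideal T\<close> solvable_ideal_subset_radical by simp
    then have "derived_series UNIV (Suc 0) \<subseteq> radical"
      using DT sub \<open>T \<subseteq> radical\<close> by (intro derived_series_Suc_subset) auto
    then have "solvable UNIV" using solvable_by_derived[OF UNIV_I] R(2) by blast
    then show False using nonsolvable by simp
  qed
  then have "x \<in> span (?D \<union> radical)" unfolding T_def by simp
  then obtain u w where "x = u + w" "u \<in> span ?D" "w \<in> radical" by (auto simp: span_Un)
  then show ?thesis by (intro bexI[of _ u]) simp_all
qed

text \<open>
  On a finite set the powers of a map eventually repeat, which gives Fitting's decomposition without any
  dimension count: \<open>x\<close> differs from its image under such a power by an element that the power kills when
  \<open>g\<close> is linear.
\<close>

lemma idempotent_power:
  fixes g :: "'l \<Rightarrow> 'l"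
  shows "\<exists>n\<ge>k. (g ^^ n) ((g ^^ n) x) = (g ^^ n) x"
proof -
  define s where "s = (\<lambda>n. (g ^^ n) x)"
  have "finite (range s)" using finite_UNIV by (rule finite_subset[OF subset_UNIV])
  then have "\<not> inj s" using finite_imageD infinite_UNIV_nat by blast
  then obtain a b where ab: "a < b" "s a = s b"
    unfolding inj_def by (metis linorder_neqE_nat)
  define p where "p = b - a"
  have shift: "s (n + p) = s n" if "n \<ge> a" for n
  proof -
    have "s (n + p) = (g ^^ (n - a)) (s b)"
      using that ab by (simp add: s_def p_def flip: funpow_add[THEN fun_cong, unfolded o_def])
    also have "\<dots> = (g ^^ (n - a)) (s a)" using ab by simp
    also have "\<dots> = s n"
      using that by (simp add: s_def flip: funpow_add[THEN fun_cong, unfolded o_def])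
    finally show ?thesis .
  qed
  have shifts: "s (n + m * p) = s n" if "n \<ge> a" for n m
  proof (induction m)
    case (Suc m)
    have "s (n + Suc m * p) = s ((n + m * p) + p)" by (simp add: algebra_simps)
    then show ?case using shift[of "n + m * p"] that Suc by simp
  qed simp
  define n where "n = (a + k) * p"
  have "p > 0" using ab p_def by simp
  then have n: "n \<ge> a + k" unfolding n_def by simp
  moreover have "(g ^^ n) ((g ^^ n) x) = s (n + (a + k) * p)"
    by (simp add: funpow_add n_def s_def)
  ultimately show ?thesis using shifts[of n "a + k"] by (intro exI[of _ n]) (simp add: s_def)
qed

end

text \<open>
  A subalgebra \<open>P\<close> with \<open>P + R = L\<close> that is minimal with this property. Any construction of a
  subalgebra of \<open>P\<close> that still covers \<open>L/R\<close> then yields all of \<open>P\<close>, and this is how every structural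
  property of \<open>P\<close> is obtained below.
\<close>

locale minimal_supplement = odd_lie_algebra scale bracket Basis
  for scale :: "'k::{field,finite} \<Rightarrow> 'l::ab_group_add \<Rightarrow> 'l" (infixr "*s" 75)
    and bracket :: "'l \<Rightarrow> 'l \<Rightarrow> 'l" (infixl "\<bullet>" 70)
    and Basis :: "'l set" +
  fixes R P :: "'l set"
  assumes R: "ideal R" and R_solvable: "solvable R" and codim_R: "dim UNIV = dim R + 3"
    and dim_R: "dim R = 3"
    and P: "subalgebra P" and supplement: "\<And>x. \<exists>y\<in>P. x - y \<in> R"
    and minimal: "\<And>K. subalgebra K \<Longrightarrow> K \<subseteq> P \<Longrightarrow> (\<And>x. \<exists>y\<in>K. x - y \<in> R) \<Longrightarrow> K = P"
    and no_complement: "P \<inter> R \<noteq> {0}"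
    and sl2: "\<exists>e f. sl2_modulo R e f"
begin

abbreviation A :: "'l set" where "A \<equiv> P \<inter> R"

lemmas R_sub = ideal_subspace[OF R]

lemma P_sub: "subspace P" and P_bracket: "x \<in> P \<Longrightarrow> y \<in> P \<Longrightarrow> x \<bullet> y \<in> P"
  using P unfolding subalgebra_def by auto

lemmas P_rules = subspace_add[OF P_sub] subspace_diff[OF P_sub] subspace_scale[OF P_sub]
  subspace_neg[OF P_sub] subspace_0[OF P_sub] P_bracket

lemmas R_rules = subspace_add[OF R_sub] subspace_diff[OF R_sub] subspace_scale[OF R_sub]
  subspace_neg[OF R_sub] subspace_0[OF R_sub] ideal_left[OF R] ideal_right[OF R]

lemma A_sub: "subspace A"
  using subspace_inter[OF P_sub R_sub] .

lemma A_bracket: "x \<in> P \<Longrightarrow> y \<in> A \<Longrightarrow> x \<bullet> y \<in> A" "x \<in> P \<Longrightarrow> y \<in> A \<Longrightarrow> y \<bullet> x \<in> A"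
  using P_bracket ideal_right[OF R] ideal_left[OF R] by auto

text \<open>Pairs \<open>e, f\<close> of \<open>P\<close> that lift the standard generators of the quotient \<open>P/A\<close>.\<close>

definition lifts :: "'l \<Rightarrow> 'l \<Rightarrow> bool" where
  "lifts e f \<longleftrightarrow> e \<in> P \<and> f \<in> P \<and> sl2_modulo R e f"

lemma lifts_exist: "\<exists>e f. lifts e f"
proof -
  obtain e f where ef: "sl2_modulo R e f" using sl2 by blast
  obtain e' f' where 1: "e' \<in> P" "f' \<in> P" "e - e' \<in> R" "f - f' \<in> R" using supplement by meson
  then have "e' - e \<in> R" "f' - f \<in> R" using R_rules(4)[of "e - e'"] R_rules(4)[of "f - f'"] by auto
  then show ?thesis using sl2_modulo_cong[OF R ef] 1 unfolding lifts_def by blast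
qed

lemma lifts_cong: "lifts e f \<Longrightarrow> x \<in> A \<Longrightarrow> y \<in> A \<Longrightarrow> lifts (e + x) (f + y)"
  unfolding lifts_def using sl2_modulo_cong[OF R, of e f "e + x" "f + y"] P_rules(1) by simp

lemma lifts_swap: assumes "lifts e f" shows "lifts f e"
proof -
  have e: "e \<in> P" "f \<in> P" and sl2: "sl2_modulo R e f" using assms by (auto simp: lifts_def)
  then have 1: "(e \<bullet> f) \<bullet> e - 2 *s e \<in> R" "(e \<bullet> f) \<bullet> f + 2 *s f \<in> R"
    by (auto simp: sl2_modulo_def)
  have "(f \<bullet> e) \<bullet> e + 2 *s e \<in> R" "(f \<bullet> e) \<bullet> f - 2 *s f \<in> R"
    using R_rules(4)[OF 1(1)] R_rules(4)[OF 1(2)]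
    by (simp_all add: bracket_anticommute[of f e] bracket_linear algebra_simps)
  moreover have "f \<notin> R" using sl2_modulo_independent[OF R sl2, of 0 0 1] by auto
  ultimately show ?thesis using e by (auto simp: lifts_def sl2_modulo_def)
qed

lemma lifts_relations:
  assumes "lifts e f"
  shows "e \<in> P" "f \<in> P" "e \<bullet> f \<in> P" "(e \<bullet> f) \<bullet> e - 2 *s e \<in> A" "(e \<bullet> f) \<bullet> f + 2 *s f \<in> A"
  using assms P_rules unfolding lifts_def sl2_modulo_def by auto

lemma lifts_independent:
  assumes "lifts e f" "a *s e + b *s (e \<bullet> f) + c *s f \<in> R" shows "a = 0" "b = 0" "c = 0"
  using sl2_modulo_independent[OF R _ assms(2)] assms(1) by (auto simp: lifts_def)

lemma lifts_span:
  assumes ef: "lifts e f" and "x \<in> P"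
  obtains a b c r where "x = a *s e + b *s (e \<bullet> f) + c *s f + r" "r \<in> A"
proof -
  obtain a b c where r: "x - (a *s e + b *s (e \<bullet> f) + c *s f) \<in> R"
    using sl2_modulo_spans[OF R codim_R] ef lifts_def by blast
  moreover have "x - (a *s e + b *s (e \<bullet> f) + c *s f) \<in> P"
    using assms(2) lifts_relations[OF ef] P_rules by auto
  ultimately show thesis
    using that[of a b c "x - (a *s e + b *s (e \<bullet> f) + c *s f)"] by simp
qed

text \<open>
  A subalgebra that contains lifts of \<open>e\<close> and \<open>f\<close> also contains a lift of their bracket.
\<close>

lemma minimal_lifts:
  assumes K: "subalgebra K" "K \<subseteq> P" and ef: "lifts e f" "e \<in> K" "f \<in> K"
  shows "K = P"
proof (rule minimal[OF K])
  fix x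
  obtain a b c where "x - (a *s e + b *s (e \<bullet> f) + c *s f) \<in> R"
    using sl2_modulo_spans[OF R codim_R] ef lifts_def by blast
  moreover have "a *s e + b *s (e \<bullet> f) + c *s f \<in> K"
    using K ef unfolding subalgebra_def by (auto intro!: subspace_add subspace_scale)
  ultimately show "\<exists>y\<in>K. x - y \<in> R" by blast
qed

text \<open>
  The brackets \<open>[h, e]\<close> and \<open>[h, f]\<close> are, up to nonzero factors, lifts of \<open>e\<close> and \<open>f\<close> again. So \<open>P\<close> equals
  its derived algebra.
\<close>

lemma minimal_derived:
  assumes K: "subalgebra K" "K \<subseteq> P" and D: "\<And>x y. x \<in> P \<Longrightarrow> y \<in> P \<Longrightarrow> x \<bullet> y \<in> K"
  shows "K = P"
proof -
  obtain e f where ef: "lifts e f" using lifts_exist by blast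
  let ?h = "e \<bullet> f"
  note r = lifts_relations[OF ef]
  have sub: "subspace K" using K by (simp add: subalgebra_def)
  have "lifts (e + (1/2) *s (?h \<bullet> e - 2 *s e)) (f + (- 1/2) *s (?h \<bullet> f + 2 *s f))"
    using r by (intro lifts_cong ef subspace_scale[OF A_sub])
  moreover have "e + (1/2) *s (?h \<bullet> e - 2 *s e) = (1/2) *s (?h \<bullet> e)"
    "f + (- 1/2) *s (?h \<bullet> f + 2 *s f) = (- 1/2) *s (?h \<bullet> f)"
    using two_neq_zero by (simp_all add: algebra_simps)
  moreover have "(1/2) *s (?h \<bullet> e) \<in> K" "(- 1/2) *s (?h \<bullet> f) \<in> K"
    by (intro subspace_scale[OF sub] D r)+
  ultimately show ?thesis using minimal_lifts[OF K] by simp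
qed

text \<open>
  The \<open>P\<close>-ideals below \<open>A\<close> are its \<open>P\<close>-submodules. They need not be ideals of \<open>L\<close>.
\<close>

definition P_ideal :: "'l set \<Rightarrow> bool" where
  "P_ideal M \<longleftrightarrow> subspace M \<and> (\<forall>x\<in>P. \<forall>m\<in>M. x \<bullet> m \<in> M)"

lemma P_ideal_A: "P_ideal A"
  unfolding P_ideal_def using A_sub A_bracket by blast

text \<open>
  Modulo \<open>M\<close> the action on \<open>w\<close> is a character of \<open>P\<close>, and characters vanish on brackets.
\<close>

lemma one_dimensional_action_trivial:
  assumes M: "P_ideal M" and w: "\<And>x. x \<in> P \<Longrightarrow> \<exists>c. x \<bullet> w - c *s w \<in> M" and x: "x \<in> P"
  shows "x \<bullet> w \<in> M"
proof -
  have sub: "subspace M" using M by (simp add: P_ideal_def)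
  have PM: "x \<bullet> m \<in> M" if "x \<in> P" "m \<in> M" for x m using M that by (simp add: P_ideal_def)
  let ?K = "{x \<in> P. x \<bullet> w \<in> M}"
  have D: "x \<bullet> y \<in> ?K" if xy: "x \<in> P" "y \<in> P" for x y
  proof -
    obtain c d where c: "x \<bullet> w - c *s w \<in> M" and d: "y \<bullet> w - d *s w \<in> M" using w xy by meson
    have "(x \<bullet> y) \<bullet> w = x \<bullet> (y \<bullet> w) - y \<bullet> (x \<bullet> w)" using leibniz[of x y w] by simp
    also have "\<dots> = (x \<bullet> (y \<bullet> w - d *s w) + d *s (x \<bullet> w - c *s w))
      - (y \<bullet> (x \<bullet> w - c *s w) + c *s (y \<bullet> w - d *s w))"
      by (simp add: bracket_linear algebra_simps)
    also have "\<dots> \<in> M"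
      by (intro subspace_diff[OF sub] subspace_add[OF sub] subspace_scale[OF sub] PM c d xy)
    finally show ?thesis using xy P_bracket by simp
  qed
  have "subspace ?K"
    unfolding subspace_def using P_rules sub
    by (auto simp: bracket_linear subspace_0 subspace_add subspace_scale)
  then have "subalgebra ?K" unfolding subalgebra_def using D by blast
  then have "?K = P" using minimal_derived D by blast
  then show ?thesis using x by blast
qed

text \<open>
  If the standard relations hold modulo an ideal \<open>M \<subseteq> A\<close>, then the lifts span, together with \<open>M\<close>,
  a supplement that meets the radical in \<open>M\<close>.
\<close>

lemma lifts_modulo:
  assumes M: "P_ideal M" "M \<subseteq> A" and ef1: "lifts e1 f1"
    and he: "(e1 \<bullet> f1) \<bullet> e1 - 2 *s e1 \<in> M" and hf: "(e1 \<bullet> f1) \<bullet> f1 + 2 *s f1 \<in> M"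
  shows "A \<subseteq> M"
proof
  fix w assume w: "w \<in> A"
  have sub: "subspace M" using M by (simp add: P_ideal_def)
  note M_rules = subspace_add[OF sub] subspace_diff[OF sub] subspace_scale[OF sub]
    subspace_neg[OF sub] subspace_0[OF sub]
  have PA: "x \<bullet> y \<in> M" if "x \<in> P" "y \<in> M" for x y using M(1) that by (simp add: P_ideal_def)
  have AP: "y \<bullet> x \<in> M" if "x \<in> P" "y \<in> M" for x y
    using M_rules(4)[OF PA[OF that]] bracket_anticommute[of y x] by simp
  define h1 where "h1 = e1 \<bullet> f1"
  note r1 = lifts_relations[OF ef1, folded h1_def]
  note he = he[folded h1_def] and hf = hf[folded h1_def]
  define K where "K = {x. \<exists>a b c. x - (a *s e1 + b *s h1 + c *s f1) \<in> M}"
  have "subspace K"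
    unfolding subspace_def
  proof (intro conjI ballI allI)
    have "0 - (0 *s e1 + 0 *s h1 + 0 *s f1) \<in> M" using M_rules by simp
    then show "0 \<in> K" unfolding K_def by blast
    fix u v d assume "u \<in> K" 
    then obtain a b c where u: "u - (a *s e1 + b *s h1 + c *s f1) \<in> M" unfolding K_def by blast
    have "d *s u - ((d * a) *s e1 + (d * b) *s h1 + (d * c) *s f1) \<in> M"
      using M_rules(3)[OF u, of d] by (simp add: algebra_simps)
    then show "d *s u \<in> K" unfolding K_def by blast
    assume "v \<in> K"
    then obtain a' b' c' where v: "v - (a' *s e1 + b' *s h1 + c' *s f1) \<in> M" unfolding K_def by blast
    have "(u + v) - ((a + a') *s e1 + (b + b') *s h1 + (c + c') *s f1) \<in> M"
      using M_rules(1)[OF u v] by (simp add: algebra_simps)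
    then show "u + v \<in> K" unfolding K_def by blast
  qed
  have KP: "K \<subseteq> P"
  proof
    fix u assume "u \<in> K"
    then obtain a b c where "u - (a *s e1 + b *s h1 + c *s f1) \<in> P" unfolding K_def using M(2) by blast
    moreover have "a *s e1 + b *s h1 + c *s f1 \<in> P" by (intro P_rules r1)
    ultimately show "u \<in> P" by (rule subspace_add_cancel[OF P_sub])
  qed
  have K_mem: "a *s e1 + b *s h1 + c *s f1 + m \<in> K" if "m \<in> M" for a b c m
    unfolding K_def using that by (intro CollectI exI[of _ a] exI[of _ b] exI[of _ c], simp)
  have "subalgebra K"
    unfolding subalgebra_def
  proof (intro conjI ballI \<open>subspace K\<close>)
    fix u v assume uv: "u \<in> K" "v \<in> K"
    then obtain a b c where u: "u - (a *s e1 + b *s h1 + c *s f1) \<in> M" unfolding K_def by blast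
    obtain a' b' c' where v: "v - (a' *s e1 + b' *s h1 + c' *s f1) \<in> M" using uv unfolding K_def by blast
    define m n where "m = u - (a *s e1 + b *s h1 + c *s f1)" and "n = v - (a' *s e1 + b' *s h1 + c' *s f1)"
    have mn: "m \<in> M" "n \<in> M" using u v by (auto simp: m_def n_def)
    define s t where "s = h1 \<bullet> e1 - 2 *s e1" and "t = h1 \<bullet> f1 + 2 *s f1"
    have st: "s \<in> M" "t \<in> M" using he hf by (auto simp: s_def t_def)
    have h: "h1 \<bullet> e1 = 2 *s e1 + s" "h1 \<bullet> f1 = t - 2 *s f1" by (auto simp: s_def t_def)
    have anti: "e1 \<bullet> h1 = - (2 *s e1 + s)" "f1 \<bullet> h1 = - (t - 2 *s f1)" "f1 \<bullet> e1 = - h1"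
      unfolding h[symmetric] unfolding h1_def by (rule bracket_anticommute)+
    have "u - m = a *s e1 + b *s h1 + c *s f1" and "v - n = a' *s e1 + b' *s h1 + c' *s f1"
      unfolding m_def n_def by simp_all
    moreover have "u \<bullet> v = (u - m) \<bullet> (v - n) + (u \<bullet> n + m \<bullet> (v - n))"
      by (simp add: bracket_diff_left bracket_diff_right)
    ultimately have "u \<bullet> v = (a *s e1 + b *s h1 + c *s f1) \<bullet> (a' *s e1 + b' *s h1 + c' *s f1)
        + (u \<bullet> n + m \<bullet> (v - n))" by metis
    also have "(a *s e1 + b *s h1 + c *s f1) \<bullet> (a' *s e1 + b' *s h1 + c' *s f1) =
        (2 * (b * a' - a * b')) *s e1 + (a * c' - c * a') *s h1 + (2 * (c * b' - b * c')) *s f1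
        + ((b * a' - a * b') *s s + (b * c' - c * b') *s t)"
      by (simp add: bracket_linear h anti h1_def[symmetric] algebra_simps)
    finally have "u \<bullet> v = (2 * (b * a' - a * b')) *s e1 + (a * c' - c * a') *s h1 + (2 * (c * b' - b * c')) *s f1
        + (((b * a' - a * b') *s s + (b * c' - c * b') *s t) + (u \<bullet> n + m \<bullet> (v - n)))"
      by (simp only: add.assoc)
    moreover have "u \<bullet> n \<in> M" using uv KP mn by (intro PA) auto
    moreover have "m \<bullet> (v - n) \<in> M" using uv KP mn M(2) by (intro AP P_rules) auto
    moreover have "(b * a' - a * b') *s s + (b * c' - c * b') *s t \<in> M" by (intro M_rules st)
    ultimately show "u \<bullet> v \<in> K" by (simp only: K_mem M_rules)
  qed
  moreover have "e1 \<in> K" "f1 \<in> K" using K_mem[of 0 1 0 0] K_mem[of 0 0 0 1] M_rules by simp_all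
  ultimately have "K = P" using minimal_lifts[OF _ KP ef1] by blast
  then have "w \<in> K" using w by blast
  then obtain a b c where abc: "w - (a *s e1 + b *s h1 + c *s f1) \<in> M" unfolding K_def by blast
  then have "w - (a *s e1 + b *s h1 + c *s f1) \<in> R" using M(2) by blast
  then have "w - (w - (a *s e1 + b *s h1 + c *s f1)) \<in> R" using w R_rules(2) by blast
  then have "a *s e1 + b *s (e1 \<bullet> f1) + c *s f1 \<in> R" by (simp only: h1_def) (simp add: algebra_simps)
  from lifts_independent[OF ef1 this] show "w \<in> M" using abc by simp
qed

text \<open>
  A one-dimensional quotient \<open>A/M\<close> is central in \<open>P/M\<close>, and a central extension of \<open>sl\<^sub>2\<close> splits: the
  defects of the relations are central, so they can be absorbed into \<open>e\<close> and \<open>f\<close>.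
\<close>

lemma no_ideal_of_codimension_one:
  assumes M: "P_ideal M" "M \<subseteq> A" and w: "w \<in> A" "\<And>x. x \<in> A \<Longrightarrow> \<exists>c. x - c *s w \<in> M"
  shows "w \<in> M"
proof -
  have sub: "subspace M" using M by (simp add: P_ideal_def)
  note M_rules = subspace_add[OF sub] subspace_diff[OF sub] subspace_scale[OF sub]
    subspace_neg[OF sub] subspace_0[OF sub]
  have PA: "x \<bullet> y \<in> M" if x: "x \<in> P" and y: "y \<in> A" for x y
  proof -
    have "x \<bullet> w \<in> M" using one_dimensional_action_trivial[OF M(1) _ x] w A_bracket by blast
    moreover obtain c where "y - c *s w \<in> M" using w(2) y by blast
    ultimately have "x \<bullet> (y - c *s w) + c *s (x \<bullet> w) \<in> M"
      using M(1) x by (intro M_rules) (auto simp: P_ideal_def)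
    then show ?thesis by (simp add: bracket_linear)
  qed
  have AP: "y \<bullet> x \<in> M" if "x \<in> P" "y \<in> A" for x y
    using M_rules(4)[OF PA[OF that]] bracket_anticommute[of y x] by simp
  obtain e f where ef: "lifts e f" using lifts_exist by blast
  note r = lifts_relations[OF ef]
  \<comment> \<open>Half of each defect is added to or subtracted from the lift; adding elements of \<open>A\<close> changes brackets only within \<open>M\<close>.\<close>
  define x y where "x = (1/2) *s ((e \<bullet> f) \<bullet> e - 2 *s e)" and "y = (- 1/2) *s ((e \<bullet> f) \<bullet> f + 2 *s f)"
  have xy: "x \<in> A" "y \<in> A" unfolding x_def y_def by (intro subspace_scale[OF A_sub] r)+
  have 2: "2 *s x = (e \<bullet> f) \<bullet> e - 2 *s e" "2 *s y = - ((e \<bullet> f) \<bullet> f + 2 *s f)"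
    unfolding x_def y_def using two_neq_zero by simp_all
  define e1 f1 h1 where "e1 = e + x" and "f1 = f + y" and "h1 = e1 \<bullet> f1"
  have ef1: "lifts e1 f1" unfolding e1_def f1_def using lifts_cong[OF ef xy] .
  note r1 = lifts_relations[OF ef1, folded h1_def]
  have h1: "h1 - e \<bullet> f \<in> M"
  proof -
    have "h1 - e \<bullet> f = e \<bullet> y + x \<bullet> f1" unfolding h1_def e1_def f1_def by (simp add: bracket_linear)
    then show ?thesis using PA[OF r(1) xy(2)] AP[OF r1(2) xy(1)] M_rules by simp
  qed
  have h1P: "(h1 - e \<bullet> f) \<bullet> z \<in> M" if "z \<in> P" for z
    using AP[OF that] h1 M(2) by blast
  have he: "h1 \<bullet> e1 - 2 *s e1 \<in> M"
  proof -
    have "h1 \<bullet> e1 - 2 *s e1 = (h1 - e \<bullet> f) \<bullet> e1 + (e \<bullet> f) \<bullet> x"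
      unfolding e1_def scale_right_distrib 2 by (simp add: bracket_linear)
    then show ?thesis using h1P[OF r1(1)] PA[OF r(3) xy(1)] M_rules by simp
  qed
  have hf: "h1 \<bullet> f1 + 2 *s f1 \<in> M"
  proof -
    have "h1 \<bullet> f1 + 2 *s f1 = (h1 - e \<bullet> f) \<bullet> f1 + (e \<bullet> f) \<bullet> y"
      unfolding f1_def scale_right_distrib 2 by (simp add: bracket_linear)
    then show ?thesis using h1P[OF r1(2)] PA[OF r(3) xy(2)] M_rules by simp
  qed
  have "A \<subseteq> M"
    using lifts_modulo[OF M ef1] he hf by (simp add: h1_def)
  then show ?thesis using w by blast
qed

text \<open>
  The generalized null space of the derivation \<open>ad x\<close> is a subalgebra. Every element differs from an
  element of it by one in the image of a high power of \<open>ad x\<close>, and that image lies in \<open>R\<close> because the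
  cube does. So the null space is a supplement.
\<close>

lemma ad_nilpotent:
  assumes x: "x \<in> P" and cube: "\<And>y. y \<in> P \<Longrightarrow> x \<bullet> (x \<bullet> (x \<bullet> y)) \<in> R" and y: "y \<in> P"
  shows "\<exists>n. ((\<bullet>) x ^^ n) y = 0"
proof -
  let ?g = "(\<bullet>) x"
  have g0: "(?g ^^ n) 0 = 0" for n by (induction n) auto
  have gadd: "(?g ^^ n) (u + v) = (?g ^^ n) u + (?g ^^ n) v" for n u v
    by (induction n) (auto simp: bracket_linear)
  have gscale: "(?g ^^ n) (c *s u) = c *s (?g ^^ n) u" for n u c
    by (induction n) (auto simp: bracket_linear)
  have gmore: "(?g ^^ (n + m)) u = 0" if "(?g ^^ n) u = 0" for n m u
    using that g0 by (simp add: add.commute[of n] funpow_add)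
  have gP: "(?g ^^ n) u \<in> P" if "u \<in> P" for n u
    using that x P_rules by (induction n) auto
  have leib: "(?g ^^ n) (u \<bullet> v) = 0" if "(?g ^^ a) u = 0" "(?g ^^ b) v = 0" "a + b = n" for a b n u v
    using that
  proof (induction n arbitrary: a b u v)
    case (Suc n)
    show ?case
    proof (cases "a = 0 \<or> b = 0")
      case True
      then have "u \<bullet> v = 0" using Suc.prems by auto
      then show ?thesis using g0 by metis
    next
      case False
      then obtain a' b' where ab: "a = Suc a'" "b = Suc b'" by (meson not0_implies_Suc)
      have "(?g ^^ a') (x \<bullet> u) = 0" "(?g ^^ b') (x \<bullet> v) = 0"
        using Suc.prems unfolding ab by (simp_all add: funpow_Suc_right del: funpow.simps)
      then have "(?g ^^ n) ((x \<bullet> u) \<bullet> v) = 0" "(?g ^^ n) (u \<bullet> (x \<bullet> v)) = 0"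
        using Suc.IH[of a' "x \<bullet> u" b v] Suc.IH[of a u b' "x \<bullet> v"] Suc.prems ab by auto
      then show ?thesis
        by (simp add: funpow_Suc_right leibniz[of x u v] gadd del: funpow.simps)
    qed
  qed simp
  define K where "K = {y \<in> P. \<exists>n. (?g ^^ n) y = 0}"
  have "subspace K"
    unfolding subspace_def
  proof (intro conjI ballI allI)
    show "0 \<in> K" using P_rules g0 by (auto simp: K_def)
    fix u v c assume u: "u \<in> K"
    then show "c *s u \<in> K" using P_rules by (auto simp: K_def gscale)
    assume v: "v \<in> K"
    from u v obtain a b where "(?g ^^ a) u = 0" "(?g ^^ b) v = 0" by (auto simp: K_def)
    then have "(?g ^^ (a + b)) (u + v) = 0"
      using gmore[of a u b] gmore[of b v a] by (simp add: gadd add.commute[of a b])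
    then show "u + v \<in> K" using u v P_rules by (auto simp: K_def)
  qed
  moreover have "u \<bullet> v \<in> K" if uv: "u \<in> K" "v \<in> K" for u v
  proof -
    obtain a b where "(?g ^^ a) u = 0" "(?g ^^ b) v = 0" using uv by (auto simp: K_def)
    from leib[OF this refl] show ?thesis using uv P_bracket by (auto simp: K_def)
  qed
  ultimately have K: "subalgebra K" by (simp add: subalgebra_def)
  have KP: "K \<subseteq> P" by (auto simp: K_def)
  have "K = P"
  proof (rule minimal[OF K KP])
    fix z
    obtain u where u: "u \<in> P" "z - u \<in> R" using supplement by blast
    obtain n where n: "n \<ge> 3" "(?g ^^ n) ((?g ^^ n) u) = (?g ^^ n) u"
      using idempotent_power[of 3 ?g u] by blast
    have "(?g ^^ n) (u - (?g ^^ n) u) = 0"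
      using gadd[of n u "- (?g ^^ n) u"] gscale[of n "- 1" "(?g ^^ n) u"] n by simp
    then have "u - (?g ^^ n) u \<in> K" using u gP P_rules by (auto simp: K_def)
    moreover have "(?g ^^ n) u \<in> R"
    proof -
      obtain m where m: "n = 3 + m" using n le_Suc_ex by blast
      have "(?g ^^ n) u = x \<bullet> (x \<bullet> (x \<bullet> (?g ^^ m) u))"
        unfolding m by (simp add: numeral_3_eq_3)
      then show ?thesis using cube[OF gP[OF u(1)]] by simp
    qed
    from R_rules(1)[OF u(2) this] have "z - (u - (?g ^^ n) u) \<in> R" by (simp add: algebra_simps)
    ultimately show "\<exists>y\<in>K. z - y \<in> R" by blast
  qed
  then show ?thesis using y by (auto simp: K_def)
qed

lemma lift_ad_nilpotent:
  assumes ef: "lifts e f" and y: "y \<in> P"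
  shows "\<exists>n. ((\<bullet>) e ^^ n) y = 0"
proof (rule ad_nilpotent[OF _ _ y])
  note r = lifts_relations[OF ef]
  show "e \<in> P" by fact
  fix z assume "z \<in> P"
  then obtain a b c u where z: "z = a *s e + b *s (e \<bullet> f) + c *s f + u" "u \<in> A"
    using lifts_span[OF ef] by blast
  define s where "s = (e \<bullet> f) \<bullet> e - 2 *s e"
  have s: "s \<in> R" using r s_def by auto
  have eh: "e \<bullet> (e \<bullet> f) = - (2 *s e + s)"
    using bracket_anticommute[of e "e \<bullet> f"] by (simp add: s_def)
  have "e \<bullet> (e \<bullet> (e \<bullet> z)) = e \<bullet> (e \<bullet> (e \<bullet> u)) - b *s (e \<bullet> (e \<bullet> s)) + c *s (e \<bullet> - s)"
    unfolding z by (simp add: bracket_linear eh)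
  moreover have "e \<bullet> (e \<bullet> (e \<bullet> u)) - b *s (e \<bullet> (e \<bullet> s)) + c *s (e \<bullet> - s) \<in> R"
    using s z(2) by (intro R_rules) auto
  ultimately show "e \<bullet> (e \<bullet> (e \<bullet> z)) \<in> R" by simp
qed

end

section \<open>The irreducible top factor\<close>

context minimal_supplement
begin

text \<open>
  Maximality of \<open>Z\<close> among the proper \<open>P\<close>-ideals of \<open>A\<close> says that \<open>A/Z\<close> is an irreducible module.
\<close>

definition top_ideal :: "'l set \<Rightarrow> bool" where
  "top_ideal Z \<longleftrightarrow> P_ideal Z \<and> Z \<subseteq> A \<and> Z \<noteq> A \<and>
    (\<forall>B. P_ideal B \<longrightarrow> Z \<subseteq> B \<longrightarrow> B \<subseteq> A \<longrightarrow> B = Z \<or> B = A)"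

lemma top_ideal_exists: "\<exists>Z. top_ideal Z"
proof -
  let ?Q = "\<lambda>Z. P_ideal Z \<and> Z \<subseteq> A \<and> Z \<noteq> A"
  have zero: "?Q {0}"
    using no_complement P_rules R_rules by (auto simp: P_ideal_def)
  have "\<forall>Z. ?Q Z \<longrightarrow> card Z < Suc (card (UNIV :: 'l set))"
    by (simp add: card_mono finite_UNIV less_Suc_eq_le)
  from ex_has_greatest_nat[where P = ?Q and f = card, OF zero this]
  obtain Z where Z: "?Q Z" and max: "\<forall>B. ?Q B \<longrightarrow> card B \<le> card Z" by auto
  have "B = Z \<or> B = A" if B: "P_ideal B" "Z \<subseteq> B" "B \<subseteq> A" for B
  proof (rule disjCI)
    assume "B \<noteq> A"
    then have "card B \<le> card Z" using max B by blast
    moreover have "finite B" using finite_UNIV by (rule finite_subset[OF subset_UNIV])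
    ultimately show "B = Z" using card_seteq[of B Z] B by simp
  qed
  then show ?thesis using Z unfolding top_ideal_def by blast
qed

lemma span_stable:
  assumes "\<And>s. s \<in> S \<Longrightarrow> x \<bullet> s \<in> span S" and "y \<in> span S"
  shows "x \<bullet> y \<in> span S"
proof -
  have "span S \<subseteq> {y. x \<bullet> y \<in> span S}"
    using assms(1) unfolding subspace_def[symmetric]
    by (intro span_minimal) (auto simp: subspace_def bracket_linear span_zero span_add span_scale)
  then show ?thesis using assms(2) by blast
qed

text \<open>
  The elements of \<open>P\<close> that preserve the span form a subalgebra, so it suffices to test two lifts.
\<close>

lemma P_ideal_span:
  assumes ef: "lifts e f"
    and S: "\<And>s. s \<in> S \<Longrightarrow> e \<bullet> s \<in> span S" "\<And>s. s \<in> S \<Longrightarrow> f \<bullet> s \<in> span S"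
  shows "P_ideal (span S)"
proof -
  let ?K = "{x \<in> P. \<forall>y\<in>span S. x \<bullet> y \<in> span S}"
  have "subspace ?K"
    unfolding subspace_def using P_rules
    by (auto simp: bracket_linear span_zero span_add span_scale)
  moreover have "x \<bullet> y \<in> ?K" if xy: "x \<in> ?K" "y \<in> ?K" for x y
  proof -
    have "(x \<bullet> y) \<bullet> w \<in> span S" if "w \<in> span S" for w
    proof -
      have "(x \<bullet> y) \<bullet> w = x \<bullet> (y \<bullet> w) - y \<bullet> (x \<bullet> w)" using leibniz[of x y w] by simp
      then show ?thesis using that xy by (auto intro!: span_diff)
    qed
    then show ?thesis using xy P_bracket by blast
  qed
  ultimately have "subalgebra ?K" by (simp add: subalgebra_def)
  moreover have "e \<in> ?K" "f \<in> ?K" using lifts_relations[OF ef] span_stable S by auto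
  ultimately have "?K = P" using minimal_lifts[OF _ _ ef] by blast
  then show ?thesis unfolding P_ideal_def by auto
qed

end

locale irreducible_top = minimal_supplement scale bracket Basis R P
  for scale :: "'k::{field,finite} \<Rightarrow> 'l::ab_group_add \<Rightarrow> 'l" (infixr "*s" 75)
    and bracket :: "'l \<Rightarrow> 'l \<Rightarrow> 'l" (infixl "\<bullet>" 70)
    and Basis R P +
  fixes Z :: "'l set"
  assumes top_ideal: "top_ideal Z"
begin

lemma Z_ideal: "P_ideal Z" and Z_subset: "Z \<subseteq> A" and Z_neq: "Z \<noteq> A"
  and Z_maximal: "P_ideal B \<Longrightarrow> Z \<subseteq> B \<Longrightarrow> B \<subseteq> A \<Longrightarrow> B = Z \<or> B = A"
  using top_ideal unfolding top_ideal_def by auto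

lemma Z_sub: "subspace Z" and Z_left: "x \<in> P \<Longrightarrow> z \<in> Z \<Longrightarrow> x \<bullet> z \<in> Z"
  using Z_ideal unfolding P_ideal_def by auto

lemma span_Z [simp]: "span Z = Z"
  using Z_sub by simp

lemmas Z_rules = subspace_add[OF Z_sub] subspace_diff[OF Z_sub] subspace_scale[OF Z_sub]
  subspace_neg[OF Z_sub] subspace_0[OF Z_sub]

lemmas A_rules = subspace_add[OF A_sub] subspace_diff[OF A_sub] subspace_scale[OF A_sub]
  subspace_neg[OF A_sub] subspace_0[OF A_sub]

lemma Z_scale_cancel: "c *s x \<in> Z \<Longrightarrow> c \<noteq> 0 \<Longrightarrow> x \<in> Z"
  using Z_rules(3)[of "c *s x" "1 / c"] by simp

text \<open>
  Irreducibility in the form in which it is applied: a set that is stable under two lifts and is not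
  contained in \<open>Z\<close> generates \<open>A\<close>.
\<close>

lemma generates:
  assumes "lifts e f" and S: "Z \<subseteq> S" "S \<subseteq> A" "v \<in> S" "v \<notin> Z"
    and stable: "\<And>s. s \<in> S - Z \<Longrightarrow> e \<bullet> s \<in> span S" "\<And>s. s \<in> S - Z \<Longrightarrow> f \<bullet> s \<in> span S"
  shows "A = span S"
proof -
  note r = lifts_relations[OF assms(1)]
  have Z: "x \<bullet> s \<in> span S" if "s \<in> Z" "x \<in> P" for x s
    using Z_left[OF that(2,1)] S(1) by (auto intro: span_base)
  have "e \<bullet> s \<in> span S" "f \<bullet> s \<in> span S" if "s \<in> S" for s
    using that stable[of s] Z[of s e] Z[of s f] r(1,2) by (cases "s \<in> Z"; simp)+
  then have "P_ideal (span S)" by (rule P_ideal_span[OF assms(1)])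
  moreover have "Z \<subseteq> span S" using S(1) span_superset by blast
  moreover have "span S \<subseteq> A" using S(2) A_sub by (rule span_minimal)
  moreover have "v \<in> span S" using S(3) by (rule span_base)
  ultimately show ?thesis using Z_maximal[of "span S"] S(4) by auto
qed

lemma not_one_dimensional: "w \<in> A \<Longrightarrow> A \<noteq> span (insert w Z)"
proof
  assume w: "w \<in> A" and eq: "A = span (insert w Z)"
  have "\<exists>c. x - c *s w \<in> Z" if "x \<in> A" for x
    using that unfolding eq span_breakdown_eq by simp
  then have "w \<in> Z" using no_ideal_of_codimension_one[OF Z_ideal Z_subset w] by blast
  then have "span (insert w Z) = Z" by (simp add: insert_absorb)
  then show False using eq Z_neq by simp
qed

lemma dim_A: "dim A \<le> 3"
  using dim_subset[of A R] dim_R by simp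

text \<open>
  The codimension of \<open>Z\<close> in \<open>A\<close> is at least two and \<open>A\<close> has dimension at most three.
\<close>

lemma dim_Z: "dim Z \<le> 1"
proof -
  obtain x where x: "x \<in> A" "x \<notin> Z" using Z_subset Z_neq by blast
  have "span (insert x Z) \<subseteq> A" using x Z_subset by (intro span_minimal A_sub) auto
  then obtain y where y: "y \<in> A" "y \<notin> span (insert x Z)"
    using not_one_dimensional[OF x(1)] by blast
  have "dim (insert y (insert x Z)) \<le> dim A"
    using x y Z_subset by (intro dim_subset) auto
  moreover have "dim (insert y (insert x Z)) = dim Z + 2" using x(2) y(2) by (simp add: dim_insert)
  ultimately show ?thesis using dim_A by simp
qed

lemma Z_line: "\<exists>z. Z = span {z}"
proof (cases "Z = {0}")
  case True
  then show ?thesis by (intro exI[of _ 0]) simp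
next
  case False
  then obtain z where z: "z \<in> Z" "z \<noteq> 0" using Z_rules(5) by blast
  have "span {z} = Z"
    using z dim_Z by (intro subspace_dim_equal Z_sub) (auto intro: span_minimal[OF _ Z_sub, THEN subsetD] simp: dim_span)
  then show ?thesis by metis
qed

text \<open>
  A line is acted on by a character, and \<open>P\<close> is its own derived algebra.
\<close>

lemma Z_central: "y \<in> Z \<Longrightarrow> x \<in> P \<Longrightarrow> x \<bullet> y = 0" "y \<in> Z \<Longrightarrow> x \<in> P \<Longrightarrow> y \<bullet> x = 0"
proof -
  obtain z where z: "Z = span {z}" using Z_line by blast
  have zZ: "z \<in> Z" unfolding z by (simp add: span_base)
  have "P_ideal {0}" by (simp add: P_ideal_def)
  moreover have "\<exists>c. x \<bullet> z - c *s z \<in> {0}" if "x \<in> P" for x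
    using Z_left[OF that zZ] unfolding z span_singleton by auto
  ultimately have 1: "x \<bullet> z \<in> {0}" if "x \<in> P" for x
    using one_dimensional_action_trivial that by blast
  show 2: "x \<bullet> y = 0" if "y \<in> Z" "x \<in> P" for x y
    using that 1 unfolding z span_singleton by (auto simp: bracket_linear)
  show "y \<bullet> x = 0" if "y \<in> Z" "x \<in> P" for x y
    using 2[OF that] bracket_anticommute[of y x] by simp
qed

text \<open>
  Otherwise \<open>A = [A, A] + Z\<close> by irreducibility. As \<open>Z\<close> is central, \<open>[A, A]\<close> would then be its own derived
  algebra, against the solvability of \<open>R\<close>.
\<close>

lemma A_abelian_modulo: "x \<in> A \<Longrightarrow> y \<in> A \<Longrightarrow> x \<bullet> y \<in> Z"
proof -
  let ?D = "{x \<bullet> y | x y. x \<in> A \<and> y \<in> A}"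
  define B where "B = span (?D \<union> Z)"
  have D: "derived_series A (Suc 0) = span ?D" by simp
  have BA: "B \<subseteq> A" unfolding B_def using A_bracket Z_subset by (intro span_minimal A_sub) blast
  have stable: "x \<bullet> s \<in> span (?D \<union> Z)" if x: "x \<in> P" and s: "s \<in> ?D \<union> Z" for x s
  proof (cases "s \<in> Z")
    case True
    then show ?thesis using Z_left[OF x] by (auto intro: span_base)
  next
    case False
    then obtain u w where uw: "s = u \<bullet> w" "u \<in> A" "w \<in> A" using s by blast
    have "x \<bullet> u \<in> A" "x \<bullet> w \<in> A" using A_bracket x uw by blast+
    then have "(x \<bullet> u) \<bullet> w \<in> ?D" "u \<bullet> (x \<bullet> w) \<in> ?D" using uw by blast+
    then show ?thesis unfolding uw leibniz[of x] by (intro span_add span_base) auto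
  qed
  have "x \<bullet> y \<in> B" if "x \<in> P" "y \<in> B" for x y
    using span_stable[OF stable[OF that(1)]] that(2) unfolding B_def by simp
  then have "P_ideal B" unfolding P_ideal_def by (simp add: B_def)
  moreover have "Z \<subseteq> B" unfolding B_def using span_superset by blast
  ultimately have "B = Z \<or> B = A" using Z_maximal BA by blast
  moreover have "B \<noteq> A"
  proof
    assume "B = A"
    have prod: "u \<bullet> w \<in> derived_series A 2" if uw: "u \<in> A" "w \<in> A" for u w
    proof -
      have split: "\<exists>d z. u = d + z \<and> d \<in> span ?D \<and> z \<in> Z" if "u \<in> B" for u
        using that unfolding B_def span_Un span_Z by blast
      obtain d z where d: "u = d + z" "d \<in> span ?D" "z \<in> Z"
        using split[of u] uw(1) \<open>B = A\<close> by blast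
      obtain d' z' where d': "w = d' + z'" "d' \<in> span ?D" "z' \<in> Z"
        using split[of w] uw(2) \<open>B = A\<close> by blast
      have "u \<bullet> w = d \<bullet> d'"
      proof -
        have "z \<in> P" using d(3) Z_subset by blast
        then have "z \<bullet> z' = 0" "u \<bullet> z' = 0" "z \<bullet> w = 0"
          using Z_central d(3) d'(3) uw by blast+
        then show ?thesis using d(1) d'(1) by (simp add: bracket_linear)
      qed
      then show ?thesis unfolding numeral_2_eq_2 derived_series.simps using d(2) d'(2)
        by (intro span_base) blast
    qed
    have 2: "derived_series A (Suc 0) \<subseteq> derived_series A 2"
      unfolding D using prod by (intro span_minimal) (auto simp: numeral_2_eq_2)
    have "derived_series A (Suc 0) \<subseteq> derived_series A (Suc n)" for n
    proof (induction n)
      case (Suc n)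
      have "derived_series (derived_series A (Suc 0)) (Suc 0) \<subseteq> derived_series (derived_series A (Suc n)) (Suc 0)"
        using Suc by (rule derived_series_mono)
      then show ?case using 2 derived_series_add[of A "Suc 0" "Suc 0"] derived_series_add[of A "Suc n" "Suc 0"]
        by (simp add: numeral_2_eq_2)
    qed simp
    moreover obtain n where "derived_series R n = {0}" using R_solvable solvable_def by blast
    moreover have "derived_series A (Suc n) \<subseteq> derived_series R (Suc n)" for n
      by (rule derived_series_mono) blast
    moreover have "derived_series R (Suc n) \<subseteq> {0}" if "derived_series R n = {0}" for n
      using that by (intro derived_series_Suc_subset) auto
    ultimately have "derived_series A (Suc 0) \<subseteq> {0}" by (meson subset_trans)
    then have "?D \<subseteq> {0}" unfolding D by (rule order_trans[OF span_superset])
    moreover have "{0} \<subseteq> Z" using Z_rules by simp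
    ultimately have "?D \<union> Z \<subseteq> Z" by (meson Un_least order_refl order_trans)
    then have "B \<subseteq> Z" unfolding B_def using Z_sub by (rule span_minimal)
    then show False using Z_neq Z_subset \<open>B = A\<close> by blast
  qed
  ultimately have B: "B = Z" by blast
  show "x \<bullet> y \<in> Z" if "x \<in> A" "y \<in> A" for x y
  proof -
    have "x \<bullet> y \<in> B" unfolding B_def using that by (intro span_base UnI1) blast
    then show ?thesis using B by simp
  qed
qed

lemma ad_power_zero:
  assumes ef: "lifts e f" shows "\<exists>n. \<forall>y\<in>A. ((\<bullet>) e ^^ n) y = 0"
proof -
  have zero: "((\<bullet>) e ^^ n) 0 = 0" for n by (induction n) auto
  have "\<forall>y\<in>A. \<exists>n. ((\<bullet>) e ^^ n) y = 0" using lift_ad_nilpotent[OF ef] by blast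
  then obtain n where n: "\<forall>y\<in>A. ((\<bullet>) e ^^ n y) y = 0" by metis
  have fin: "finite A" using finite_UNIV by (rule finite_subset[OF subset_UNIV])
  have "((\<bullet>) e ^^ sum n A) y = 0" if "y \<in> A" for y
  proof -
    have "n y \<le> sum n A" using that fin by (intro member_le_sum) auto
    then obtain k where "sum n A = k + n y" using le_Suc_ex by (metis add.commute)
    then show ?thesis using n that zero by (simp add: funpow_add)
  qed
  then show ?thesis by blast
qed

text \<open>
  The kernel of the action on \<open>A/Z\<close> is an ideal of \<open>P\<close> that contains \<open>A\<close>. If it contained \<open>e\<close>, then also \<open>h\<close>
  and \<open>f\<close>, and every line of \<open>A/Z\<close> would be a submodule.
\<close>

lemma acts_nontrivially:
  assumes ef: "lifts e f" shows "\<exists>y\<in>A. e \<bullet> y \<notin> Z"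
proof (rule ccontr)
  assume "\<not> ?thesis"
  then have triv: "e \<bullet> y \<in> Z" if "y \<in> A" for y using that by blast
  note r = lifts_relations[OF ef]
  let ?K = "{x \<in> P. \<forall>y\<in>A. x \<bullet> y \<in> Z}"
  have sub: "subspace ?K"
    unfolding subspace_def using P_rules Z_rules by (auto simp: bracket_linear)
  have K_ideal: "x \<bullet> k \<in> ?K" if x: "x \<in> P" and k: "k \<in> ?K" for x k
  proof -
    have "(x \<bullet> k) \<bullet> y \<in> Z" if y: "y \<in> A" for y
    proof -
      have "(x \<bullet> k) \<bullet> y = x \<bullet> (k \<bullet> y) - k \<bullet> (x \<bullet> y)" using leibniz[of x k y] by simp
      moreover have "k \<bullet> y \<in> Z" using k y by blast
      moreover have "k \<bullet> (x \<bullet> y) \<in> Z" using k A_bracket(1)[OF x y] by blast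
      ultimately show ?thesis using Z_left[OF x] Z_rules(2) by simp
    qed
    then show ?thesis using x k P_bracket by blast
  qed
  have e: "e \<in> ?K" using triv r by blast
  have neg: "- k \<in> ?K" if "k \<in> ?K" for k using subspace_neg[OF sub that] .
  have "- (f \<bullet> e) \<in> ?K" using neg[OF K_ideal[OF r(2) e]] .
  then have h: "e \<bullet> f \<in> ?K" using bracket_anticommute[of e f] by simp
  have "- (f \<bullet> (e \<bullet> f)) \<in> ?K" using neg[OF K_ideal[OF r(2) h]] .
  then have hf: "(e \<bullet> f) \<bullet> f \<in> ?K" using bracket_anticommute[of "e \<bullet> f" f] by simp
  have "(e \<bullet> f) \<bullet> f + 2 *s f \<in> ?K" using r(5) A_abelian_modulo by blast
  from subspace_diff[OF sub this hf] have "2 *s f \<in> ?K" by simp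
  from subspace_scale[OF sub this, of "1/2"] have f: "f \<in> ?K" using two_neq_zero by simp
  have "subalgebra ?K" unfolding subalgebra_def using sub K_ideal by blast
  then have K: "?K = P" using minimal_lifts[OF _ _ ef e f] by blast
  obtain w where w: "w \<in> A" "w \<notin> Z" using Z_subset Z_neq by blast
  have "x \<bullet> w \<in> span (insert w Z)" if "x \<in> P" for x
  proof -
    have "x \<bullet> w \<in> Z" using that K w by blast
    then show ?thesis by (simp add: span_base)
  qed
  then have "A = span (insert w Z)"
    using r(1,2) w Z_subset by (intro generates[OF ef, of _ w]) auto
  then show False using not_one_dimensional w by blast
qed

text \<open>
  Vectors that an operator moves step by step into \<open>Z\<close> are linearly independent modulo \<open>Z\<close>. Three of
  them fill the dimensions that are available, so that \<open>Z\<close> vanishes and a fourth one cannot exist.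
\<close>

lemma chain_dim:
  assumes x: "x \<in> P" and x1: "x1 \<in> A" "x1 \<notin> Z" "x \<bullet> x1 \<in> Z" and x2: "x2 \<in> A" "x \<bullet> x2 = x1"
    and x3: "x3 \<in> A" "x \<bullet> x3 = x2"
  shows "Z = {0}" "A = span {x1, x2, x3}" "a *s x1 + b *s x2 + c *s x3 = 0 \<Longrightarrow> a = 0 \<and> b = 0 \<and> c = 0"
    "x4 \<in> A \<Longrightarrow> x \<bullet> x4 \<noteq> x3"
proof -
  have x2_out: "x2 \<notin> span (insert x1 Z)"
  proof
    assume "x2 \<in> span (insert x1 Z)"
    then obtain k where "x2 - k *s x1 \<in> Z" by (auto simp: span_breakdown_eq)
    then have "x \<bullet> (x2 - k *s x1) + k *s (x \<bullet> x1) \<in> Z" using x x1 Z_rules Z_left by meson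
    then show False using x1 x2 by (simp add: bracket_linear)
  qed
  have x3_out: "x3 \<notin> span (insert x2 (insert x1 Z))"
  proof
    assume "x3 \<in> span (insert x2 (insert x1 Z))"
    then obtain k l where "x3 - k *s x2 - l *s x1 \<in> Z" by (auto simp: span_breakdown_eq)
    then have "x \<bullet> (x3 - k *s x2 - l *s x1) + l *s (x \<bullet> x1) \<in> Z" using x x1 Z_rules Z_left by meson
    then have "x2 - k *s x1 \<in> Z" using x2 x3 by (simp add: bracket_linear)
    then show False using x2_out by (auto simp: span_breakdown_eq)
  qed
  let ?S = "insert x3 (insert x2 (insert x1 Z))"
  have dim: "dim ?S = dim Z + 3"
    using x1(2) x2_out x3_out by (simp add: dim_insert)
  have SA: "span ?S \<subseteq> A" using x1 x2 x3 Z_subset by (intro span_minimal A_sub) auto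
  have "dim ?S \<le> dim A" by (intro dim_subset order_trans[OF span_superset SA])
  then have dimZ: "dim Z = 0" and dimA: "dim A = 3" using dim dim_A by linarith+
  then show Z0: "Z = {0}" using Z_rules(5) by auto
  have S: "span ?S = A" using dim dimA dimZ by (intro subspace_dim_equal A_sub SA) auto
  also have "span ?S = span {x1, x2, x3}"
    by (rule span_eq[THEN iffD2]) (auto simp: Z0 span_zero intro: span_base)
  finally show A: "A = span {x1, x2, x3}" by simp
  have indep: "a = 0 \<and> b = 0 \<and> c = 0" if eq: "a *s x1 + b *s x2 + c *s x3 = 0" for a b c
  proof -
    have xx1: "x \<bullet> x1 = 0" using x1 Z0 by blast
    have 1: "b *s x1 + c *s x2 = 0"
      using arg_cong[OF eq, of "\<lambda>y. x \<bullet> y"] by (simp add: bracket_linear x2 x3 xx1)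
    have 2: "c *s x1 = 0"
      using arg_cong[OF 1, of "\<lambda>y. x \<bullet> y"] by (simp add: bracket_linear x2 x3 xx1)
    have "x1 \<noteq> 0" using x1 Z0 by blast
    then have "c = 0" using 2 by simp
    moreover from this have "b = 0" using 1 \<open>x1 \<noteq> 0\<close> by simp
    ultimately show ?thesis using eq \<open>x1 \<noteq> 0\<close> by simp
  qed
  then show "a *s x1 + b *s x2 + c *s x3 = 0 \<Longrightarrow> a = 0 \<and> b = 0 \<and> c = 0" .
  show "x \<bullet> x4 \<noteq> x3" if "x4 \<in> A"
  proof
    assume x4: "x \<bullet> x4 = x3"
    have "x4 \<in> span {x1, x2, x3}" using that A by simp
    then obtain a b c where "x4 = a *s x1 + b *s x2 + c *s x3"
      by (auto simp: span_breakdown_eq algebra_simps)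
    then have "x3 = b *s x1 + c *s x2" using x4 x2 x3 x1 Z0 by (auto simp: bracket_linear)
    then have "(- b) *s x1 + (- c) *s x2 + 1 *s x3 = 0" by simp
    then show False using indep[of "- b" "- c" 1] by simp
  qed
qed

text \<open>
  Let \<open>n\<close> be maximal such that \<open>e\<^sup>n\<close> does not vanish on \<open>A/Z\<close>. Then \<open>n \<ge> 1\<close>, and the image of \<open>e\<^sup>n\<close> is
  one-dimensional, since two independent images together with their preimages would span four
  dimensions. The image is stable under \<open>h\<close> and killed by \<open>e\<close>. Thus no eigenvalue has to be found in
  an extension of the field.
\<close>

lemma highest_weight_vector:
  assumes ef: "lifts e f"
  obtains v l where "v \<in> A" "v \<notin> Z" "e \<bullet> v \<in> Z" "(e \<bullet> f) \<bullet> v - l *s v \<in> Z"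
proof -
  note r = lifts_relations[OF ef]
  let ?g = "(\<bullet>) e"
  have gA: "(?g ^^ n) y \<in> A" if "y \<in> A" for n y
    using that A_bracket(1)[OF r(1)] by (induction n) auto
  have gZ: "(?g ^^ n) y \<in> Z" if "y \<in> Z" for n y
    using that Z_left[OF r(1)] by (induction n) auto
  have gadd: "(?g ^^ n) (u + v) = (?g ^^ n) u + (?g ^^ n) v" for n u v
    by (induction n) (auto simp: bracket_linear)
  have gscale: "(?g ^^ n) (c *s u) = c *s (?g ^^ n) u" for n u c
    by (induction n) (auto simp: bracket_linear)
  have gdiff: "(?g ^^ n) (u - v) = (?g ^^ n) u - (?g ^^ n) v" for n u v
    using gadd[of n u "- v"] gscale[of n "- 1" v] by simp
  define m where "m = (LEAST m. \<forall>y\<in>A. (?g ^^ m) y \<in> Z)"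
  have "\<exists>m. \<forall>y\<in>A. (?g ^^ m) y \<in> Z" using ad_power_zero[OF ef] Z_rules(5) by metis
  then have m: "\<forall>y\<in>A. (?g ^^ m) y \<in> Z" unfolding m_def by (rule LeastI_ex)
  have less: "\<exists>y\<in>A. (?g ^^ k) y \<notin> Z" if "k < m" for k
    using not_less_Least[OF that[unfolded m_def]] by blast
  have "m \<noteq> 0" using m Z_subset Z_neq by auto
  moreover have "m \<noteq> 1" using m acts_nontrivially[OF ef] by auto
  ultimately obtain n where n: "m = Suc n" "n \<ge> 1" by (metis One_nat_def Suc_le_eq not0_implies_Suc not_gr0)
  obtain u where u: "u \<in> A" "(?g ^^ n) u \<notin> Z" using less[of n] n by auto
  define v where "v = (?g ^^ n) u"
  have v: "v \<in> A" "v \<notin> Z" using u gA by (auto simp: v_def)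
  have ev: "e \<bullet> v \<in> Z" using m u unfolding v_def n by simp
  have gnn: "(?g ^^ n) ((?g ^^ n) y) \<in> Z" if "y \<in> A" for y
  proof -
    obtain k where k: "n = Suc k" using n by (metis Suc_le_D One_nat_def)
    have "(?g ^^ n) ((?g ^^ n) y) = (?g ^^ k) ((?g ^^ m) y)"
      unfolding n k by (simp add: funpow_swap1 flip: funpow_add[THEN fun_cong, unfolded o_def])
    then show ?thesis using gZ m that by simp
  qed
  have rank_one: "\<exists>c. (?g ^^ n) y - c *s v \<in> Z" if y: "y \<in> A" for y
  proof (rule ccontr)
    assume none: "\<not> ?thesis"
    define v' where "v' = (?g ^^ n) y"
    have v': "v' \<in> A" using gA y v'_def by simp
    have 1: "v' \<notin> span (insert v Z)" using none by (auto simp: v'_def span_breakdown_eq)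
    have kills: "(?g ^^ n) w \<in> Z" if w: "w \<in> span (insert v' (insert v Z))" for w
    proof -
      obtain a b where ab: "w - a *s v' - b *s v \<in> Z" using w by (auto simp: span_breakdown_eq)
      have "(?g ^^ n) v' \<in> Z" "(?g ^^ n) v \<in> Z" unfolding v'_def v_def using gnn y u by auto
      then have "(?g ^^ n) (w - a *s v' - b *s v) + a *s (?g ^^ n) v' + b *s (?g ^^ n) v \<in> Z"
        using gZ[OF ab] Z_rules by meson
      then show ?thesis by (simp add: gdiff gscale)
    qed
    have 2: "u \<notin> span (insert v' (insert v Z))" using kills[of u] u by blast
    have 3: "y \<notin> span (insert u (insert v' (insert v Z)))"
    proof
      assume "y \<in> span (insert u (insert v' (insert v Z)))"
      then obtain c where "y - c *s u \<in> span (insert v' (insert v Z))" unfolding span_breakdown_eq by blast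
      then have "(?g ^^ n) (y - c *s u) \<in> Z" by (rule kills)
      then show False using none by (auto simp: gdiff gscale v_def)
    qed
    have "dim (insert y (insert u (insert v' (insert v Z)))) = dim Z + 4"
      using 1 2 3 v(2) by (simp add: dim_insert)
    moreover have "dim (insert y (insert u (insert v' (insert v Z)))) \<le> dim A"
      using y u v v' Z_subset by (intro dim_subset) auto
    ultimately show False using dim_A by simp
  qed
  define a where "a = (e \<bullet> f) \<bullet> e - 2 *s e"
  have a: "a \<in> A" "(e \<bullet> f) \<bullet> e = 2 *s e + a" using r(4) by (auto simp: a_def)
  have shift: "(e \<bullet> f) \<bullet> (?g ^^ k) w - ((?g ^^ k) ((e \<bullet> f) \<bullet> w) + (2 * of_nat k) *s (?g ^^ k) w) \<in> Z"
    if w: "w \<in> A" for k w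
  proof (induction k)
    case 0
    then show ?case using Z_rules by simp
  next
    case (Suc k)
    define y where "y = (?g ^^ k) w"
    have y: "y \<in> A" using gA w y_def by simp
    define z where "z = (e \<bullet> f) \<bullet> y - ((?g ^^ k) ((e \<bullet> f) \<bullet> w) + (2 * of_nat k) *s y)"
    have z: "z \<in> Z" using Suc by (simp add: z_def y_def)
    have "(e \<bullet> f) \<bullet> (e \<bullet> y) = (2 *s e + a) \<bullet> y + e \<bullet> ((?g ^^ k) ((e \<bullet> f) \<bullet> w) + (2 * of_nat k) *s y + z)"
      unfolding leibniz[of "e \<bullet> f" e y] a(2) by (simp add: z_def)
    then have "(e \<bullet> f) \<bullet> (e \<bullet> y) - (e \<bullet> (?g ^^ k) ((e \<bullet> f) \<bullet> w) + (2 * of_nat (Suc k)) *s (e \<bullet> y))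
        = a \<bullet> y + e \<bullet> z"
      by (simp add: bracket_linear algebra_simps)
    moreover have "a \<bullet> y + e \<bullet> z \<in> Z" using A_abelian_modulo a(1) y Z_left[OF r(1) z] Z_rules(1) by blast
    ultimately show ?case by (simp add: y_def)
  qed
  obtain c where c: "(?g ^^ n) ((e \<bullet> f) \<bullet> u) - c *s v \<in> Z"
    using rank_one[OF A_bracket(1)[OF r(3) u(1)]] by blast
  have "(e \<bullet> f) \<bullet> v - ((?g ^^ n) ((e \<bullet> f) \<bullet> u) + (2 * of_nat n) *s v) \<in> Z"
    using shift[OF u(1), of n] by (simp add: v_def)
  from Z_rules(1)[OF this c] have "(e \<bullet> f) \<bullet> v - (c + 2 * of_nat n) *s v \<in> Z"
    by (simp add: algebra_simps)
  then show thesis using that v ev by blast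
qed

text \<open>
  The usual recursion along the string \<open>v, [f, v], [f, [f, v]], \<dots>\<close> holds modulo \<open>Z\<close> because the defects
  of the relations lie in \<open>A\<close>, which acts on \<open>A\<close> with values in \<open>Z\<close>. The coefficient in front of the last
  vector outside \<open>Z\<close> has to vanish, and this determines the weight.
\<close>

lemma weight_string:
  assumes ef: "lifts e f" and v: "v \<in> A" "e \<bullet> v \<in> Z" "(e \<bullet> f) \<bullet> v - l *s v \<in> Z"
  shows "(e \<bullet> f) \<bullet> (f \<bullet> v) - (l - 2) *s (f \<bullet> v) \<in> Z" "e \<bullet> (f \<bullet> v) - l *s v \<in> Z"
    "e \<bullet> (f \<bullet> (f \<bullet> v)) - (2 * (l - 1)) *s (f \<bullet> v) \<in> Z"
    "(e \<bullet> f) \<bullet> (f \<bullet> (f \<bullet> v)) - (l - 4) *s (f \<bullet> (f \<bullet> v)) \<in> Z"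
    "e \<bullet> (f \<bullet> (f \<bullet> (f \<bullet> v))) - (3 * (l - 2)) *s (f \<bullet> (f \<bullet> v)) \<in> Z"
proof -
  note r = lifts_relations[OF ef]
  have h: "(e \<bullet> f) \<bullet> (f \<bullet> y) - (m - 2) *s (f \<bullet> y) \<in> Z"
    if y: "y \<in> A" "(e \<bullet> f) \<bullet> y - m *s y \<in> Z" for y m
  proof -
    define b where "b = (e \<bullet> f) \<bullet> f + 2 *s f"
    have b: "(e \<bullet> f) \<bullet> f = b - 2 *s f" "b \<in> A" using r(5) by (auto simp: b_def)
    have "(e \<bullet> f) \<bullet> (f \<bullet> y) - (m - 2) *s (f \<bullet> y) = b \<bullet> y + f \<bullet> ((e \<bullet> f) \<bullet> y - m *s y)"
      unfolding leibniz[of "e \<bullet> f" f y] b(1) by (simp add: bracket_linear algebra_simps)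
    then show ?thesis using A_abelian_modulo[OF b(2) y(1)] Z_left[OF r(2) y(2)] Z_rules(1) by simp
  qed
  have e: "e \<bullet> (f \<bullet> y) - (m + n) *s y \<in> Z"
    if y: "(e \<bullet> f) \<bullet> y - m *s y \<in> Z" "f \<bullet> (e \<bullet> y) - n *s y \<in> Z" for y m n
    using Z_rules(1)[OF y] unfolding leibniz[of e f y] by (simp add: algebra_simps)
  have f: "f \<bullet> (e \<bullet> (f \<bullet> y)) - n *s (f \<bullet> y) \<in> Z" if "e \<bullet> (f \<bullet> y) - n *s y \<in> Z" for y n
    using Z_left[OF r(2) that] by (simp add: bracket_linear)
  have fA: "f \<bullet> v \<in> A" "f \<bullet> (f \<bullet> v) \<in> A" using A_bracket(1)[OF r(2)] v(1) by auto
  show 1: "(e \<bullet> f) \<bullet> (f \<bullet> v) - (l - 2) *s (f \<bullet> v) \<in> Z" using h v by blast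
  show 2: "e \<bullet> (f \<bullet> v) - l *s v \<in> Z" using e[OF v(3), of 0] Z_left[OF r(2) v(2)] by simp
  have "(l - 2) + l = 2 * (l - 1)" by simp
  then show 3: "e \<bullet> (f \<bullet> (f \<bullet> v)) - (2 * (l - 1)) *s (f \<bullet> v) \<in> Z"
    using e[OF 1 f[OF 2]] by simp
  have "(l - 2) - 2 = l - 4" by simp
  then show 4: "(e \<bullet> f) \<bullet> (f \<bullet> (f \<bullet> v)) - (l - 4) *s (f \<bullet> (f \<bullet> v)) \<in> Z"
    using h[OF fA(1) 1] by simp
  have "(l - 4) + 2 * (l - 1) = 3 * (l - 2)" by (simp add: algebra_simps)
  then show "e \<bullet> (f \<bullet> (f \<bullet> (f \<bullet> v))) - (3 * (l - 2)) *s (f \<bullet> (f \<bullet> v)) \<in> Z"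
    using e[OF 4 f[OF 3]] by simp
qed

lemma scale_four: "4 *s x = x + x + (x + x)"
  using scale_left_distrib[of 2 2 x] by (simp add: scale_two)

text \<open>
  The Casimir element of \<open>sl\<^sub>2\<close> is homotopic to zero on the cochains with values in \<open>A\<close>. If it acts as a
  nonzero scalar \<open>c\<close>, then the homotopy, divided by \<open>c\<close>, turns the defects \<open>[h, e] - 2e\<close> and \<open>[h, f] + 2f\<close>
  into corrections of \<open>e\<close> and \<open>f\<close> after which the relations hold exactly. That contradicts \<open>A \<noteq> 0\<close>.
\<close>

lemma casimir_splitting:
  assumes ef: "lifts e f" and abelian: "\<And>x y. x \<in> A \<Longrightarrow> y \<in> A \<Longrightarrow> x \<bullet> y = 0"
    and casimir: "\<And>x. x \<in> A \<Longrightarrow>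
      (e \<bullet> f) \<bullet> ((e \<bullet> f) \<bullet> x) - 2 *s ((e \<bullet> f) \<bullet> x) + 4 *s (e \<bullet> (f \<bullet> x)) = c *s x"
  shows "c = 0"
proof (rule ccontr)
  assume c: "c \<noteq> 0"
  note r = lifts_relations[OF ef]
  define h where "h = e \<bullet> f"
  define a b where "a = h \<bullet> e - 2 *s e" and "b = h \<bullet> f + 2 *s f"
  have ab: "a \<in> A" "b \<in> A" using r(4,5) by (simp_all add: a_def b_def h_def)
  have he: "h \<bullet> e = 2 *s e + a" and hf: "h \<bullet> f = b - 2 *s f" by (simp_all add: a_def b_def)
  have hA: "h \<bullet> w \<in> A" and eA: "e \<bullet> w \<in> A" and fA: "f \<bullet> w \<in> A" if "w \<in> A" for w
    using A_bracket(1) r(1-3) that unfolding h_def by blast+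
  have eh: "e \<bullet> (h \<bullet> w) = h \<bullet> (e \<bullet> w) - 2 *s (e \<bullet> w)" if "w \<in> A" for w
    unfolding leibniz[of h e w] he using abelian[OF ab(1) that] by (simp add: bracket_linear)
  have fh: "f \<bullet> (h \<bullet> w) = h \<bullet> (f \<bullet> w) + 2 *s (f \<bullet> w)" if "w \<in> A" for w
    unfolding leibniz[of h f w] hf using abelian[OF ab(2) that] by (simp add: bracket_linear)
  have ef_fe: "f \<bullet> (e \<bullet> w) = e \<bullet> (f \<bullet> w) - h \<bullet> w" for w
    unfolding leibniz[of e f w] h_def by simp
  have "h \<bullet> (e \<bullet> f) = (h \<bullet> e) \<bullet> f + e \<bullet> (h \<bullet> f)" by (rule leibniz)
  then have "0 = 2 *s h + a \<bullet> f + (e \<bullet> b - 2 *s h)"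
    unfolding he hf h_def[symmetric] by (simp add: bracket_linear h_def[symmetric])
  then have cocycle: "e \<bullet> b = f \<bullet> a" using bracket_anticommute[of a f] by (simp add: algebra_simps)
  define t where "t = - 1 / c"
  have tc: "t * c = - 1" using c by (simp add: t_def)
  \<comment> \<open>Up to a scalar, the homotopy applied to the cocycle with values \<open>a\<close>, \<open>b\<close> and \<open>0\<close> at \<open>(h, e)\<close>, \<open>(h, f)\<close> and \<open>(e, f)\<close>.\<close>
  define x y where "x = t *s (h \<bullet> a)" and "y = t *s (h \<bullet> b)"
  have xy: "x \<in> A" "y \<in> A" unfolding x_def y_def using hA ab A_rules(3) by blast+
  define h1 where "h1 = (e + x) \<bullet> (f + y)"
  have h1: "h1 = h + (e \<bullet> y - f \<bullet> x)"
    unfolding h1_def using abelian[OF xy] bracket_anticommute[of x f]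
    by (simp add: bracket_linear h_def)
  have d: "e \<bullet> y - f \<bullet> x \<in> A" using eA fA xy A_rules(2) by blast
  have *: "w \<bullet> (e + x) = - (e \<bullet> w)" "w \<bullet> (f + y) = - (f \<bullet> w)" if "w \<in> A" for w
    using abelian[OF that xy(1)] abelian[OF that xy(2)] bracket_anticommute[of w e] bracket_anticommute[of w f]
    by (simp_all add: bracket_linear)
  have "h1 \<bullet> (e + x) - 2 *s (e + x) = a + h \<bullet> x - e \<bullet> (e \<bullet> y) + e \<bullet> (f \<bullet> x) - 2 *s x"
    unfolding h1 bracket_add_left *[OF d] by (simp add: bracket_linear he scale_two scale_four algebra_simps del: scale_scale)
  also have "e \<bullet> (e \<bullet> y) = t *s (h \<bullet> (e \<bullet> (f \<bullet> a)) - 4 *s (e \<bullet> (f \<bullet> a)))"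
    unfolding y_def by (simp add: bracket_linear eh[OF ab(2)] eh[OF fA[OF ab(1)]] cocycle scale_two scale_four algebra_simps del: scale_scale)
  also have "e \<bullet> (f \<bullet> x) = t *s (h \<bullet> (e \<bullet> (f \<bullet> a)))"
    unfolding x_def by (simp add: bracket_linear fh[OF ab(1)] eh[OF fA[OF ab(1)]] scale_two scale_four algebra_simps del: scale_scale)
  also have "a + h \<bullet> x - t *s (h \<bullet> (e \<bullet> (f \<bullet> a)) - 4 *s (e \<bullet> (f \<bullet> a))) + t *s (h \<bullet> (e \<bullet> (f \<bullet> a))) - 2 *s x
      = a + t *s (h \<bullet> (h \<bullet> a) - 2 *s (h \<bullet> a) + 4 *s (e \<bullet> (f \<bullet> a)))"
    unfolding x_def by (simp add: bracket_linear scale_two scale_four algebra_simps del: scale_scale)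
  also have "\<dots> = 0"
    unfolding casimir[OF ab(1), folded h_def] by (simp add: tc)
  finally have e1: "h1 \<bullet> (e + x) - 2 *s (e + x) = 0" .
  have "h1 \<bullet> (f + y) + 2 *s (f + y) = b + h \<bullet> y - f \<bullet> (e \<bullet> y) + f \<bullet> (f \<bullet> x) + 2 *s y"
    unfolding h1 bracket_add_left *[OF d] by (simp add: bracket_linear hf scale_two scale_four algebra_simps del: scale_scale)
  also have "f \<bullet> (e \<bullet> y) = t *s (h \<bullet> (f \<bullet> (e \<bullet> b)))"
    unfolding y_def by (simp add: bracket_linear eh[OF ab(2)] fh[OF eA[OF ab(2)]] scale_two scale_four algebra_simps del: scale_scale)
  also have "f \<bullet> (f \<bullet> x) = t *s (h \<bullet> (f \<bullet> (e \<bullet> b)) + 4 *s (f \<bullet> (e \<bullet> b)))"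
    unfolding x_def cocycle by (simp add: bracket_linear fh[OF ab(1)] fh[OF fA[OF ab(1)]] scale_two scale_four algebra_simps del: scale_scale)
  also have "b + h \<bullet> y - t *s (h \<bullet> (f \<bullet> (e \<bullet> b))) + t *s (h \<bullet> (f \<bullet> (e \<bullet> b)) + 4 *s (f \<bullet> (e \<bullet> b))) + 2 *s y
      = b + t *s (h \<bullet> (h \<bullet> b) - 2 *s (h \<bullet> b) + 4 *s (e \<bullet> (f \<bullet> b)))"
    unfolding y_def ef_fe by (simp add: bracket_linear scale_two scale_four algebra_simps del: scale_scale)
  also have "\<dots> = 0"
    unfolding casimir[OF ab(2), folded h_def] by (simp add: tc)
  finally have f1: "h1 \<bullet> (f + y) + 2 *s (f + y) = 0" .
  have "A \<subseteq> {0}"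
    using e1 f1 by (intro lifts_modulo[OF _ _ lifts_cong[OF ef xy]])
      (auto simp: P_ideal_def h1_def A_rules P_rules R_rules)
  then show False using no_complement A_rules(5) by blast
qed

text \<open>
  Here \<open>3 (l - 2) = 0\<close>, and the Casimir element acts as \<open>l (l + 2)\<close>. For \<open>l = 0\<close> the last two vectors of
  the string span a submodule, and for \<open>l = -2\<close> the characteristic is three and the last vector does; so
  the scalar is nonzero.
\<close>

lemma no_three_dimensional_top:
  assumes ef: "lifts e f" and v: "v \<in> A" "e \<bullet> v \<in> Z" "(e \<bullet> f) \<bullet> v - l *s v \<in> Z"
    and ffv: "f \<bullet> (f \<bullet> v) \<notin> Z" "f \<bullet> (f \<bullet> (f \<bullet> v)) \<in> Z"
  shows False
proof -
  note r = lifts_relations[OF ef]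
  define h v1 v2 where "h = e \<bullet> f" and "v1 = f \<bullet> v" and "v2 = f \<bullet> (f \<bullet> v)"
  have A: "v1 \<in> A" "v2 \<in> A" unfolding v1_def v2_def using A_bracket(1)[OF r(2)] v(1) by auto
  have f: "f \<bullet> v = v1" "f \<bullet> v1 = v2" by (simp_all add: v1_def v2_def)
  note chain = chain_dim[OF r(2) A(2) _ _ A(1) f(2) v(1) f(1)]
  have Z0: "Z = {0}" and span: "A = span {v2, v1, v}"
    and indep: "a *s v2 + b *s v1 + c *s v = 0 \<Longrightarrow> a = 0 \<and> b = 0 \<and> c = 0" for a b c
    using chain(1-3) ffv by (simp_all add: v2_def)
  have rel: "f \<bullet> v2 = 0" "e \<bullet> v = 0" "h \<bullet> v = l *s v" "h \<bullet> v1 = (l - 2) *s v1"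
    "e \<bullet> v1 = l *s v" "e \<bullet> v2 = (2 * (l - 1)) *s v1" "h \<bullet> v2 = (l - 4) *s v2"
    "0 = (3 * (l - 2)) *s v2"
    using weight_string[OF ef v] v(2,3) ffv(2) unfolding Z0 h_def v1_def v2_def by simp_all
  have nonzero: "v2 \<noteq> 0" using ffv Z0 by (simp add: v2_def)
  then have l: "3 * (l - 2) = 0" using rel(8) by simp
  have "l \<noteq> 0"
  proof
    assume "l = 0"
    have "e \<bullet> v2 \<in> span {0, v1, v2}" unfolding rel(6) by (intro span_scale span_base) simp
    moreover have "e \<bullet> v1 \<in> span {0, v1, v2}" using rel(5) \<open>l = 0\<close> by (simp add: span_zero)
    moreover have "f \<bullet> v1 \<in> span {0, v1, v2}" unfolding f(2) by (intro span_base) simp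
    moreover have "f \<bullet> v2 \<in> span {0, v1, v2}" unfolding rel(1) by (rule span_zero)
    ultimately have "A = span {0, v1, v2}"
      using A nonzero A_rules(5) by (intro generates[OF ef, of _ v2]) (auto simp: Z0)
    then have "v \<in> span {0, v1, v2}" using v(1) by simp
    then obtain k m where "v - k *s v1 - m *s v2 = 0" by (auto simp: span_breakdown_eq)
    then have "(- m) *s v2 + (- k) *s v1 + 1 *s v = 0" by (simp add: algebra_simps)
    from indep[OF this] show False by simp
  qed
  moreover have "l + 2 \<noteq> 0"
  proof
    assume l2: "l + 2 = 0"
    then have "l = - 2" by (simp add: eq_neg_iff_add_eq_0)
    then have "4 * (3::'k) = 0" using l by simp
    then have "(3::'k) = 0" using four_neq_zero mult_eq_0_iff by blast
    then have "2 * (l - 1) = 0" using \<open>l = - 2\<close> by simp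
    then have "A = span (insert v2 Z)"
      using A nonzero rel A_rules(5)
      by (intro generates[OF ef, of _ v2]) (auto simp: Z0 span_zero)
    then show False using not_one_dimensional A(2) by blast
  qed
  moreover have "l * (l + 2) = 0"
  proof (rule casimir_splitting[OF ef])
    show "x \<bullet> y = 0" if "x \<in> A" "y \<in> A" for x y
      using A_abelian_modulo[OF that] Z0 by simp
    define C where "C = (\<lambda>x. h \<bullet> (h \<bullet> x) - 2 *s (h \<bullet> x) + 4 *s (e \<bullet> (f \<bullet> x)))"
    have scalar: "l * (l + 2) = l * l - 2 * l + 4 * l"
      "l * (l + 2) = (l - 2) * (l - 2) - 2 * (l - 2) + 4 * (2 * (l - 1))"
      "l * (l + 2) = (l - 4) * (l - 4) - 2 * (l - 4)"
      using l by algebra+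
    have "C v = (l * (l + 2)) *s v"
      unfolding C_def scalar(1) by (simp only: rel(1-7) f bracket_linear scale_scale
        flip: scale_left_distrib scale_left_diff_distrib)
    moreover have "C v1 = (l * (l + 2)) *s v1"
      unfolding C_def scalar(2) by (simp only: rel(1-7) f bracket_linear scale_scale
        flip: scale_left_distrib scale_left_diff_distrib)
    moreover have "C v2 = (l * (l + 2)) *s v2"
      unfolding C_def scalar(3) by (simp only: rel(1-7) f bracket_linear scale_scale bracket_zero_right scale_zero_right
        add_0_right flip: scale_left_distrib scale_left_diff_distrib)
    moreover have "subspace {x. C x = (l * (l + 2)) *s x}"
    proof -
      have "C (x + y) = C x + C y" for x y by (simp add: C_def bracket_linear algebra_simps)
      moreover have "C (c *s x) = c *s C x" for c x by (simp add: C_def bracket_linear algebra_simps)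
      moreover have "C 0 = 0" by (simp add: C_def)
      ultimately show ?thesis by (simp add: subspace_def scale_right_distrib mult.commute)
    qed
    ultimately have "span {v2, v1, v} \<subseteq> {x. C x = (l * (l + 2)) *s x}"
      by (intro span_minimal) auto
    then show "(e \<bullet> f) \<bullet> ((e \<bullet> f) \<bullet> x) - 2 *s ((e \<bullet> f) \<bullet> x) + 4 *s (e \<bullet> (f \<bullet> x)) = (l * (l + 2)) *s x"
      if "x \<in> A" for x using that unfolding span C_def h_def[symmetric] by blast
  qed
  ultimately show False by simp
qed

text \<open>
  A string of length one contradicts irreducibility, and one of length three or more is excluded already.
  For length two the recursion gives the weight one.
\<close>

lemma two_dimensional_top:
  obtains e f v where "lifts e f" "v \<in> A" "v \<notin> Z" "e \<bullet> v \<in> Z" "(e \<bullet> f) \<bullet> v - v \<in> Z"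
    "f \<bullet> v \<notin> Z" "f \<bullet> (f \<bullet> v) \<in> Z" "A = span (insert (f \<bullet> v) (insert v Z))" "e \<bullet> (f \<bullet> v) - v \<in> Z"
    "(e \<bullet> f) \<bullet> (f \<bullet> v) + f \<bullet> v \<in> Z"
proof -
  obtain e f where ef: "lifts e f" using lifts_exist by blast
  note r = lifts_relations[OF ef]
  obtain v l where v: "v \<in> A" "v \<notin> Z" "e \<bullet> v \<in> Z" "(e \<bullet> f) \<bullet> v - l *s v \<in> Z"
    using highest_weight_vector[OF ef] by blast
  note w = weight_string[OF ef v(1,3,4)]
  have fA: "f \<bullet> y \<in> A" if "y \<in> A" for y using A_bracket(1)[OF r(2) that] .
  have fv: "f \<bullet> v \<notin> Z"
  proof
    assume "f \<bullet> v \<in> Z"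
    then have "A = span (insert v Z)"
      using v Z_subset by (intro generates[OF ef, of _ v]) (auto intro: span_base)
    then show False using not_one_dimensional v(1) by blast
  qed
  have ffv: "f \<bullet> (f \<bullet> v) \<in> Z"
  proof (rule ccontr)
    assume ffv: "f \<bullet> (f \<bullet> v) \<notin> Z"
    show False
    proof (cases "f \<bullet> (f \<bullet> (f \<bullet> v)) \<in> Z")
      case True
      then show False using no_three_dimensional_top[OF ef v(1,3,4) ffv] by blast
    next
      case False
      let ?g = "(\<bullet>) f"
      define m where "m = (LEAST m. (?g ^^ m) v \<in> Z)"
      have "\<exists>m. (?g ^^ m) v \<in> Z" using ad_power_zero[OF lifts_swap[OF ef]] v(1) Z_rules(5) by metis
      then have m: "(?g ^^ m) v \<in> Z" unfolding m_def by (rule LeastI_ex)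
      have less: "(?g ^^ k) v \<notin> Z" if "k < m" for k
        using not_less_Least[OF that[unfolded m_def]] .
      have gA: "(?g ^^ k) v \<in> A" for k using v(1) fA by (induction k) auto
      have "m \<noteq> 0" "m \<noteq> 1" "m \<noteq> 2" "m \<noteq> 3"
        using m v(2) fv ffv False by (intro notI; simp add: numeral_2_eq_2 numeral_3_eq_3)+
      then have "4 \<le> m" by simp
      then obtain k where k: "m = 4 + k" using le_Suc_ex by blast
      have mk: "m = Suc (Suc (Suc (Suc k)))" using k by simp
      show False
        using chain_dim(4)[OF r(2) gA[of "Suc (Suc (Suc k))"] _ _ gA[of "Suc (Suc k)"] _ gA[of "Suc k"] _ gA[of k]]
          less[of "Suc (Suc (Suc k))"] m unfolding mk by simp
    qed
  qed
  have "(2 * (l - 1)) *s (f \<bullet> v) \<in> Z"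
    using Z_rules(2)[OF Z_left[OF r(1) ffv] w(3)] by simp
  then have "2 * (l - 1) = 0" using Z_scale_cancel fv by blast
  then have l: "l = 1" using two_neq_zero by simp
  have "A = span (insert (f \<bullet> v) (insert v Z))"
  proof (rule generates[OF ef, of _ v])
    fix s assume "s \<in> insert (f \<bullet> v) (insert v Z) - Z"
    then consider "s = v" | "s = f \<bullet> v" by blast
    then show "e \<bullet> s \<in> span (insert (f \<bullet> v) (insert v Z))"
    proof cases
      case 1
      then show ?thesis using v(3) by (simp add: span_base)
    next
      case 2
      have "e \<bullet> (f \<bullet> v) - v \<in> span (insert (f \<bullet> v) (insert v Z))"
        using w(2) l by (simp add: span_base)
      from span_add[OF this, of v] show ?thesis using 2 by (simp add: span_base)
    qed
    show "f \<bullet> s \<in> span (insert (f \<bullet> v) (insert v Z))"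
      using \<open>s \<in> insert (f \<bullet> v) (insert v Z) - Z\<close> ffv by (auto intro: span_base)
  qed (use v fA Z_subset in auto)
  moreover have "(l - 2) *s (f \<bullet> v) = - (f \<bullet> v)" by (simp add: l)
  ultimately show thesis using that[OF ef v(1,2,3) _ fv ffv] v(4) w(1,2) by (simp add: l)
qed

end

section \<open>Normal form of the lifts\<close>

context irreducible_top
begin

text \<open>
  Lifts \<open>e\<close>, \<open>f\<close> that act on weight vectors \<open>v0\<close>, \<open>v1\<close> as in the natural module, up to the values
  \<open>[e, v0]\<close> and \<open>[f, v1]\<close> in \<open>Z\<close>. The scalars \<open>a\<close> and \<open>b\<close> are the coordinates of the extension class.
\<close>

definition natural_lifts :: "'l \<Rightarrow> 'l \<Rightarrow> 'l \<Rightarrow> 'l \<Rightarrow> 'k \<Rightarrow> 'k \<Rightarrow> bool" where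
  "natural_lifts e f v0 v1 a b \<longleftrightarrow> lifts e f \<and> v0 \<in> A \<and> v1 \<in> A \<and> v0 \<notin> Z \<and> v1 \<notin> Z \<and>
    A = span (insert v0 (insert v1 Z)) \<and> e \<bullet> v0 \<in> Z \<and> f \<bullet> v1 \<in> Z \<and>
    (e \<bullet> f) \<bullet> v0 = v0 \<and> (e \<bullet> f) \<bullet> v1 = - v1 \<and> e \<bullet> v1 = v0 \<and> f \<bullet> v0 = v1 \<and>
    (e \<bullet> f) \<bullet> e = 2 *s e + a *s v1 \<and> (e \<bullet> f) \<bullet> f = b *s v0 - 2 *s f"

text \<open>
  The operator \<open>ad h - 2\<close> has the eigenvalues \<open>-1\<close>, \<open>-3\<close> and \<open>-2\<close> at \<open>v0\<close>, \<open>v1\<close> and \<open>Z\<close>, and \<open>ad h + 2\<close> has the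
  eigenvalues \<open>3\<close>, \<open>1\<close> and \<open>2\<close>. All parts of the defects that belong to the eigenvalues other than
  \<open>3\<close> and \<open>-3\<close> are therefore removed by changing the lifts within \<open>A\<close>; comparing weights shows that the
  new bracket \<open>[e, f]\<close> differs from the old one by an element of \<open>Z\<close> and hence acts in the same way.
\<close>

lemma natural_lifts_exist: "\<exists>e f v0 v1 a b. natural_lifts e f v0 v1 a b"
proof -
  obtain e f v where ef: "lifts e f" and v: "v \<in> A" "v \<notin> Z" "e \<bullet> v \<in> Z" "(e \<bullet> f) \<bullet> v - v \<in> Z"
    and w: "f \<bullet> v \<notin> Z" "f \<bullet> (f \<bullet> v) \<in> Z" "A = span (insert (f \<bullet> v) (insert v Z))"
      "e \<bullet> (f \<bullet> v) - v \<in> Z" "(e \<bullet> f) \<bullet> (f \<bullet> v) + f \<bullet> v \<in> Z"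
    by (rule two_dimensional_top)
  note r = lifts_relations[OF ef]
  define h where "h = e \<bullet> f"
  define z where "z = h \<bullet> v - v"
  define z' where "z' = h \<bullet> (f \<bullet> v) + f \<bullet> v"
  \<comment> \<open>As \<open>h\<close> kills \<open>Z\<close>, these corrections give exact eigenvectors.\<close>
  define v0 v1 where "v0 = v + z" and "v1 = f \<bullet> v - z'"
  have hP: "h \<in> P" using r by (simp add: h_def)
  have z: "z \<in> Z" "z' \<in> Z" using v(4) w(5) by (simp_all add: z_def z'_def h_def)
  note hz = Z_central(1)[OF z(1)] Z_central(1)[OF z(2)]
  have "h \<bullet> (h \<bullet> (f \<bullet> v)) = - (h \<bullet> (f \<bullet> v))"
    using hz(2)[OF hP] by (simp add: z'_def bracket_linear eq_neg_iff_add_eq_0)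
  then have hv: "h \<bullet> v0 = v0" "h \<bullet> v1 = - v1"
    using hz(1)[OF hP] unfolding v0_def v1_def by (simp_all add: bracket_linear z_def z'_def)
  have fA: "f \<bullet> v \<in> A" using A_bracket(1)[OF r(2) v(1)] .
  have vA: "v0 \<in> A" "v1 \<in> A"
    unfolding v0_def v1_def using A_rules(1)[OF v(1)] A_rules(2)[OF fA] z Z_subset by auto
  have vZ: "v0 \<notin> Z" "v1 \<notin> Z"
    using Z_rules(2)[OF _ z(1), of v0] Z_rules(1)[OF _ z(2), of v1] v(2) w(1)
    by (auto simp: v0_def v1_def)
  have ev: "e \<bullet> v0 \<in> Z" "f \<bullet> v1 \<in> Z" "e \<bullet> v1 - v0 \<in> Z" "f \<bullet> v0 - v1 \<in> Z"
    using v(3) w(2) hz[OF r(1)] hz[OF r(2)] Z_rules(2)[OF w(4) z(1)] z(2)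
    unfolding v0_def v1_def by (simp_all add: bracket_linear algebra_simps)
  have span: "A = span (insert v0 (insert v1 Z))"
  proof -
    have "v \<in> span (insert v0 (insert v1 Z))"
      using span_diff[of v0 "insert v0 (insert v1 Z)" z] z by (simp add: v0_def span_base)
    moreover have "f \<bullet> v \<in> span (insert v0 (insert v1 Z))"
      using span_add[of v1 "insert v0 (insert v1 Z)" z'] z by (simp add: v1_def span_base)
    ultimately have "A \<subseteq> span (insert v0 (insert v1 Z))"
      unfolding w(3) by (intro span_minimal) (auto intro: span_base)
    moreover have "span (insert v0 (insert v1 Z)) \<subseteq> A"
      using vA Z_subset by (intro span_minimal A_sub) auto
    ultimately show ?thesis by blast
  qed
  have coord: "\<exists>c d. \<exists>y\<in>Z. x = c *s v0 + d *s v1 + y" if "x \<in> A" for x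
  proof -
    have "x \<in> span (insert v0 (insert v1 Z))" using that span by simp
    then obtain c d where "x - c *s v0 - d *s v1 \<in> Z" by (auto simp: span_breakdown_eq)
    then show ?thesis by (intro exI[of _ c] exI[of _ d] bexI[of _ "x - c *s v0 - d *s v1"]) auto
  qed
  obtain a0 a y where a: "h \<bullet> e - 2 *s e = a0 *s v0 + a *s v1 + y" "y \<in> Z"
    using coord r(4) h_def by metis
  obtain b b1 y' where b: "h \<bullet> f + 2 *s f = b *s v0 + b1 *s v1 + y'" "y' \<in> Z"
    using coord r(5) h_def by metis
  define x where "x = a0 *s v0 + (1/2) *s y"
  define x' where "x' = - (b1 *s v1 + (1/2) *s y')"
  have half_y: "(1/2) *s y \<in> Z" "(1/2) *s y' \<in> Z" using a(2) b(2) Z_rules(3) by auto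
  then have half_yA: "(1/2) *s y \<in> A" "(1/2) *s y' \<in> A" using Z_subset by blast+
  have xA: "x \<in> A" "x' \<in> A"
    unfolding x_def x'_def by (intro A_rules(1,3,4) vA half_yA)+
  define e1 f1 h1 where "e1 = e + x" and "f1 = f + x'" and "h1 = e1 \<bullet> f1"
  have ef1: "lifts e1 f1" unfolding e1_def f1_def using lifts_cong[OF ef xA] .
  note r1 = lifts_relations[OF ef1, folded h1_def]
  have two_half: "2 *s (1/2) *s w = w" for w using two_neq_zero by simp
  have he1: "h \<bullet> e1 = 2 *s e1 + a *s v1"
  proof -
    have 1: "h \<bullet> x = a0 *s v0" unfolding x_def using Z_central(1)[OF half_y(1) hP] hv by (simp add: bracket_linear)
    have 2: "2 *s x = a0 *s v0 + a0 *s v0 + y" unfolding x_def scale_right_distrib two_half by (simp add: scale_two del: scale_scale)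
    have 3: "h \<bullet> e = 2 *s e + (a0 *s v0 + a *s v1 + y)" using a(1) by (simp add: algebra_simps)
    show ?thesis unfolding e1_def bracket_add_right 1 3 scale_right_distrib 2 by simp
  qed
  have hf1: "h \<bullet> f1 = b *s v0 - 2 *s f1"
  proof -
    have 1: "h \<bullet> x' = b1 *s v1" unfolding x'_def using Z_central(1)[OF half_y(2) hP] hv by (simp add: bracket_linear)
    have 2: "2 *s x' = - (b1 *s v1 + b1 *s v1 + y')"
      unfolding x'_def scale_right_distrib scale_minus_right two_half by (simp add: scale_two del: scale_scale)
    have 3: "h \<bullet> f = (b *s v0 + b1 *s v1 + y') - 2 *s f" using b(1) by (simp add: algebra_simps)
    show ?thesis unfolding f1_def bracket_add_right 1 3 scale_right_distrib 2 by simp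
  qed
  have AZ: "u \<bullet> w \<in> Z" if "u \<in> A" "w \<in> A" for u w using A_abelian_modulo[OF that] .
  have ev1: "e1 \<bullet> v0 \<in> Z" "f1 \<bullet> v1 \<in> Z" "e1 \<bullet> v1 - v0 \<in> Z" "f1 \<bullet> v0 - v1 \<in> Z"
    using Z_rules(1)[OF ev(1) AZ[OF xA(1) vA(1)]] Z_rules(1)[OF ev(2) AZ[OF xA(2) vA(2)]]
      Z_rules(1)[OF ev(3) AZ[OF xA(1) vA(2)]] Z_rules(1)[OF ev(4) AZ[OF xA(2) vA(1)]]
    unfolding e1_def f1_def by (simp_all add: bracket_linear algebra_simps)
  define m where "m = h1 - h"
  have mZ: "m \<in> Z"
  proof -
    have "m = e \<bullet> x' + x \<bullet> f1"
      unfolding m_def h1_def h_def e1_def f1_def by (simp add: bracket_linear)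
    then have "m \<in> A" using A_bracket(1)[OF r(1) xA(2)] A_bracket(2)[OF r1(2) xA(1)] A_rules(1) by simp
    then obtain c d y where m: "m = c *s v0 + d *s v1 + y" "y \<in> Z" using coord by blast
    have "h \<bullet> m = h \<bullet> (e1 \<bullet> f1)" unfolding m_def h1_def by (simp add: bracket_linear)
    also have "\<dots> = b *s (e1 \<bullet> v0) - a *s (f1 \<bullet> v1)"
      unfolding leibniz[of h e1 f1] he1 hf1 using bracket_anticommute[of v1 f1] by (simp add: bracket_linear)
    finally have "h \<bullet> m \<in> Z" using ev1 Z_rules by simp
    then have 1: "c *s v0 - d *s v1 \<in> Z"
      unfolding m(1) using Z_central(1)[OF m(2) hP] hv by (simp add: bracket_linear)
    have "h \<bullet> (c *s v0 - d *s v1) = 0" using Z_central(1)[OF 1 hP] .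
    then have "c *s v0 + d *s v1 = 0" using hv by (simp add: bracket_linear)
    then show ?thesis using m by simp
  qed
  have act: "h1 \<bullet> w = h \<bullet> w" if "w \<in> P" for w
    using Z_central(2)[OF mZ that] by (simp add: m_def bracket_linear)
  have vP: "v0 \<in> P" "v1 \<in> P" using vA by auto
  have "e1 \<bullet> v1 = v0"
  proof -
    have "h \<bullet> (e1 \<bullet> v1) = e1 \<bullet> v1"
      unfolding leibniz[of h e1 v1] he1 hv by (simp add: bracket_linear scale_two)
    then show ?thesis using Z_central(1)[OF ev1(3) hP] hv by (simp add: bracket_linear)
  qed
  moreover have "f1 \<bullet> v0 = v1"
  proof -
    have "h \<bullet> (f1 \<bullet> v0) = - (f1 \<bullet> v0)"
      unfolding leibniz[of h f1 v0] hf1 hv by (simp add: bracket_linear scale_two)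
    then show ?thesis using Z_central(1)[OF ev1(4) hP] hv by (simp add: bracket_linear)
  qed
  ultimately have "natural_lifts e1 f1 v0 v1 a b"
    unfolding natural_lifts_def h1_def[symmetric] act[OF vP(1)] act[OF vP(2)] act[OF r1(1)] act[OF r1(2)]
    using ef1 vA vZ span ev1 hv he1 hf1 by blast
  then show ?thesis by blast
qed

text \<open>
  If \<open>3\<close> is invertible, then the remaining defects are removed in the same way, and the relations of \<open>sl\<^sub>2\<close>
  hold modulo \<open>Z\<close>.
\<close>

lemma characteristic_three: "(3::'k) = 0"
proof (rule ccontr)
  assume three: "(3::'k) \<noteq> 0"
  obtain e f v0 v1 a b where n: "natural_lifts e f v0 v1 a b" using natural_lifts_exist by blast
  then have ef: "lifts e f" and vA: "v0 \<in> A" "v1 \<in> A" and vZ: "v0 \<notin> Z"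
    and ev: "e \<bullet> v0 \<in> Z" "f \<bullet> v1 \<in> Z" and hv: "(e \<bullet> f) \<bullet> v0 = v0" "(e \<bullet> f) \<bullet> v1 = - v1"
    and he: "(e \<bullet> f) \<bullet> e = 2 *s e + a *s v1" and hf: "(e \<bullet> f) \<bullet> f = b *s v0 - 2 *s f"
    unfolding natural_lifts_def by blast+
  define x y where "x = (a / 3) *s v1" and "y = (- b / 3) *s v0"
  have xy: "x \<in> A" "y \<in> A" unfolding x_def y_def using vA A_rules(3) by blast+
  note ef1 = lifts_cong[OF ef xy]
  note r = lifts_relations[OF ef] and r1 = lifts_relations[OF ef1]
  define m where "m = (e + x) \<bullet> (f + y) - e \<bullet> f"
  have "m = e \<bullet> y - f \<bullet> x + x \<bullet> y"
    unfolding m_def using bracket_anticommute[of x f] by (simp add: bracket_linear)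
  moreover have "e \<bullet> y \<in> Z" "f \<bullet> x \<in> Z"
    unfolding x_def y_def bracket_scale_right using ev Z_rules(3) by blast+
  ultimately have "m \<in> Z" using A_abelian_modulo[OF xy] Z_rules(1,2) by simp
  then have act: "((e + x) \<bullet> (f + y)) \<bullet> w = (e \<bullet> f) \<bullet> w" if "w \<in> P" for w
  proof -
    have "(e + x) \<bullet> (f + y) = e \<bullet> f + m" by (simp add: m_def)
    then show ?thesis using Z_central(2)[OF \<open>m \<in> Z\<close> that] by (simp only: bracket_add_left add_0_right)
  qed
  have "3 *s x = a *s v1" "b *s v0 = - (3 *s y)" unfolding x_def y_def using three by simp_all
  then have x3: "a *s v1 = x + x + x" and y3: "b *s v0 = - (y + y + y)"
    using scale_left_distrib[of 2 1 x] scale_left_distrib[of 2 1 y] by (simp_all add: scale_two)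
  have "(e \<bullet> f) \<bullet> x = - x" "(e \<bullet> f) \<bullet> y = y" unfolding x_def y_def by (simp_all add: bracket_linear hv)
  then have "((e + x) \<bullet> (f + y)) \<bullet> (e + x) - 2 *s (e + x) = 0"
    "((e + x) \<bullet> (f + y)) \<bullet> (f + y) + 2 *s (f + y) = 0"
    unfolding act[OF r1(1)] act[OF r1(2)]
    by (simp_all add: bracket_linear he hf x3 y3 scale_two)
  then have "A \<subseteq> Z"
    using Z_rules(5) by (intro lifts_modulo[OF Z_ideal Z_subset ef1]) simp_all
  then show False using vA vZ by blast
qed

lemma scale_two_char3: "2 *s x = - x"
proof -
  have "2 *s x + x = (2 + 1) *s x" by (simp only: scale_left_distrib scale_one)
  then show ?thesis using characteristic_three by (simp add: eq_neg_iff_add_eq_0)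
qed

lemma double_char3: "x + x = - x" for x :: 'l
  using scale_two_char3[of x] by (simp add: scale_two)

lemma double_char3': "x + (x + y) = - x + y" for x y :: 'l
  using double_char3[of x] by (simp flip: add.assoc)

text \<open>
  The Jacobi identity for \<open>h, e, v0\<close> and for \<open>h, f, v1\<close> shows that \<open>[v0, v1]\<close> is killed by \<open>a\<close> and \<open>b\<close>, and the one
  for \<open>h, e, f\<close> is the second equation. Both scalars cannot vanish, for then the lifts would span a
  complement.
\<close>

lemma natural_lifts_relations:
  assumes "natural_lifts e f v0 v1 a b"
  shows "v0 \<bullet> v1 = 0" "a *s (f \<bullet> v1) = b *s (e \<bullet> v0)" "a \<noteq> 0 \<or> b \<noteq> 0"
proof -
  have ef: "lifts e f" and vA: "v0 \<in> A" "v1 \<in> A" and vZ: "v0 \<notin> Z"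
    and ev: "e \<bullet> v0 \<in> Z" "f \<bullet> v1 \<in> Z" and hv: "(e \<bullet> f) \<bullet> v0 = v0" "(e \<bullet> f) \<bullet> v1 = - v1"
    and he: "(e \<bullet> f) \<bullet> e = 2 *s e + a *s v1" and hf: "(e \<bullet> f) \<bullet> f = b *s v0 - 2 *s f"
    using assms unfolding natural_lifts_def by blast+
  note r = lifts_relations[OF ef]
  define h where "h = e \<bullet> f"
  note rel = hv[folded h_def] he[folded h_def] hf[folded h_def]
  have hP: "h \<in> P" using r h_def by simp
  show nz: "a \<noteq> 0 \<or> b \<noteq> 0"
  proof (rule ccontr)
    assume "\<not> ?thesis"
    then have "A \<subseteq> {0}"
      using he hf by (intro lifts_modulo[OF _ _ ef]) (auto simp: P_ideal_def A_rules P_rules R_rules)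
    then show False using no_complement A_rules(5) by blast
  qed
  have "0 = h \<bullet> (e \<bullet> v0)" using Z_central(1)[OF ev(1) hP] by simp
  also have "\<dots> = a *s (v1 \<bullet> v0)"
    unfolding leibniz[of h e v0] rel by (simp add: bracket_linear scale_two_char3)
  finally have 1: "a *s (v0 \<bullet> v1) = 0" using bracket_anticommute[of v1 v0] by simp
  have "0 = h \<bullet> (f \<bullet> v1)" using Z_central(1)[OF ev(2) hP] by simp
  also have "\<dots> = b *s (v0 \<bullet> v1)"
    unfolding leibniz[of h f v1] rel by (simp add: bracket_linear scale_two_char3)
  finally have 2: "b *s (v0 \<bullet> v1) = 0" by simp
  show "v0 \<bullet> v1 = 0" using 1 2 nz by auto
  have "h \<bullet> (e \<bullet> f) = 0" using bracket_self by (simp add: h_def)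
  then have "0 = (2 *s e + a *s v1) \<bullet> f + e \<bullet> (b *s v0 - 2 *s f)"
    unfolding leibniz[of h e f] rel by simp
  then show "a *s (f \<bullet> v1) = b *s (e \<bullet> v0)"
    using bracket_anticommute[of v1 f] by (simp add: bracket_linear algebra_simps)
qed

end

text \<open>
  In characteristic three cubing is additive, hence injective.
\<close>

lemma cube_root_exists:
  assumes "(3::'k::{field,finite}) = 0" shows "\<exists>s::'k. s * s * s = x"
proof -
  have "inj (\<lambda>s::'k. s * s * s)"
  proof (rule injI)
    fix s t :: 'k assume "s * s * s = t * t * t"
    then have "(s - t) * (s - t) * (s - t) = - 3 * s * s * t + 3 * s * t * t" by algebra
    then show "s = t" using assms by simp
  qed
  then have "surj (\<lambda>s::'k. s * s * s)" by (rule finite_UNIV_inj_surj[OF finite])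
  then obtain s where "x = s * s * s" by (rule surjE)
  then show ?thesis by (intro exI[of _ s]) simp
qed

context irreducible_top
begin

lemma natural_liftsI:
  assumes "e \<in> P" "f \<in> P" "e \<notin> R" "v0 \<in> A" "v1 \<in> A" "v0 \<notin> Z" "v1 \<notin> Z" "A \<subseteq> span (insert v0 (insert v1 Z))"
    and "e \<bullet> v0 \<in> Z" "f \<bullet> v1 \<in> Z" "(e \<bullet> f) \<bullet> v0 = v0" "(e \<bullet> f) \<bullet> v1 = - v1" "e \<bullet> v1 = v0" "f \<bullet> v0 = v1"
    and e: "(e \<bullet> f) \<bullet> e = - e + a *s v1" and f: "(e \<bullet> f) \<bullet> f = f + b *s v0"
  shows "natural_lifts e f v0 v1 a b"
proof -
  have e2: "(e \<bullet> f) \<bullet> e = 2 *s e + a *s v1" and f2: "(e \<bullet> f) \<bullet> f = b *s v0 - 2 *s f"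
    unfolding e f by (simp_all add: scale_two_char3)
  have "lifts e f"
    unfolding lifts_def sl2_modulo_def e2 f2 using assms R_rules by simp
  moreover have "span (insert v0 (insert v1 Z)) \<subseteq> A"
    using assms Z_subset by (intro span_minimal A_sub) auto
  ultimately show ?thesis unfolding natural_lifts_def e2 f2 using assms by blast
qed

text \<open>
  The Weyl element of \<open>sl\<^sub>2\<close> interchanges \<open>e\<close> and \<open>f\<close>, and thereby the two coordinates of the class.
\<close>

lemma natural_lifts_swap:
  assumes n: "natural_lifts e f v0 v1 0 b" and b: "b \<noteq> 0"
  shows "natural_lifts f e (- b *s v1) (- b *s v0) 1 0"
proof -
  have ef: "lifts e f" and vA: "v0 \<in> A" "v1 \<in> A" and vZ: "v0 \<notin> Z" "v1 \<notin> Z"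
    and span: "A = span (insert v0 (insert v1 Z))"
    and ev: "e \<bullet> v0 \<in> Z" "f \<bullet> v1 \<in> Z" and hv: "(e \<bullet> f) \<bullet> v0 = v0" "(e \<bullet> f) \<bullet> v1 = - v1"
    "e \<bullet> v1 = v0" "f \<bullet> v0 = v1"
    and he: "(e \<bullet> f) \<bullet> e = 2 *s e + 0 *s v1" and hf: "(e \<bullet> f) \<bullet> f = b *s v0 - 2 *s f"
    using n unfolding natural_lifts_def by blast+
  note fe = bracket_anticommute[of f e]
  have scaled: "x \<in> span S" if "- b *s x \<in> span S" for x S
    using span_scale[OF that, of "- (1 / b)"] b by simp
  show ?thesis
  proof (rule natural_liftsI)
    show "A \<subseteq> span (insert (- b *s v1) (insert (- b *s v0) Z))"
      unfolding span
    proof (rule span_minimal[OF _ subspace_span])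
      have "v0 \<in> span (insert (- b *s v1) (insert (- b *s v0) Z))" by (rule scaled) (simp add: span_base)
      moreover have "v1 \<in> span (insert (- b *s v1) (insert (- b *s v0) Z))" by (rule scaled) (simp add: span_base)
      ultimately show "insert v0 (insert v1 Z) \<subseteq> span (insert (- b *s v1) (insert (- b *s v0) Z))"
        by (auto intro: span_base)
    qed
    show "f \<in> P" "e \<in> P" "f \<notin> R" using lifts_swap[OF ef] by (auto simp: lifts_def sl2_modulo_def)
    show "- b *s v1 \<in> A" "- b *s v0 \<in> A" using vA A_rules(3) by blast+
    show "- b *s v1 \<notin> Z" "- b *s v0 \<notin> Z" using vZ Z_scale_cancel b by (metis neg_equal_0_iff_equal)+
    show "f \<bullet> (- b *s v1) \<in> Z" "e \<bullet> (- b *s v0) \<in> Z"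
      unfolding bracket_scale_right using ev Z_rules(3) by blast+
  qed (simp_all add: fe bracket_linear hv he hf scale_two_char3)
qed

text \<open>
  The automorphisms \<open>exp (s ad e)\<close> of the quotient act on the extension class through the cubes
  \<open>s\<^sup>3\<close>, so that a cube root of \<open>b/a\<close> removes the second coordinate.
\<close>

lemma natural_lifts_rotate:
  assumes n: "natural_lifts e f v0 v1 a b" and s: "a * (s * s * s) = b"
  shows "\<exists>f' v0' v1'. natural_lifts e f' v0' v1' a 0"
proof -
  have ef: "lifts e f" and vA: "v0 \<in> A" "v1 \<in> A" and vZ: "v0 \<notin> Z" "v1 \<notin> Z"
    and span: "A = span (insert v0 (insert v1 Z))"
    and ev: "e \<bullet> v0 \<in> Z" "f \<bullet> v1 \<in> Z" and hv: "(e \<bullet> f) \<bullet> v0 = v0" "(e \<bullet> f) \<bullet> v1 = - v1"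
    "e \<bullet> v1 = v0" "f \<bullet> v0 = v1"
    and he: "(e \<bullet> f) \<bullet> e = 2 *s e + a *s v1" and hf: "(e \<bullet> f) \<bullet> f = b *s v0 - 2 *s f"
    using n unfolding natural_lifts_def by blast+
  note r = lifts_relations[OF ef]
  define h z z' where "h = e \<bullet> f" and "z = e \<bullet> v0" and "z' = f \<bullet> v1"
  have zZ: "z \<in> Z" "z' \<in> Z" using ev by (simp_all add: z_def z'_def)
  have hP: "h \<in> P" using r h_def by simp
  have zP: "z \<in> P" using zZ Z_subset by blast
  have vP: "v0 \<in> P" "v1 \<in> P" using vA by auto
  note nr = natural_lifts_relations[OF n]
  have zz': "a *s z' = b *s z" using nr(2) by (simp add: z_def z'_def)
  have 0: "x \<bullet> z = 0" "z \<bullet> x = 0" if "x \<in> P" for x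
    using Z_central zZ that by blast+
  have 1: "e \<bullet> f = h" "e \<bullet> v0 = z" "e \<bullet> v1 = v0" "f \<bullet> v0 = v1" "f \<bullet> v1 = z'" "v0 \<bullet> v1 = 0"
    "h \<bullet> v0 = v0" "h \<bullet> v1 = - v1" "h \<bullet> e = - e + a *s v1" "h \<bullet> f = b *s v0 + f"
    using hv he hf nr(1) by (simp_all add: h_def z_def z'_def scale_two_char3)
  have 2: "f \<bullet> e = - h" "v0 \<bullet> e = - z" "v1 \<bullet> e = - v0" "v0 \<bullet> f = - v1" "v1 \<bullet> f = - z'" "v1 \<bullet> v0 = 0"
    "v0 \<bullet> h = - v0" "v1 \<bullet> h = v1" "e \<bullet> h = e - a *s v1" "f \<bullet> h = - b *s v0 - f"
    using bracket_anticommute[of f e] bracket_anticommute[of v0 e] bracket_anticommute[of v1 e]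
      bracket_anticommute[of v0 f] bracket_anticommute[of v1 f] bracket_anticommute[of v1 v0]
      bracket_anticommute[of v0 h] bracket_anticommute[of v1 h] bracket_anticommute[of e h] bracket_anticommute[of f h]
    by (simp_all add: 1)
  note rel = 1 2 0[OF r(1)] 0[OF r(2)] 0[OF hP] 0[OF vP(1)] 0[OF vP(2)] 0[OF zP]
  \<comment> \<open>All terms but \<open>b *s v0\<close> make up \<open>exp (s ad e)\<close> applied to \<open>f\<close>, truncated after the square, where
    \<open>1/2 = -1\<close>. The term \<open>b *s v0\<close> makes the relations exact when \<open>z\<close> is not zero.\<close>
  define f' where "f' = f + s *s h - (s * s) *s e + b *s v0 + (a * (s * s)) *s v1"
  define v0' v1' where "v0' = v0 + s *s z" and "v1' = v1 + s *s v0 - (s * s) *s z"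
  have h': "e \<bullet> f' = h + s *s e + (a * (s * s)) *s v0 - (s * a) *s v1 + b *s z"
    unfolding f'_def by (simp add: rel bracket_linear algebra_simps)
  have f'P: "f' \<in> P" unfolding f'_def using r hP vP by (intro P_rules)
  have sz: "s *s z \<in> Z" "(s * s) *s z \<in> Z" using zZ Z_rules(3) by blast+
  have v0s: "s *s v0 \<in> A" using vA A_rules(3) by blast
  have szA: "s *s z \<in> A" "(s * s) *s z \<in> A" using sz Z_subset by blast+
  have v'A: "v0' \<in> A" "v1' \<in> A" unfolding v0'_def v1'_def by (intro A_rules(1,2) vA v0s szA)+
  let ?S = "insert v0' (insert v1' Z)"
  have v0S: "v0 \<in> span ?S"
    using span_diff[OF span_base span_base, of v0' ?S "s *s z"] sz by (simp add: v0'_def)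
  have v1S: "v1 \<in> span ?S"
  proof -
    have "v1' \<in> span ?S" "z \<in> span ?S" using zZ by (auto intro: span_base)
    then have "v1' - s *s v0 + (s * s) *s z \<in> span ?S" using v0S by (intro span_add span_diff span_scale)
    then show ?thesis by (simp add: v1'_def)
  qed
  have AS: "A \<subseteq> span ?S"
    unfolding span using v0S v1S by (intro span_minimal) (auto intro: span_base)
  have v0'Z: "v0' \<notin> Z" using Z_rules(2)[OF _ sz(1), of v0'] vZ by (auto simp: v0'_def)
  have ev1': "e \<bullet> v1' = v0'" unfolding v0'_def v1'_def by (simp add: rel bracket_linear)
  then have v1'Z: "v1' \<notin> Z" using Z_left[OF r(1)] v0'Z by metis
  have "natural_lifts e f' v0' v1' a 0"
  proof (rule natural_liftsI)
    show "e \<in> P" "e \<notin> R" using ef by (auto simp: lifts_def sl2_modulo_def)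
    show "e \<bullet> v0' \<in> Z" unfolding v0'_def using zZ by (simp add: rel bracket_linear)
    have "f' \<bullet> v1' = z' - (s * s * s) *s z"
      unfolding f'_def v1'_def by (simp add: rel bracket_linear algebra_simps)
    then show "f' \<bullet> v1' \<in> Z" using zZ Z_rules by simp
    show "(e \<bullet> f') \<bullet> v0' = v0'"
      unfolding h' v0'_def by (simp add: rel bracket_linear algebra_simps)
    show "(e \<bullet> f') \<bullet> v1' = - v1'"
      unfolding h' v1'_def by (simp add: rel bracket_linear algebra_simps double_char3 double_char3')
    show "f' \<bullet> v0' = v1'"
      unfolding f'_def v0'_def v1'_def by (simp add: rel bracket_linear algebra_simps)
    show "(e \<bullet> f') \<bullet> e = - e + a *s v1'"
      unfolding h' v1'_def by (simp add: rel bracket_linear algebra_simps)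
    have "s *s (a *s z') = s *s (b *s z)" using zz' by simp
    then have "(a * s) *s z' = (a * (s * (s * (s * s)))) *s z"
      using s by (simp add: algebra_simps)
    then show "(e \<bullet> f') \<bullet> f' = f' + 0 *s v0'"
      unfolding h' unfolding f'_def
      by (simp add: rel bracket_linear s[symmetric] algebra_simps double_char3 double_char3')
  qed (use f'P v'A v0'Z v1'Z AS ev1' in simp_all)
  then show ?thesis by blast
qed

lemma natural_lifts_scale:
  assumes n: "natural_lifts e f v0 v1 a 0" and a: "a \<noteq> 0"
  shows "natural_lifts e f (a *s v0) (a *s v1) 1 0"
proof -
  have ef: "lifts e f" and vA: "v0 \<in> A" "v1 \<in> A" and vZ: "v0 \<notin> Z" "v1 \<notin> Z"
    and span: "A = span (insert v0 (insert v1 Z))"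
    and ev: "e \<bullet> v0 \<in> Z" "f \<bullet> v1 \<in> Z" and hv: "(e \<bullet> f) \<bullet> v0 = v0" "(e \<bullet> f) \<bullet> v1 = - v1"
    "e \<bullet> v1 = v0" "f \<bullet> v0 = v1"
    and he: "(e \<bullet> f) \<bullet> e = 2 *s e + a *s v1" and hf: "(e \<bullet> f) \<bullet> f = 0 *s v0 - 2 *s f"
    using n unfolding natural_lifts_def by blast+
  have scaled: "x \<in> span S" if "a *s x \<in> span S" for x S
    using span_scale[OF that, of "1 / a"] a by simp
  show ?thesis
  proof (rule natural_liftsI)
    let ?S = "insert (a *s v0) (insert (a *s v1) Z)"
    have "v0 \<in> span ?S" "v1 \<in> span ?S" by (rule scaled, simp add: span_base)+
    then show "A \<subseteq> span ?S" unfolding span by (intro span_minimal) (auto intro: span_base)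
    show "e \<in> P" "f \<in> P" "e \<notin> R" using ef by (auto simp: lifts_def sl2_modulo_def)
    show "a *s v0 \<in> A" "a *s v1 \<in> A" using vA A_rules(3) by blast+
    show "a *s v0 \<notin> Z" "a *s v1 \<notin> Z" using vZ Z_scale_cancel a by metis+
    show "e \<bullet> (a *s v0) \<in> Z" "f \<bullet> (a *s v1) \<in> Z"
      unfolding bracket_scale_right using ev Z_rules(3) by blast+
  qed (simp_all add: bracket_linear hv he hf scale_two_char3)
qed

proposition normal_form: "\<exists>e f v0 v1. natural_lifts e f v0 v1 1 0"
proof -
  obtain e f v0 v1 a b where n: "natural_lifts e f v0 v1 a b" using natural_lifts_exist by blast
  show ?thesis
  proof (cases "a = 0")
    case True
    then have "b \<noteq> 0" using natural_lifts_relations(3)[OF n] by simp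
    then show ?thesis using natural_lifts_swap n True by blast
  next
    case False
    obtain s where "s * s * s = b / a" using cube_root_exists[OF characteristic_three] by blast
    then have "a * (s * s * s) = b" using False by simp
    then obtain f' v0' v1' where "natural_lifts e f' v0' v1' a 0"
      using natural_lifts_rotate[OF n] by blast
    then show ?thesis using natural_lifts_scale False by blast
  qed
qed

end

section \<open>Multiplication tables\<close>

context odd_lie_algebra
begin

text \<open>
  A spanning list whose length is the dimension is a basis; so linear independence need never be
  checked for the tables.
\<close>

lemma is_basis_if_spanning:
  assumes "dim UNIV = length bs" "span (set bs) = UNIV" shows "is_basis bs"
proof -
  have "dim UNIV \<le> card (set bs)" using assms(2) by (intro dim_le_card) auto
  then have card: "card (set bs) = length bs" using assms(1) card_length[of bs] by simp
  moreover have "independent (set bs)"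
    using assms card by (intro card_le_dim_spanning[of _ UNIV]) auto
  ultimately show ?thesis using assms(2) by (simp add: is_basis_def card_distinct)
qed

text \<open>
  Stability under brackets is tested on the basis.
\<close>

lemma core_span_ideal:
  assumes basis: "is_basis [d, e, h, f, v0, v1]" and core: "core_products e h f v0 v1 0 0"
    and d: "d \<bullet> e \<in> span {e, h, f, v0, v1}" "d \<bullet> h \<in> span {e, h, f, v0, v1}" "d \<bullet> f \<in> span {e, h, f, v0, v1}"
      "d \<bullet> v0 \<in> span {e, h, f, v0, v1}" "d \<bullet> v1 \<in> span {e, h, f, v0, v1}"
  shows "ideal (span {e, h, f, v0, v1})" "dim (span {e, h, f, v0, v1}) = 5"
proof -
  let ?S = "{e, h, f, v0, v1}"
  have base: "e \<in> span ?S" "h \<in> span ?S" "f \<in> span ?S" "v0 \<in> span ?S" "v1 \<in> span ?S"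
    by (auto intro: span_base)
  note c = core[unfolded core_products_def]
  have c': "e \<bullet> h = - (- e + v1)" "v0 \<bullet> h = - v0" "v0 \<bullet> e = - 0" "v0 \<bullet> f = - v1" "f \<bullet> h = - f" "v1 \<bullet> h = - (- v1)"
    "v1 \<bullet> e = - v0" "v1 \<bullet> f = - 0" "f \<bullet> e = - h" "v1 \<bullet> v0 = - 0"
    using c bracket_anticommute by metis+
  note base' = base span_neg[OF base(1)] span_neg[OF base(2)] span_neg[OF base(3)] span_neg[OF base(4)]
    span_neg[OF base(5)] span_zero span_diff[OF base(1) base(5)] span_diff[OF base(5) base(1)]
  have prod: "x \<bullet> s \<in> span ?S" if "x \<in> insert d ?S" "s \<in> ?S" for x s
    using that d base' by (auto simp: c c' bracket_self)
  have "span (insert d ?S) \<subseteq> {x. \<forall>y\<in>span ?S. x \<bullet> y \<in> span ?S}"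
  proof (rule span_minimal)
    show "insert d ?S \<subseteq> {x. \<forall>y\<in>span ?S. x \<bullet> y \<in> span ?S}"
    proof
      fix x assume "x \<in> insert d ?S"
      then have "x \<bullet> s \<in> span ?S" if "s \<in> ?S" for s using prod that by blast
      then have "span ?S \<subseteq> {y. x \<bullet> y \<in> span ?S}"
        by (intro span_minimal) (auto simp: subspace_def bracket_linear span_zero span_add span_scale)
      then show "x \<in> {x. \<forall>y\<in>span ?S. x \<bullet> y \<in> span ?S}" by blast
    qed
    show "subspace {x. \<forall>y\<in>span ?S. x \<bullet> y \<in> span ?S}"
      by (auto simp: subspace_def bracket_linear span_zero span_add span_scale)
  qed
  then show "ideal (span ?S)"
    using basis unfolding ideal_def is_basis_def by auto
  have "independent (insert d ?S)" using basis by (simp add: is_basis_def)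
  then have "independent ?S" by (rule independent_mono) blast
  then have "dim (span ?S) = card ?S" by (rule dim_span_eq_card_independent)
  then show "dim (span ?S) = 5" using basis by (simp add: is_basis_def)
qed

end

context irreducible_top
begin

lemma dim_UNIV_six: "dim UNIV = 6"
  using codim_R dim_R by simp

lemma spanning_if_lifts:
  assumes "lifts e f" "e \<in> span S" "e \<bullet> f \<in> span S" "f \<in> span S" "R \<subseteq> span S"
  shows "span S = UNIV"
proof -
  have "x \<in> span S" for x
  proof -
    obtain a b c where r: "x - (a *s e + b *s (e \<bullet> f) + c *s f) \<in> R"
      using sl2_modulo_spans[OF R codim_R] assms(1) lifts_def by blast
    have "(a *s e + b *s (e \<bullet> f) + c *s f) \<in> span S" using assms by (intro span_add span_scale)
    then show ?thesis by (rule subspace_add_cancel[OF subspace_span subsetD[OF assms(5) r]])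
  qed
  then show ?thesis by blast
qed

lemma natural_lifts_core:
  assumes "natural_lifts e f v0 v1 1 0"
  shows "core_products e (e \<bullet> f) f v0 v1 (e \<bullet> v0) 0" "lifts e f" "A = span (insert v0 (insert v1 Z))"
    "v0 \<in> A" "v1 \<in> A" "e \<bullet> v0 \<in> Z" "dim A = dim Z + 2"
proof -
  show A: "lifts e f" "A = span (insert v0 (insert v1 Z))"
    "v0 \<in> A" "v1 \<in> A" "e \<bullet> v0 \<in> Z" using assms unfolding natural_lifts_def by blast+
  show "core_products e (e \<bullet> f) f v0 v1 (e \<bullet> v0) 0"
    using assms natural_lifts_relations[OF assms]
    unfolding core_products_def natural_lifts_def by (auto simp: scale_two_char3)
  have v1: "v1 \<notin> Z" using assms unfolding natural_lifts_def by blast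
  have "v0 \<notin> span (insert v1 Z)"
  proof
    assume "v0 \<in> span (insert v1 Z)"
    then have "A = span (insert v1 Z)" using A(2) by (simp add: span_redundant)
    then show False using not_one_dimensional A(4) by blast
  qed
  then have "dim (span (insert v0 (insert v1 Z))) = dim Z + 2" using v1 by (simp add: dim_insert)
  then show "dim A = dim Z + 2" using A(2) by simp
qed

text \<open>
  For \<open>Z \<noteq> 0\<close> the dimensions give \<open>A = R\<close>, so that \<open>P = L\<close> and \<open>Z\<close> is the line of a central element. If \<open>[e, v0]\<close>
  is not zero, it serves as this element.
\<close>

lemma table_central_case:
  assumes "Z \<noteq> {0}"
  shows "has_table (Table_I 0 0) \<or> has_table (Table_I 1 0)"
proof -
  obtain e f v0 v1 where n: "natural_lifts e f v0 v1 1 0" using normal_form by blast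
  note c = natural_lifts_core[OF n]
  obtain y where y: "y \<in> Z" "y \<noteq> 0" using assms Z_rules(5) by blast
  have "dim Z \<noteq> 0" using y by auto
  then have "dim A = dim R" using c(7) dim_Z dim_R by linarith
  then have AR: "A = R" using A_sub R_sub by (intro subspace_dim_equal) auto
  have spanning: "span (set [e, e \<bullet> f, f, v0, v1, z]) = UNIV"
    and central: "\<forall>x. z \<bullet> x = 0" if z: "z \<in> Z" "z \<noteq> 0" for z
  proof -
    have "span {z} = Z"
      using z dim_Z by (intro subspace_dim_equal Z_sub) (auto intro: span_minimal[OF _ Z_sub, THEN subsetD] simp: dim_span)
    then have "Z \<subseteq> span {e, e \<bullet> f, f, v0, v1, z}" using span_mono[of "{z}" "{e, e \<bullet> f, f, v0, v1, z}"] by simp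
    then have "A \<subseteq> span {e, e \<bullet> f, f, v0, v1, z}"
      unfolding c(3) by (intro span_minimal) (auto intro: span_base)
    then show "span (set [e, e \<bullet> f, f, v0, v1, z]) = UNIV"
      using AR by (intro spanning_if_lifts[OF c(2)]) (auto intro: span_base)
    have "P = UNIV"
    proof -
      have "x \<in> P" for x
      proof -
        obtain p where "p \<in> P" "x - p \<in> R" using supplement by blast
        moreover have "R \<subseteq> P" using AR by blast
        ultimately show ?thesis using subspace_add_cancel[OF P_sub] by blast
      qed
      then show ?thesis by blast
    qed
    then show "\<forall>x. z \<bullet> x = 0" using Z_central(2) z by blast
  qed
  show ?thesis
  proof (cases "e \<bullet> v0 = 0")
    case True
    have "core_products e (e \<bullet> f) f v0 v1 (0 *s y) (0 *s y)" using c(1) True by simp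
    moreover have "is_basis [e, e \<bullet> f, f, v0, v1, y]"
      using spanning[OF y] dim_UNIV_six by (intro is_basis_if_spanning) simp_all
    ultimately have "has_table (Table_I 0 0)" unfolding has_table.simps using central[OF y] by blast
    then show ?thesis by blast
  next
    case False
    let ?z = "e \<bullet> v0"
    have "core_products e (e \<bullet> f) f v0 v1 (1 *s ?z) (0 *s ?z)" using c(1) by simp
    moreover have "is_basis [e, e \<bullet> f, f, v0, v1, ?z]"
      using spanning[OF c(6) False] dim_UNIV_six by (intro is_basis_if_spanning) simp_all
    ultimately have "has_table (Table_I 1 0)" unfolding has_table.simps using central[OF c(6) False] by blast
    then show ?thesis by blast
  qed
qed

text \<open>
  Since \<open>P\<close> is its own derived algebra, it maps the line \<open>R/A\<close> to zero, so \<open>ad d\<close> is a derivation of \<open>P\<close> with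
  values in \<open>A\<close>. An inner derivation by an element of \<open>A\<close> achieves \<open>[h, d] = 0\<close>, and then weights leave
  only multiples of \<open>e \<mapsto> v1\<close>, of \<open>f \<mapsto> v0\<close>, and a scalar \<open>k\<close> on \<open>A\<close>. Applying the derivation to
  \<open>[h, e] = - e + v1\<close> shows \<open>k = 0\<close>: the extension class does not vanish.
\<close>

lemma outer_element:
  assumes Z0: "Z = {0}" and n: "natural_lifts e f v0 v1 1 0"
  obtains d y w where "R \<subseteq> span {d, v0, v1}" "d \<bullet> e = y *s v1" "d \<bullet> f = w *s v0" "d \<bullet> (e \<bullet> f) = 0"
    "d \<bullet> v0 = 0" "d \<bullet> v1 = 0"
proof -
  note c = natural_lifts_core[OF n]
  note r = lifts_relations[OF c(2)]
  define h where "h = e \<bullet> f"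
  have core: "h \<bullet> e = - e + v1" "h \<bullet> f = f" "h \<bullet> v0 = v0" "h \<bullet> v1 = - v1" "f \<bullet> v0 = v1"
    using c(1) by (auto simp: core_products_def h_def)
  have hP: "h \<in> P" using r h_def by simp
  have A: "A = span {v0, v1}"
  proof -
    have "span (insert v0 (insert v1 Z)) = span {v0, v1}"
      unfolding Z0 by (rule span_eq[THEN iffD2]) (auto simp: span_zero intro: span_base)
    then show ?thesis using c(3) by simp
  qed
  have dimA: "dim A = 2" using c(7) Z0 by simp
  have coord: "\<exists>s t. x = s *s v0 + t *s v1" if "x \<in> A" for x
  proof -
    have "x \<in> span {v0, v1}" using that A by simp
    then obtain s t where "x - s *s v0 - t *s v1 = 0" by (auto simp: span_breakdown_eq)
    then show ?thesis by (intro exI[of _ s] exI[of _ t]) (simp add: algebra_simps)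
  qed
  have v_nz: "v0 \<noteq> 0" "v1 \<noteq> 0" using n Z0 unfolding natural_lifts_def by blast+
  have indep: "s = 0 \<and> t = 0" if "s *s v0 + t *s v1 = 0" for s t
  proof -
    have "s *s v0 - t *s v1 = 0"
      using arg_cong[OF that, of "\<lambda>x. h \<bullet> x"] by (simp add: bracket_linear core)
    then have "s *s v0 + s *s v0 = 0" using that by (simp add: algebra_simps)
    then have "s *s v0 = 0" by (simp add: double_char3)
    then show ?thesis using v_nz that by simp
  qed
  have abelian: "x \<bullet> y = 0" if "x \<in> A" "y \<in> A" for x y using A_abelian_modulo[OF that] Z0 by simp
  have "A \<noteq> R" using dimA dim_R by auto
  then obtain d0 where d0: "d0 \<in> R" "d0 \<notin> A" by blast
  have spanA: "span A = A" using A_sub by simp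
  have "dim (insert d0 A) = 3" using d0 dimA by (simp add: dim_insert spanA)
  then have R_eq: "span (insert d0 A) = R"
    using d0 dim_R by (intro subspace_dim_equal R_sub span_minimal) auto
  have dA: "x \<bullet> d0 \<in> A" if "x \<in> P" for x
  proof (rule one_dimensional_action_trivial[OF P_ideal_A _ that])
    fix x assume "x \<in> P"
    have "x \<bullet> d0 \<in> span (insert d0 A)" unfolding R_eq by (rule R_rules(7)[OF d0(1)])
    then show "\<exists>k. x \<bullet> d0 - k *s d0 \<in> A" unfolding span_breakdown_eq spanA .
  qed
  obtain s t where hd0: "h \<bullet> d0 = s *s v0 + t *s v1" using coord dA[OF hP] by blast
  \<comment> \<open>The operator \<open>ad h\<close> is invertible on \<open>A\<close> and maps the subtracted vector to \<open>[h, d0]\<close>.\<close>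
  define d where "d = d0 - (s *s v0 - t *s v1)"
  have stA: "s *s v0 - t *s v1 \<in> A" using c(4,5) by (intro A_rules)
  have hd: "h \<bullet> d = 0" unfolding d_def by (simp add: bracket_linear hd0 core)
  have PdA: "x \<bullet> d \<in> A" if "x \<in> P" for x
    using A_rules(2)[OF dA[OF that] A_bracket(1)[OF that stA]]
    unfolding d_def bracket_diff_right[of x d0] .
  have Rd: "R \<subseteq> span {d, v0, v1}"
  proof -
    have "s *s v0 - t *s v1 \<in> span {d, v0, v1}" by (intro span_diff span_scale span_base) auto
    moreover have "d \<in> span {d, v0, v1}" by (intro span_base) simp
    ultimately have "d + (s *s v0 - t *s v1) \<in> span {d, v0, v1}" by (intro span_add)
    then have "d0 \<in> span {d, v0, v1}" by (simp add: d_def)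
    moreover have "A \<subseteq> span {d, v0, v1}" unfolding A by (intro span_mono) auto
    ultimately have "span (insert d0 A) \<subseteq> span {d, v0, v1}" by (intro span_minimal) auto
    then show ?thesis using R_eq by simp
  qed
  have eigen: "\<exists>k. x = k *s v0" if x: "x \<in> A" "h \<bullet> x = x" for x
  proof -
    obtain a b where ab: "x = a *s v0 + b *s v1" using coord x(1) by blast
    then have "b *s v1 + b *s v1 = 0" using x(2) by (simp add: bracket_linear core algebra_simps)
    then have "b *s v1 = 0" by (simp add: double_char3)
    then show ?thesis using ab by auto
  qed
  have vP: "v0 \<in> P" "v1 \<in> P" using c(4,5) by auto
  have "h \<bullet> (v0 \<bullet> d) = v0 \<bullet> d" unfolding leibniz[of h v0 d] core hd by simp
  then obtain k where k: "v0 \<bullet> d = k *s v0" using eigen PdA[OF vP(1)] by blast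
  have "f \<bullet> (v0 \<bullet> d) = v1 \<bullet> d"
    unfolding leibniz[of f v0 d] core using abelian[OF c(4) PdA[OF r(2)]] by simp
  then have v1d: "v1 \<bullet> d = k *s v1" unfolding k by (simp add: bracket_linear core)
  obtain x y where xy: "e \<bullet> d = x *s v0 + y *s v1" using coord PdA[OF r(1)] by blast
  have "h \<bullet> (e \<bullet> d) = - (e \<bullet> d) + k *s v1"
    unfolding leibniz[of h e d] core hd by (simp add: bracket_linear v1d)
  then have "(x + x) *s v0 + (- k) *s v1 = 0"
    unfolding xy scale_left_distrib[of x x] by (simp add: bracket_linear core algebra_simps)
  from indep[OF this] have "x + x = 0" "k = 0" by auto
  then have "2 * x = 0" "k = 0" by (simp_all only: mult_2)
  then have xk: "x = 0" "k = 0" using two_neq_zero by simp_all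
  have "h \<bullet> (f \<bullet> d) = f \<bullet> d" unfolding leibniz[of h f d] core hd by simp
  then obtain w where w: "f \<bullet> d = w *s v0" using eigen PdA[OF r(2)] by blast
  show thesis
  proof (rule that[OF Rd])
    show "d \<bullet> e = (- y) *s v1" using xy xk bracket_anticommute[of d e] by simp
    show "d \<bullet> f = (- w) *s v0" using w bracket_anticommute[of d f] by simp
    show "d \<bullet> (e \<bullet> f) = 0" using hd bracket_anticommute[of d h] by (simp add: h_def)
    show "d \<bullet> v0 = 0" "d \<bullet> v1 = 0"
      using k v1d xk bracket_anticommute[of d v0] bracket_anticommute[of d v1] by simp_all
  qed
qed

text \<open>
  Without \<open>Z\<close>, the remaining basis vector \<open>d\<close> of the radical acts as an outer derivation of \<open>P\<close>.
  The automorphisms \<open>exp (s ad f)\<close> fix the extension class \<open>(1, 0)\<close> and add to the value at \<open>e\<close> the multiple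
  \<open>s\<^sup>3\<close> of the value at \<open>f\<close>. So the value at \<open>e\<close> can be removed when the one at \<open>f\<close> does not vanish.
\<close>

lemma table_outer_case:
  assumes Z0: "Z = {0}"
  shows "has_table (Table_I 0 0) \<or> has_table Table_II_e \<or> has_table Table_II_f"
proof -
  obtain e f v0 v1 where n: "natural_lifts e f v0 v1 1 0" using normal_form by blast
  note c = natural_lifts_core[OF n]
  obtain d y w where Rd: "R \<subseteq> span {d, v0, v1}" and d: "d \<bullet> e = y *s v1" "d \<bullet> f = w *s v0"
    "d \<bullet> (e \<bullet> f) = 0" "d \<bullet> v0 = 0" "d \<bullet> v1 = 0"
    by (rule outer_element[OF Z0 n])
  define h where "h = e \<bullet> f"
  have ev0: "e \<bullet> v0 = 0" using c(6) Z0 by simp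
  have core: "core_products e h f v0 v1 0 0" using c(1) ev0 by (simp add: h_def)
  then have rel: "h \<bullet> e = - e + v1" "h \<bullet> v0 = v0" "e \<bullet> v0 = 0" "f \<bullet> v0 = v1" "h \<bullet> f = f"
    "h \<bullet> v1 = - v1" "e \<bullet> v1 = v0" "f \<bullet> v1 = 0" "e \<bullet> f = h" "v0 \<bullet> v1 = 0"
    by (auto simp: core_products_def)
  have spanning: "span (set [d', e, h, f, v0, v1]) = UNIV" if "d \<in> span {d', e, h, f, v0, v1}" for d'
  proof -
    have "span {d, v0, v1} \<subseteq> span {d', e, h, f, v0, v1}"
      using that by (intro span_minimal) (auto intro: span_base)
    then show ?thesis using Rd
      by (intro spanning_if_lifts[OF c(2)]) (auto simp: h_def[symmetric] intro: span_base)
  qed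
  consider "w \<noteq> 0" | "w = 0" "y \<noteq> 0" | "w = 0" "y = 0" by blast
  then show ?thesis
  proof cases
    case 3
    have span: "span (set [d, e, h, f, v0, v1]) = UNIV" by (rule spanning) (simp add: span_base)
    then have "span (set [e, h, f, v0, v1, d]) = UNIV" by (simp add: insert_commute)
    then have basis: "is_basis [e, h, f, v0, v1, d]" using dim_UNIV_six by (intro is_basis_if_spanning) simp_all
    have central: "d \<bullet> x = 0" for x
    proof -
      have "span (set [d, e, h, f, v0, v1]) \<subseteq> {x. d \<bullet> x = 0}"
        using d 3 by (intro span_minimal) (auto simp: h_def subspace_def bracket_linear)
      then show ?thesis using span by blast
    qed
    have "has_table (Table_I 0 0)" unfolding has_table.simps
      by (rule exI[of _ "e"], rule exI[of _ "h"], rule exI[of _ "f"], rule exI[of _ "v0"], rule exI[of _ "v1"], rule exI[of _ "d"])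
        (use basis central core in simp)
    then show ?thesis by blast
  next
    case 2
    define d' where "d' = (1 / y) *s d"
    have "d = y *s d'" using 2 by (simp add: d'_def)
    then have "d \<in> span {d', e, h, f, v0, v1}" by (auto intro: span_scale span_base)
    then have basis: "is_basis [d', e, h, f, v0, v1]"
      using spanning dim_UNIV_six by (intro is_basis_if_spanning) simp_all
    have d': "d' \<bullet> e = v1" "d' \<bullet> h = 0" "d' \<bullet> f = 0" "d' \<bullet> v0 = 0" "d' \<bullet> v1 = 0"
      using d 2 by (simp_all add: d'_def bracket_linear h_def)
    have "has_table Table_II_e"
      unfolding has_table.simps
      by (rule exI[of _ "d'"], rule exI[of _ "e"], rule exI[of _ "h"], rule exI[of _ "f"], rule exI[of _ "v0"], rule exI[of _ "v1"])
        (use basis core d' core_span_ideal[OF basis core] in \<open>simp add: span_base span_zero\<close>)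
    then show ?thesis by blast
  next
    case 1
    obtain s where s: "s * s * s = - (y / w)" using cube_root_exists[OF characteristic_three] by blast
    \<comment> \<open>The images of \<open>e\<close>, \<open>h\<close>, \<open>v0\<close> under \<open>exp (s ad f)\<close>; the element \<open>f\<close> and \<open>v1\<close> stay fixed. The multiples of
      \<open>v0\<close> and \<open>v1\<close> in \<open>d'\<close> are chosen so that \<open>d'\<close> commutes with \<open>h'\<close>.\<close>
    define e' h' v0' where "e' = e - s *s h - (s * s) *s f" and "h' = h - s *s f" and "v0' = v0 + s *s v1"
    define d' where "d' = (1 / w) *s d - s *s v0 + (s * s) *s v1"
    have anti: "f \<bullet> e = - h" "f \<bullet> h = - f" "e \<bullet> h = e - v1" "v0 \<bullet> e = 0" "v1 \<bullet> e = - v0" "v0 \<bullet> f = - v1" "v1 \<bullet> f = 0"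
      "v0 \<bullet> h = - v0" "v1 \<bullet> h = v1" "v1 \<bullet> v0 = 0"
      using bracket_anticommute[of f e] bracket_anticommute[of f h] bracket_anticommute[of e h]
        bracket_anticommute[of v0 e] bracket_anticommute[of v1 e] bracket_anticommute[of v0 f]
        bracket_anticommute[of v1 f] bracket_anticommute[of v0 h] bracket_anticommute[of v1 h]
        bracket_anticommute[of v1 v0] by (simp_all add: rel)
    note prods = rel anti d[folded h_def] bracket_linear
    have core': "core_products e' h' f v0' v1 0 0"
      unfolding core_products_def e'_def h'_def v0'_def
      by (intro conjI) (simp_all add: prods algebra_simps double_char3 double_char3')
    have yw: "(y / w) = - (s * s * s)" using s by simp
    have d': "d' \<bullet> e' = 0" "d' \<bullet> h' = 0" "d' \<bullet> f = v0'" "d' \<bullet> v0' = 0" "d' \<bullet> v1 = 0"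
      unfolding d'_def e'_def h'_def v0'_def using 1
      by (simp_all add: prods yw algebra_simps double_char3 double_char3')
    have "span (set [d', e', h', f, v0', v1]) = UNIV"
    proof -
      let ?S = "{d', e', h', f, v0', v1}"
      have 0: "d' \<in> span ?S" "e' \<in> span ?S" "h' \<in> span ?S" "f \<in> span ?S" "v0' \<in> span ?S" "v1 \<in> span ?S"
        by (auto intro: span_base)
      have "h = h' + s *s f" "v0 = v0' - s *s v1" by (simp_all add: h'_def v0'_def)
      then have 1: "h \<in> span ?S" "v0 \<in> span ?S" using 0 by (auto intro!: span_add span_diff span_scale)
      have "e = e' + s *s h + (s * s) *s f" by (simp add: e'_def)
      then have 2: "e \<in> span ?S" using 0 1 by (auto intro!: span_add span_scale)
      have "d = w *s (d' + s *s v0 - (s * s) *s v1)" using \<open>w \<noteq> 0\<close> by (simp add: d'_def)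
      then have 3: "d \<in> span ?S" using 0 1 by (auto intro!: span_add span_diff span_scale)
      have "span {d, e, h, f, v0, v1} \<subseteq> span ?S" using 0 1 2 3 by (intro span_minimal) auto
      then show ?thesis using spanning[of d] by (simp add: span_base top.extremum_unique)
    qed
    then have basis: "is_basis [d', e', h', f, v0', v1]"
      using dim_UNIV_six by (intro is_basis_if_spanning) simp_all
    have "has_table Table_II_f"
      unfolding has_table.simps
      by (rule exI[of _ "d'"], rule exI[of _ "e'"], rule exI[of _ "h'"], rule exI[of _ "f"], rule exI[of _ "v0'"], rule exI[of _ "v1"])
        (use basis core' d' core_span_ideal[OF basis core'] in \<open>simp add: span_base span_zero\<close>)
    then show ?thesis by blast
  qed
qed

end

section \<open>The classification\<close>

context odd_lie_algebra
begin

lemma splits_if_complement: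
  assumes P: "subalgebra P" and supplement: "\<And>x. \<exists>y\<in>P. x - y \<in> radical" and "P \<inter> radical = {0}"
  shows radical_extension_splits
proof -
  note sub = ideal_subspace[OF radical_is_solvable_ideal(1)[OF finite_UNIV]]
  have coset_eq: "coset radical x = coset radical y" if "x - y \<in> radical" for x y
  proof -
    have "coset radical x \<subseteq> coset radical y" if "x - y \<in> radical" for x y
    proof
      fix w assume "w \<in> coset radical x"
      then obtain r where "r \<in> radical" "w = x + r" by (auto simp: coset_def)
      then have "w = y + ((x - y) + r)" "(x - y) + r \<in> radical"
        using that subspace_add[OF sub] by auto
      then show "w \<in> coset radical y" unfolding coset_def by blast
    qed
    from this[OF that] this[of y x] show ?thesis using subspace_neg[OF sub that] by auto
  qed
  have "inj_on (coset radical) P"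
  proof (rule inj_onI)
    fix x y assume xy: "x \<in> P" "y \<in> P" "coset radical x = coset radical y"
    have "x + 0 \<in> coset radical x" unfolding coset_def using subspace_0[OF sub] by blast
    then obtain r where r: "r \<in> radical" "x = y + r" using xy(3) by (auto simp: coset_def)
    have "x - y \<in> P" using P xy by (auto simp: subalgebra_def intro: subspace_diff)
    then have "r \<in> P \<inter> radical" using r by simp
    then show "x = y" using assms(3) r by simp
  qed
  moreover have "coset radical ` P = range (coset radical)"
  proof (intro equalityI subsetI)
    fix c assume "c \<in> range (coset radical)"
    then obtain x where "c = coset radical x" by blast
    moreover obtain y where "y \<in> P" "x - y \<in> radical" using supplement by blast
    ultimately show "c \<in> coset radical ` P" using coset_eq by blast
  qed blast
  ultimately show ?thesis unfolding radical_extension_splits_def bij_betw_def using P by blast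
qed

proposition nonsplit_classification:
  assumes dim: "dim UNIV = 6" and nonsolvable: "\<not> solvable UNIV" and dimR: "dim radical = 3"
    and nonsplit: "\<not> radical_extension_splits"
  shows "(3::'k) = 0 \<and> (\<exists>T\<in>classification_tables. has_table T)"
proof -
  note R = radical_is_solvable_ideal[OF finite_UNIV]
  have codim: "dim UNIV = dim radical + 3" using dim dimR by simp
  let ?Q = "\<lambda>K. subalgebra K \<and> (\<forall>x. \<exists>y\<in>K. x - y \<in> radical)"
  have "subalgebra UNIV" by (simp add: subalgebra_def)
  moreover have "\<exists>y\<in>UNIV. x - y \<in> radical" for x
    using subspace_0[OF ideal_subspace[OF R(1)]] by (intro bexI[of _ x]) auto
  ultimately have "?Q UNIV" by blast
  from ex_has_least_nat[where P = ?Q and m = card, OF this]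
  obtain P where P: "?Q P" and least: "\<forall>K. ?Q K \<longrightarrow> card P \<le> card K" by auto
  interpret minimal_supplement scale bracket Basis radical P
  proof
    show "\<exists>y\<in>P. x - y \<in> radical" for x using P by blast
    show "K = P" if "subalgebra K" "K \<subseteq> P" "\<And>x. \<exists>y\<in>K. x - y \<in> radical" for K
    proof (rule card_seteq[OF _ that(2)])
      show "finite P" using finite_UNIV by (rule finite_subset[OF subset_UNIV])
      show "card P \<le> card K" using least that by simp
    qed
    show "P \<inter> radical \<noteq> {0}" using splits_if_complement P nonsplit by blast
    show "\<exists>e f. sl2_modulo radical e f"
      using exists_sl2_modulo[OF R(1) codim perfect_modulo_radical[OF nonsolvable codim]] by blast
  qed (use R codim dimR P in auto)
  obtain Z where "top_ideal Z" using top_ideal_exists by blast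
  then interpret irreducible_top scale bracket Basis radical P Z by unfold_locales
  have "has_table (Table_I 0 0) \<or> has_table (Table_I 1 0) \<or> has_table Table_II_e \<or> has_table Table_II_f"
    using table_central_case table_outer_case by blast
  then show ?thesis using characteristic_three unfolding classification_tables_def by blast
qed

end

section \<open>Invariants of the tables\<close>

context alternating_algebra
begin

definition derived_algebra :: "'l set" where
  "derived_algebra = span (range (\<lambda>(x, y). bracket x y))"

definition has_center :: bool where
  "has_center \<longleftrightarrow> (\<exists>z. z \<noteq> 0 \<and> (\<forall>x. bracket z x = 0))"

definition satisfies_jacobi :: bool where
  "satisfies_jacobi \<longleftrightarrow>
    (\<forall>x y w. bracket x (bracket y w) + bracket y (bracket w x) + bracket w (bracket x y) = 0)"

text \<open>
  In the table with \<open>[d, e] = v\<^sub>1\<close> the basis vectors themselves are witnesses. The pair \<open>h, f\<close> generates a Borel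
  subalgebra modulo the radical.
\<close>

definition outer_centralizes_borel :: bool where
  "outer_centralizes_borel \<longleftrightarrow> (\<exists>d e h f. d \<notin> derived_algebra \<and> bracket d h = 0 \<and> bracket d f = 0 \<and>
    bracket h f = f \<and> f \<noteq> 0 \<and> bracket e f = h)"

lemma bracket_in_derived_algebra: "bracket x y \<in> derived_algebra"
  unfolding derived_algebra_def by (rule span_base) auto

lemma derived_algebra_subset:
  assumes "subspace W" "\<And>x y. bracket x y \<in> W" shows "derived_algebra \<subseteq> W"
  unfolding derived_algebra_def using assms by (intro span_minimal) auto

lemma basis_coordinates:
  assumes "is_basis [b1, b2, b3, b4, b5, b6]"
  shows "\<exists>a1 a2 a3 a4 a5 a6. x = scale a1 b1 + scale a2 b2 + scale a3 b3 + scale a4 b4 + scale a5 b5 + scale a6 b6"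
proof -
  have "x \<in> span {b1, b2, b3, b4, b5, b6}" using assms by (simp add: is_basis_def)
  then obtain a1 a2 a3 a4 a5 a6 where
    "x - scale a1 b1 - scale a2 b2 - scale a3 b3 - scale a4 b4 - scale a5 b5 - scale a6 b6 = 0"
    by (auto simp: span_breakdown_eq)
  then have "x = scale a1 b1 + scale a2 b2 + scale a3 b3 + scale a4 b4 + scale a5 b5 + scale a6 b6"
    by (simp add: algebra_simps)
  then show ?thesis by blast
qed

lemma basis_independent:
  assumes "is_basis [b1, b2, b3, b4, b5, b6]"
    and "scale a1 b1 + scale a2 b2 + scale a3 b3 + scale a4 b4 + scale a5 b5 + scale a6 b6 = 0"
  shows "a1 = 0 \<and> a2 = 0 \<and> a3 = 0 \<and> a4 = 0 \<and> a5 = 0 \<and> a6 = 0"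
proof -
  let ?S = "{b1, b2, b3, b4, b5, b6}"
  define u where "u = (\<lambda>v. if v = b1 then a1 else if v = b2 then a2 else if v = b3 then a3
    else if v = b4 then a4 else if v = b5 then a5 else a6)"
  have d: "distinct [b1, b2, b3, b4, b5, b6]" "independent ?S" using assms(1) by (simp_all add: is_basis_def)
  have "(\<Sum>v\<in>?S. scale (u v) v) = 0" using assms(2) d(1) by (auto simp: u_def algebra_simps)
  then have "u v = 0" if "v \<in> ?S" for v using independentD[OF d(2) _ subset_refl _ that] by simp
  from this[of b1] this[of b2] this[of b3] this[of b4] this[of b5] this[of b6]
  show ?thesis using d(1) by (auto simp: u_def)
qed

lemma basis_not_in_span:
  assumes "is_basis (b # bs)" shows "b \<notin> span (set bs)"
  using assms unfolding is_basis_def by (auto simp: independent_insert split: if_splits)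

lemma is_basis_rotate: "is_basis [b1, b2, b3, b4, b5, b6] \<Longrightarrow> is_basis [b6, b1, b2, b3, b4, b5]"
  unfolding is_basis_def by (auto simp: insert_commute)

lemma core_anticommute:
  assumes "core_products e h f v0 v1 a b"
  shows "bracket e h = e - v1" "bracket v0 h = - v0" "bracket v0 e = - a" "bracket v0 f = - v1"
    "bracket f h = - f" "bracket v1 h = v1" "bracket v1 e = - v0" "bracket v1 f = 0" "bracket f e = - h"
    "bracket v1 v0 = - b"
  using assms bracket_anticommute[of e h] bracket_anticommute[of v0 h] bracket_anticommute[of v0 e]
    bracket_anticommute[of v0 f] bracket_anticommute[of f h] bracket_anticommute[of v1 h]
    bracket_anticommute[of v1 e] bracket_anticommute[of v1 f] bracket_anticommute[of f e]
    bracket_anticommute[of v1 v0]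
  by (simp_all add: core_products_def)

lemma core_in_derived_algebra:
  assumes c: "core_products e h f v0 v1 a b"
  shows "e \<in> derived_algebra" "h \<in> derived_algebra" "f \<in> derived_algebra" "v0 \<in> derived_algebra" "v1 \<in> derived_algebra"
proof -
  note b = bracket_in_derived_algebra
  show h: "h \<in> derived_algebra" "f \<in> derived_algebra" "v0 \<in> derived_algebra" and v1: "v1 \<in> derived_algebra"
    using b[of e f] b[of h f] b[of h v0] b[of f v0] c by (simp_all add: core_products_def)
  have "v1 - bracket h e \<in> derived_algebra" using v1 b unfolding derived_algebra_def by (rule span_diff)
  then show "e \<in> derived_algebra" using c by (simp add: core_products_def)
qed

lemma Table_I_perfect:
  assumes "has_table (Table_I \<alpha> \<beta>)" "\<alpha> = 1 \<or> \<beta> = 1" shows "derived_algebra = UNIV"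
proof -
  obtain e h f v0 v1 z where basis: "is_basis [e, h, f, v0, v1, z]"
    and c: "core_products e h f v0 v1 (scale \<alpha> z) (scale \<beta> z)"
    using assms(1) by auto
  have "z \<in> derived_algebra"
    using assms(2) c bracket_in_derived_algebra[of e v0] bracket_in_derived_algebra[of v0 v1]
    by (auto simp: core_products_def)
  then have "span (set [e, h, f, v0, v1, z]) \<subseteq> derived_algebra"
    using core_in_derived_algebra[OF c] by (intro span_minimal) (auto simp: derived_algebra_def)
  then show ?thesis using basis by (auto simp: is_basis_def)
qed

lemma Table_I_zero:
  assumes "has_table (Table_I 0 0)" shows "derived_algebra \<noteq> UNIV" "has_center"
proof -
  obtain e h f v0 v1 z where basis: "is_basis [e, h, f, v0, v1, z]" and z: "\<forall>x. bracket z x = 0"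
    and c: "core_products e h f v0 v1 0 0"
    using assms by auto
  let ?W = "span {e, h, f, v0, v1}"
  have z': "bracket x z = 0" for x using z bracket_anticommute[of x z] by simp
  have W: "e \<in> ?W" "h \<in> ?W" "f \<in> ?W" "v0 \<in> ?W" "v1 \<in> ?W" by (auto intro: span_base)
  have "bracket x y \<in> ?W" for x y
  proof -
    obtain a1 a2 a3 a4 a5 a6 where x: "x = scale a1 e + scale a2 h + scale a3 f + scale a4 v0 + scale a5 v1 + scale a6 z"
      using basis_coordinates[OF basis] by blast
    obtain c1 c2 c3 c4 c5 c6 where y: "y = scale c1 e + scale c2 h + scale c3 f + scale c4 v0 + scale c5 v1 + scale c6 z"
      using basis_coordinates[OF basis] by blast
    note cc = c[unfolded core_products_def]
    show ?thesis
      unfolding x y by (simp only: bracket_linear cc core_anticommute[OF c] z z')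
        (intro span_add span_diff span_scale span_neg span_zero W)
  qed
  then have "derived_algebra \<subseteq> ?W" by (intro derived_algebra_subset) auto
  moreover have "z \<notin> ?W" using basis_not_in_span[OF is_basis_rotate[OF basis]] by simp
  ultimately show "derived_algebra \<noteq> UNIV" by blast
  have "z \<noteq> 0" using \<open>z \<notin> ?W\<close> span_zero by metis
  then show has_center unfolding has_center_def using z by blast
qed

lemma jacobi_from_basis:
  assumes B: "span B = UNIV"
    and J: "\<And>x y w. x \<in> B \<Longrightarrow> y \<in> B \<Longrightarrow> w \<in> B \<Longrightarrow>
      bracket x (bracket y w) + bracket y (bracket w x) + bracket w (bracket x y) = 0"
  shows satisfies_jacobi
proof -
  define j where "j = (\<lambda>x y w. bracket x (bracket y w) + bracket y (bracket w x) + bracket w (bracket x y))"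
  have add: "j (x + x') y w = j x y w + j x' y w" "j y (x + x') w = j y x w + j y x' w"
    "j y w (x + x') = j y w x + j y w x'" for x x' y w
    by (simp_all add: j_def bracket_add_left bracket_add_right add_ac)
  have scaled: "j (scale a x) y w = scale a (j x y w)" "j y (scale a x) w = scale a (j y x w)"
    "j y w (scale a x) = scale a (j y w x)" for a x y w
    by (simp_all add: j_def bracket_scale_left bracket_scale_right scale_right_distrib)
  have zero: "j 0 y w = 0" "j y 0 w = 0" "j y w 0 = 0" for y w
    by (simp_all add: j_def)
  have lin: "subspace {x. j x y w = 0}" "subspace {x. j y x w = 0}" "subspace {x. j y w x = 0}" for y w
    by (simp_all add: subspace_def add scaled zero)
  have 1: "j x y w = 0" if "y \<in> B" "w \<in> B" for x y w
  proof -
    have "span B \<subseteq> {x. j x y w = 0}" using J that by (intro span_minimal lin) (auto simp: j_def)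
    then show ?thesis using B by auto
  qed
  have 2: "j x y w = 0" if "w \<in> B" for x y w
  proof -
    have "span B \<subseteq> {y. j x y w = 0}" using 1 that by (intro span_minimal lin) auto
    then show ?thesis using B by auto
  qed
  have "j x y w = 0" for x y w
  proof -
    have "span B \<subseteq> {w. j x y w = 0}" using 2 by (intro span_minimal lin) auto
    then show ?thesis using B by auto
  qed
  then show ?thesis unfolding satisfies_jacobi_def j_def by blast
qed

text \<open>
  The summands that do not cancel in pairs occur three times.
\<close>

lemma Table_I_alpha_jacobi:
  assumes three: "(3::'k) = 0" and "has_table (Table_I 1 0)" shows satisfies_jacobi
proof -
  obtain e h f v0 v1 z where basis: "is_basis [e, h, f, v0, v1, z]" and z: "\<forall>x. bracket z x = 0"
    and c: "core_products e h f v0 v1 z 0"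
    using assms(2) by auto
  have z': "bracket x z = 0" for x using z bracket_anticommute[of x z] by simp
  have triple: "x + (x + x) = 0" for x :: 'l
  proof -
    have "x + (x + x) = scale (1 + (1 + 1)) x" by (simp only: scale_left_distrib scale_one)
    then show ?thesis using three by simp
  qed
  have double: "x + x = - x" "- x - x = x" for x :: 'l
    using triple[of x] triple[of "- x"] by (simp_all add: eq_neg_iff_add_eq_0 algebra_simps)
  let ?B = "{e, h, f, v0, v1, z}"
  have "\<forall>x\<in>?B. \<forall>y\<in>?B. \<forall>w\<in>?B.
      bracket x (bracket y w) + bracket y (bracket w x) + bracket w (bracket x y) = 0"
    by (simp add: c[unfolded core_products_def] core_anticommute[OF c] bracket_linear z z' triple double add.assoc)
  moreover have "span ?B = UNIV" using basis by (simp add: is_basis_def)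
  ultimately show ?thesis using jacobi_from_basis[of ?B] by metis
qed

text \<open>
  The identity fails for \<open>h, e, v0\<close>, since \<open>[v0, [h, e]] = [v0, v1] = z\<close> is the only term that does not cancel.
\<close>

lemma Table_I_beta_not_jacobi:
  assumes "has_table (Table_I 0 1)" shows "\<not> satisfies_jacobi"
proof
  assume satisfies_jacobi
  obtain e h f v0 v1 z where basis: "is_basis [e, h, f, v0, v1, z]"
    and c: "core_products e h f v0 v1 0 z"
    using assms by auto
  have "bracket h (bracket e v0) + bracket e (bracket v0 h) + bracket v0 (bracket h e) = 0"
    using \<open>satisfies_jacobi\<close> by (simp add: satisfies_jacobi_def)
  then have "z = 0"
    using c[unfolded core_products_def] core_anticommute[OF c] by (simp add: bracket_linear)
  moreover have "z \<notin> span (set [e, h, f, v0, v1])"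
    using basis_not_in_span[OF is_basis_rotate[OF basis]] by simp
  ultimately show False using span_zero by metis
qed

lemma Table_II_derived_algebra:
  assumes basis: "is_basis [d, e, h, f, v0, v1]" and I: "ideal (span {e, h, f, v0, v1})"
    and c: "core_products e h f v0 v1 0 0"
  shows "derived_algebra = span {e, h, f, v0, v1}" "d \<notin> derived_algebra"
proof -
  let ?W = "span {e, h, f, v0, v1}"
  have "bracket x y \<in> ?W" for x y
  proof -
    have "x \<in> span (insert d {e, h, f, v0, v1})" "y \<in> span (insert d {e, h, f, v0, v1})"
      using basis by (simp_all add: is_basis_def)
    then obtain a b where "x - scale a d \<in> ?W" "y - scale b d \<in> ?W" unfolding span_breakdown_eq by blast
    then have "bracket (x - scale a d) y + bracket (scale a d) (y - scale b d) \<in> ?W"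
      using ideal_left[OF I] ideal_right[OF I] by (intro span_add) auto
    then show ?thesis by (simp add: bracket_linear)
  qed
  then have "derived_algebra \<subseteq> ?W" by (intro derived_algebra_subset) auto
  moreover have "?W \<subseteq> derived_algebra"
    using core_in_derived_algebra[OF c] by (intro span_minimal) (auto simp: derived_algebra_def)
  ultimately show "derived_algebra = ?W" by blast
  then show "d \<notin> derived_algebra" using basis_not_in_span[OF basis] by simp
qed

text \<open>
  Bracketing a central element with \<open>v0\<close>, \<open>v1\<close> and \<open>h\<close> leaves only a multiple of \<open>d\<close>.
\<close>

lemma Table_II_no_center:
  assumes basis: "is_basis [d, e, h, f, v0, v1]" and c: "core_products e h f v0 v1 0 0"
    and d: "bracket d e = scale y v1" "bracket d f = scale w v0" "bracket d h = 0" "bracket d v0 = 0" "bracket d v1 = 0"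
    and yw: "y \<noteq> 0 \<or> w \<noteq> 0"
  shows "\<not> has_center"
proof
  assume has_center
  then obtain x where x0: "x \<noteq> 0" and x: "\<forall>u. bracket x u = 0" unfolding has_center_def by blast
  obtain a1 a2 a3 a4 a5 a6 where
    xe: "x = scale a1 d + scale a2 e + scale a3 h + scale a4 f + scale a5 v0 + scale a6 v1"
    using basis_coordinates[OF basis] by blast
  note indep = basis_independent[OF basis]
  note rel = c[unfolded core_products_def] core_anticommute[OF c] d bracket_linear
  have "scale 0 d + scale 0 e + scale 0 h + scale 0 f + scale a3 v0 + scale a4 v1 = 0"
    using x[rule_format, of v0] unfolding xe by (simp add: rel)
  from indep[OF this] have 1: "a3 = 0" "a4 = 0" by auto
  have "scale 0 d + scale 0 e + scale 0 h + scale 0 f + scale a2 v0 + scale 0 v1 = 0"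
    using x[rule_format, of v1] unfolding xe by (simp add: rel 1)
  from indep[OF this] have 2: "a2 = 0" by auto
  have "scale 0 d + scale 0 e + scale 0 h + scale 0 f + scale (- a5) v0 + scale a6 v1 = 0"
    using x[rule_format, of h] unfolding xe by (simp add: rel 1 2)
  from indep[OF this] have 3: "a5 = 0" "a6 = 0" by auto
  have "scale 0 d + scale 0 e + scale 0 h + scale 0 f + scale 0 v0 + scale (a1 * y) v1 = 0"
    using x[rule_format, of e] unfolding xe by (simp add: rel 1 2 3)
  moreover have "scale 0 d + scale 0 e + scale 0 h + scale 0 f + scale (a1 * w) v0 + scale 0 v1 = 0"
    using x[rule_format, of f] unfolding xe by (simp add: rel 1 2 3)
  ultimately have "a1 * y = 0" "a1 * w = 0" using indep by blast+
  then have "a1 = 0" using yw by auto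
  then show False using x0 xe 1 2 3 by simp
qed

lemma Table_II_e_invariants:
  assumes "has_table Table_II_e"
  shows "derived_algebra \<noteq> UNIV" "\<not> has_center" "outer_centralizes_borel"
proof -
  obtain d e h f v0 v1 where basis: "is_basis [d, e, h, f, v0, v1]" and I: "ideal (span {e, h, f, v0, v1})"
    and c: "core_products e h f v0 v1 0 0" and d: "bracket d e = v1" "bracket d h = 0" "bracket d f = 0"
      "bracket d v0 = 0" "bracket d v1 = 0"
    using assms by auto
  show "derived_algebra \<noteq> UNIV" using Table_II_derived_algebra[OF basis I c] by blast
  show "\<not> has_center" using d by (intro Table_II_no_center[OF basis c, of 1 0]) auto
  have "f \<noteq> 0"
    using basis_independent[OF basis, of 0 0 0 1 0 0] by auto
  then show outer_centralizes_borel
    unfolding outer_centralizes_borel_def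
    using Table_II_derived_algebra[OF basis I c] c d
    by (intro exI[of _ d] exI[of _ e] exI[of _ h] exI[of _ f]) (simp add: core_products_def)
qed

text \<open>
  In this table an element outside the derived algebra that commutes with elements \<open>h, f\<close> spanning a
  two-dimensional subalgebra modulo the radical must be a multiple of the basis vector \<open>d\<close>, and the
  subalgebra must be the one spanned by \<open>e\<close> and \<open>h\<close>. There the extension class is visible: because of
  \<open>[h, e] = - e + v\<^sub>1\<close>, no lift of \<open>e\<close> is an eigenvector of a lift of \<open>h\<close>.
\<close>

lemma Table_II_f_invariants:
  assumes "has_table Table_II_f"
  shows "derived_algebra \<noteq> UNIV" "\<not> has_center" "\<not> outer_centralizes_borel"
proof -
  obtain d e h f v0 v1 where basis: "is_basis [d, e, h, f, v0, v1]" and I: "ideal (span {e, h, f, v0, v1})"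
    and c: "core_products e h f v0 v1 0 0" and d: "bracket d f = v0" "bracket d h = 0" "bracket d e = 0"
      "bracket d v0 = 0" "bracket d v1 = 0"
    using assms by auto
  show "derived_algebra \<noteq> UNIV" using Table_II_derived_algebra[OF basis I c] by blast
  show "\<not> has_center" using d by (intro Table_II_no_center[OF basis c, of 0 1]) auto
  have d': "bracket f d = - v0" "bracket h d = 0" "bracket e d = 0" "bracket v0 d = 0" "bracket v1 d = 0"
    using d bracket_anticommute[of f d] bracket_anticommute[of h d] bracket_anticommute[of e d]
      bracket_anticommute[of v0 d] bracket_anticommute[of v1 d] by simp_all
  define comb where "comb = (\<lambda>xd xe xh xf x0 x1.
    scale xd d + scale xe e + scale xh h + scale xf f + scale x0 v0 + scale x1 v1)"
  have comb_eq: "xd = yd \<and> xe = ye \<and> xh = yh \<and> xf = yf \<and> x0 = y0 \<and> x1 = y1"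
    if "comb xd xe xh xf x0 x1 = comb yd ye yh yf y0 y1" for xd xe xh xf x0 x1 yd ye yh yf y0 y1
  proof -
    have "scale (xd - yd) d + scale (xe - ye) e + scale (xh - yh) h + scale (xf - yf) f
        + scale (x0 - y0) v0 + scale (x1 - y1) v1 = 0"
      using that unfolding comb_def by (simp add: algebra_simps)
    from basis_independent[OF basis this] show ?thesis by simp
  qed
  have prod: "bracket (comb xd xe xh xf x0 x1) (comb yd ye yh yf y0 y1) =
      comb 0 (xe * yh - xh * ye) (xe * yf - xf * ye) (xh * yf - xf * yh)
        ((xh * y0 - x0 * yh) + (xe * y1 - x1 * ye) + (xd * yf - xf * yd))
        ((xh * ye - xe * yh) - (xh * y1 - x1 * yh) + (xf * y0 - x0 * yf))"
    for xd xe xh xf x0 x1 yd ye yh yf y0 y1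
    unfolding comb_def
    by (simp add: bracket_linear c[unfolded core_products_def] core_anticommute[OF c] d d' algebra_simps)
  have surj: "\<exists>xd xe xh xf x0 x1. x = comb xd xe xh xf x0 x1" for x
    unfolding comb_def using basis_coordinates[OF basis] .
  show "\<not> outer_centralizes_borel"
  proof
    assume outer_centralizes_borel
    then obtain D E H F where D: "D \<notin> derived_algebra" and eqs: "bracket D H = 0" "bracket D F = 0"
      "bracket H F = F" "F \<noteq> 0" "bracket E F = H"
      unfolding outer_centralizes_borel_def by blast
    obtain Dd De Dh Df D0 D1 where Dc: "D = comb Dd De Dh Df D0 D1" using surj by blast
    obtain Ed Ee Eh Ef E0 E1 where Ec: "E = comb Ed Ee Eh Ef E0 E1" using surj by blast
    obtain Hd He Hh Hf H0 H1 where Hc: "H = comb Hd He Hh Hf H0 H1" using surj by blast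
    obtain Fd Fe Fh Ff F0 F1 where Fc: "F = comb Fd Fe Fh Ff F0 F1" using surj by blast
    have zero: "0 = comb 0 0 0 0 0 0" by (simp add: comb_def)
    have Dd: "Dd \<noteq> 0"
    proof
      assume "Dd = 0"
      then have "D \<in> span {e, h, f, v0, v1}"
        unfolding Dc comb_def by (auto intro!: span_add span_scale intro: span_base)
      then show False using D Table_II_derived_algebra[OF basis I c] by simp
    qed
    note HF = comb_eq[OF eqs(3)[unfolded Hc Fc prod]]
    note EF = comb_eq[OF eqs(5)[unfolded Ec Hc Fc prod]]
    note DH = comb_eq[OF eqs(1)[unfolded Dc Hc prod zero]]
    note DF = comb_eq[OF eqs(2)[unfolded Dc Fc prod zero]]
    have F_nz: "Fe \<noteq> 0 \<or> Fh \<noteq> 0 \<or> Ff \<noteq> 0"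
    proof (rule ccontr)
      assume "\<not> ?thesis"
      then have 0: "Fe = 0" "Fh = 0" "Ff = 0" by auto
      then have "He = 0" "Hh = 0" "Hf = 0" using EF by auto
      then have "Fd = 0" "F0 = 0" "F1 = 0" using 0 HF by auto
      then show False using eqs(4) 0 unfolding Fc zero by simp
    qed
    have 1: "De * Fh = Dh * Fe" "De * Ff = Df * Fe" "Dh * Ff = Df * Fh"
      "De * Hh = Dh * He" "De * Hf = Df * He" "Dh * Hf = Df * Hh"
      using DF DH by auto
    have 2: "He * Fh - Hh * Fe = Fe" "He * Ff - Hf * Fe = Fh" "Hh * Ff - Hf * Fh = Ff"
      using HF by auto
    have "De * Fe = 0" using 1(1,4) 2(1) by algebra
    moreover have "De * Fh = 0" using 1(2,5) 2(2) by algebra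
    moreover have e: "De * Ff = 0" using 1(3,4,5) 2(3) by algebra
    moreover have "Dh * Fe = 0" using 1(1,4) 2(1) by algebra
    moreover have "Dh * Fh = 0" using 1(1,4) 2(2,3) e by algebra
    moreover have h: "Dh * Ff = 0" using 1(3,6) 2(3) by algebra
    moreover have "Df * Fe = 0" "Df * Fh = 0" using 1(2,3) e h by simp_all
    moreover have "Df * Ff = 0" using 1(3,6) 2(3) by algebra
    ultimately have D0: "De = 0" "Dh = 0" "Df = 0" using F_nz by auto
    have 3: "Dd * Ff = D0 * Fh + D1 * Fe" "D1 * Fh = D0 * Ff" "Dd * Hf = D0 * Hh + D1 * He" "D1 * Hh = D0 * Hf"
      using DF DH D0 by (auto simp: algebra_simps eq_neg_iff_add_eq_0)
    have "Dd * (He * Ff - Hf * Fe) = He * (Dd * Ff) - (Dd * Hf) * Fe" by algebra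
    also have "\<dots> = D0 * (He * Fh - Hh * Fe)" unfolding 3(1,3) by algebra
    finally have 4: "Dd * Fh = D0 * Fe" unfolding 2 .
    have "Dd * (Hh * Ff - Hf * Fh) = Hh * (Dd * Ff) - (Dd * Hf) * Fh" by algebra
    also have "\<dots> = - (D1 * (He * Fh - Hh * Fe))" unfolding 3(1,3) by algebra
    finally have 5: "Dd * Ff = - (D1 * Fe)" unfolding 2 .
    have "D1 * (Hh * Ff - Hf * Fh) = (D1 * Hh) * Ff - Hf * (D1 * Fh)" by algebra
    also have "\<dots> = 0" unfolding 3(2,4) by algebra
    finally have 6: "D1 * Ff = 0" unfolding 2 .
    have "D1 * (He * Fh - Hh * Fe) = He * (D1 * Fh) - (D1 * Hh) * Fe" by algebra
    also have "\<dots> = D0 * (He * Ff - Hf * Fe)" unfolding 3(2,4) by algebra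
    finally have 7: "D1 * Fe = D0 * Fh" unfolding 2 .
    have Fe: "Fe \<noteq> 0" using 4 5 Dd F_nz by auto
    have "D1 * D1 * Fe = 0" using 5 6 by algebra
    then have D1: "D1 = 0" using Fe by simp
    then have Ff: "Ff = 0" using 5 D1 Dd by simp
    have "D0 * D0 * Fe = 0" using 4 7 D1 by algebra
    then have D00: "D0 = 0" using Fe by simp
    then have Fh: "Fh = 0" using 4 D00 Dd by simp
    have "Hh * Fe + Fe = He * Fh" using 2(1) by (simp add: diff_eq_eq add.commute)
    then have "(Hh + 1) * Fe = 0" using Fh by (simp add: distrib_right)
    moreover have "Hf * Fe = 0" using 2(2) Fh Ff by simp
    ultimately have "Hh = - 1" "Hf = 0" using Fe by (simp_all add: eq_neg_iff_add_eq_0)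
    then show False using HF Fh Ff Fe by simp
  qed
qed

end

lemma isomorphic_invariants:
  assumes "alternating_algebra scale1 bracket1" "alternating_algebra scale2 bracket2"
    and iso: "algebra_isomorphic scale1 bracket1 scale2 bracket2"
  shows "alternating_algebra.derived_algebra scale1 bracket1 = UNIV \<longleftrightarrow>
      alternating_algebra.derived_algebra scale2 bracket2 = UNIV"
    and "alternating_algebra.has_center bracket1 \<longleftrightarrow> alternating_algebra.has_center bracket2"
    and "alternating_algebra.satisfies_jacobi bracket1 \<longleftrightarrow> alternating_algebra.satisfies_jacobi bracket2"
    and "alternating_algebra.outer_centralizes_borel scale1 bracket1 \<longleftrightarrow>
      alternating_algebra.outer_centralizes_borel scale2 bracket2"
proof -
  interpret L1: alternating_algebra scale1 bracket1 by fact
  interpret L2: alternating_algebra scale2 bracket2 by fact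
  obtain \<phi> where lin: "Vector_Spaces.linear scale1 scale2 \<phi>" and bij: "bij \<phi>"
    and hom: "\<And>x y. \<phi> (bracket1 x y) = bracket2 (\<phi> x) (\<phi> y)"
    using iso unfolding algebra_isomorphic_def by blast
  interpret \<phi>: Vector_Spaces.linear scale1 scale2 \<phi> by fact
  have inj: "\<phi> x = \<phi> y \<longleftrightarrow> x = y" for x y using bij by (simp add: bij_is_inj inj_eq)
  have zero: "\<phi> x = 0 \<longleftrightarrow> x = 0" for x using inj[of x 0] \<phi>.zero by simp
  have surj: "\<exists>x. y = \<phi> x" for y using bij by (metis bij_pointE)
  have ex: "(\<exists>y. Q y) \<longleftrightarrow> (\<exists>x. Q (\<phi> x))" for Q using surj by metis
  have all: "(\<forall>y. Q y) \<longleftrightarrow> (\<forall>x. Q (\<phi> x))" for Q using surj by metis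
  have "\<phi> ` range (\<lambda>(x, y). bracket1 x y) = range (\<lambda>(x, y). bracket2 x y)"
  proof (intro equalityI subsetI)
    fix w assume "w \<in> range (\<lambda>(x, y). bracket2 x y)"
    then obtain u v where w: "w = bracket2 u v" by auto
    obtain x y where "u = \<phi> x" "v = \<phi> y" using surj by metis
    then have "w = \<phi> (bracket1 x y)" using w hom by simp
    then show "w \<in> \<phi> ` range (\<lambda>(x, y). bracket1 x y)" by auto
  next
    fix w assume "w \<in> \<phi> ` range (\<lambda>(x, y). bracket1 x y)"
    then obtain x y where "w = bracket2 (\<phi> x) (\<phi> y)" by (auto simp: hom)
    then show "w \<in> range (\<lambda>(x, y). bracket2 x y)" by (intro range_eqI[of _ _ "(\<phi> x, \<phi> y)"]) simp
  qed
  then have image: "\<phi> ` L1.derived_algebra = L2.derived_algebra"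
    unfolding L1.derived_algebra_def L2.derived_algebra_def by (simp flip: \<phi>.span_image)
  then have mem: "\<phi> x \<in> L2.derived_algebra \<longleftrightarrow> x \<in> L1.derived_algebra" for x
    using inj by (metis image_iff)
  show "L1.derived_algebra = UNIV \<longleftrightarrow> L2.derived_algebra = UNIV"
    using mem surj by (metis UNIV_I UNIV_eq_I)
  show "L1.has_center \<longleftrightarrow> L2.has_center"
    unfolding L1.has_center_def L2.has_center_def
    by (simp only: ex all hom[symmetric] zero)
  show "L1.satisfies_jacobi \<longleftrightarrow> L2.satisfies_jacobi"
    unfolding L1.satisfies_jacobi_def L2.satisfies_jacobi_def
    by (simp only: all hom[symmetric] \<phi>.add[symmetric] zero)
  show "L1.outer_centralizes_borel \<longleftrightarrow> L2.outer_centralizes_borel"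
    unfolding L1.outer_centralizes_borel_def L2.outer_centralizes_borel_def
    by (simp only: ex hom[symmetric] zero inj mem)
qed

theorem theorem5p4:
  fixes scale :: "'k::{field,finite} \<Rightarrow> 'l::ab_group_add \<Rightarrow> 'l"
    and bracket :: "'l \<Rightarrow> 'l \<Rightarrow> 'l"
    and p :: nat
    and scale1 :: "'k \<Rightarrow> 'a::ab_group_add \<Rightarrow> 'a"
    and bracket1 :: "'a \<Rightarrow> 'a \<Rightarrow> 'a"
    and scale2 :: "'k \<Rightarrow> 'b::ab_group_add \<Rightarrow> 'b"
    and bracket2 :: "'b \<Rightarrow> 'b \<Rightarrow> 'b"
  shows "(lie_algebra scale bracket \<and> CHAR('k) = p \<and> p \<ge> 3 \<and>
          vector_space.dim scale (UNIV :: 'l set) = 6 \<and>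
          \<not> alternating_algebra.solvable scale bracket UNIV \<and>
          vector_space.dim scale (alternating_algebra.radical scale bracket) = 3 \<and>
          \<not> alternating_algebra.radical_extension_splits scale bracket
            \<longrightarrow> p = 3 \<and> (\<exists>T\<in>classification_tables. alternating_algebra.has_table scale bracket T))
       \<and> (CHAR('k) = 3 \<longrightarrow>
          (\<forall>T\<in>classification_tables. \<forall>T'\<in>classification_tables. T \<noteq> T' \<and>
             alternating_algebra scale1 bracket1 \<and> alternating_algebra.has_table scale1 bracket1 T \<and>
             alternating_algebra scale2 bracket2 \<and> alternating_algebra.has_table scale2 bracket2 T'
               \<longrightarrow> \<not> algebra_isomorphic scale1 bracket1 scale2 bracket2))"
proof (intro conjI impI ballI notI)
  assume asm: "lie_algebra scale bracket \<and> CHAR('k) = p \<and> p \<ge> 3 \<and>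
          vector_space.dim scale (UNIV :: 'l set) = 6 \<and>
          \<not> alternating_algebra.solvable scale bracket UNIV \<and>
          vector_space.dim scale (alternating_algebra.radical scale bracket) = 3 \<and>
          \<not> alternating_algebra.radical_extension_splits scale bracket"
  interpret lie_algebra scale bracket using asm by blast
  have char: "of_nat n = (0::'k) \<longleftrightarrow> p dvd n" for n using asm of_nat_eq_0_iff_char_dvd by blast
  obtain B where B: "independent B" "UNIV \<subseteq> span B" "card B = dim UNIV" using basis_exists[of UNIV] by blast
  have "(2::'k) \<noteq> 0" using char[of 2] asm by (auto dest: dvd_imp_le)
  moreover have "finite B" using B(3) asm by (intro card_ge_0_finite) simp
  ultimately interpret odd_lie_algebra scale bracket B
    using B by unfold_locales auto
  have *: "(3::'k) = 0 \<and> (\<exists>T\<in>classification_tables. has_table T)"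
    using asm by (intro nonsplit_classification) blast+
  then have "p dvd 3" using char[of 3] by simp
  then show "p = 3" using asm dvd_imp_le[of p 3] by simp
  show "\<exists>T\<in>classification_tables. has_table T" using * by blast
next
  fix T T' :: "'k mult_table"
  assume char: "CHAR('k) = 3" and T: "T \<in> classification_tables" "T' \<in> classification_tables"
    and asm: "T \<noteq> T' \<and> alternating_algebra scale1 bracket1 \<and> alternating_algebra.has_table scale1 bracket1 T \<and>
             alternating_algebra scale2 bracket2 \<and> alternating_algebra.has_table scale2 bracket2 T'"
    and iso: "algebra_isomorphic scale1 bracket1 scale2 bracket2"
  have three: "(3::'k) = 0" using of_nat_CHAR[where 'a = 'k] char by simp
  interpret L1: alternating_algebra scale1 bracket1 using asm by blast
  interpret L2: alternating_algebra scale2 bracket2 using asm by blast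
  note inv = isomorphic_invariants[OF L1.alternating_algebra_axioms L2.alternating_algebra_axioms iso]
  have h1: "L1.has_table T" and h2: "L2.has_table T'" and ne: "T \<noteq> T'" using asm by auto
  have cases: "S = Table_I 0 0 \<or> S = Table_I 0 1 \<or> S = Table_I 1 0 \<or> S = Table_II_e \<or> S = Table_II_f"
    if "S \<in> classification_tables" for S :: "'k mult_table"
    using that unfolding classification_tables_def by blast
  note facts1 = L1.Table_I_perfect[of 0 1] L1.Table_I_perfect[of 1 0] L1.Table_I_zero L1.Table_I_alpha_jacobi[OF three]
    L1.Table_I_beta_not_jacobi L1.Table_II_e_invariants L1.Table_II_f_invariants
  note facts2 = L2.Table_I_perfect[of 0 1] L2.Table_I_perfect[of 1 0] L2.Table_I_zero L2.Table_I_alpha_jacobi[OF three]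
    L2.Table_I_beta_not_jacobi L2.Table_II_e_invariants L2.Table_II_f_invariants
  from cases[OF T(1)] cases[OF T(2)] h1 h2 ne inv facts1 facts2 show False
    by (elim disjE) (simp_all del: L1.has_table.simps L2.has_table.simps)
qed

end
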